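(* Let $d>1$ and let $\Gamma$ be a sub-semigroup of $M_{inv}(d,\mathbb{Z})=GL(d,\mathbb{R})\cap M(d,\mathbb{Z})$ such that $\Gamma$ contains an element which is both proximal and expanding and the $\Gamma$-action on $\mathbb{R}^d$ is strongly irreducible. Then the semigroup $\Gamma$ acting on $\mathbb{T}^d=\mathbb{R}^d/\mathbb{Z}^d$ has the ID-property, that is, every infinite $\Gamma$-invariant subset of $\mathbb{T}^d$ is dense in $\mathbb{T}^d$.
   Context: $M(d,\mathbb{Z})$ is the set of $d\times d$ matrices with integer entries; $M_{inv}(d,\mathbb{Z})$ is a semigroup under multiplication and acts by endomorphisms on $\mathbb{T}^d$. A matrix $\gamma\in GL(d,\mathbb{R})$ is proximal if it has an eigenvalue $\lambda_\gamma$ with $|\lambda_\gamma|>|\lambda|$ for all other (complex) eigenvalues $\lambda$ of $\gamma$, counted with algebraic multiplicity (so $\lambda_\gamma$ is real and simple). It is expanding if it has an eigenvalue $\lambda$ with $|\lambda|>1$. The $\Gamma$-action on $\mathbb{R}^d$ is strongly irreducible if there is no finite union $W_1\cup\dots\cup W_n$ ($n\ge 1$) of non-zero proper subspaces of $\mathbb{R}^d$ which is $\Gamma$-invariant. A set $\Sigma$ is $\Gamma$-invariant if $\gamma\Sigma\subset\Sigma$ for all $\gamma\in\Gamma$. *)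

theory Defs
  imports
    "HOL-Analysis.Analysis"
    "HOL-Computational_Algebra.Computational_Algebra"
begin

definition charpoly :: "'a::comm_ring_1^'n^'n \<Rightarrow> 'a poly" where
  "charpoly A = det (mat [:0, 1:] - map_matrix (\<lambda>a. [:a:]) A)"

text \<open>The multiset of complex eigenvalues of a real matrix, each one repeated according to its
  algebraic multiplicity.\<close>

definition eigenvalues :: "real^'n^'n \<Rightarrow> complex multiset" where
  "eigenvalues A = proots (charpoly (map_matrix complex_of_real A))"

text \<open>Only one copy of the dominant eigenvalue is removed, so that it is forced to be simple.\<close>

definition proximal :: "real^'n^'n \<Rightarrow> bool" where
  "proximal A \<longleftrightarrow>
    (\<exists>l. l \<in># eigenvalues A \<and> (\<forall>m. m \<in># eigenvalues A - {#l#} \<longrightarrow> cmod l > cmod m))"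

definition expanding :: "real^'n^'n \<Rightarrow> bool" where
  "expanding A \<longleftrightarrow> (\<exists>l. l \<in># eigenvalues A \<and> cmod l > 1)"

lemma poly_charpoly: "poly (charpoly A) x = det (mat x - A)"
proof -
  have "poly ((mat [:0, 1:] - map_matrix (\<lambda>a. [:a:]) A) $ i $ j) x = (mat x - A) $ i $ j" for i j
    by (simp add: mat_def)
  then show ?thesis
    unfolding charpoly_def det_def by (simp add: poly_sum poly_prod)
qed

lemma det_eq_0_iff_kernel:
  fixes A :: "'a::field^'n^'n"
  shows "det A = 0 \<longleftrightarrow> (\<exists>v. v \<noteq> 0 \<and> A *v v = 0)"
  using invertible_det_nz[of A] matrix_left_invertible_ker[of A] invertible_left_inverse[of A]
  by auto

lemma poly_charpoly_eq_0_iff: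
  fixes A :: "'a::field^'n^'n"
  shows "poly (charpoly A) l = 0 \<longleftrightarrow> (\<exists>v. v \<noteq> 0 \<and> A *v v = l *s v)"
proof -
  have "(mat l - A) *v v = l *s v - A *v v" for v
  proof -
    have "mat l *v v = l *s v"
      by (simp add: vec_eq_iff matrix_vector_mult_def mat_def if_distrib if_distribR cong: if_cong)
    then show ?thesis
      by (simp add: matrix_vector_mult_diff_rdistrib)
  qed
  then show ?thesis
    by (auto simp: poly_charpoly det_eq_0_iff_kernel)
qed

lemma charpoly_nonzero:
  fixes A :: "complex^'n^'n"
  shows "charpoly A \<noteq> 0"
proof
  assume 0: "charpoly A = 0"
  have "bounded_linear ((*v) A)"
    by (rule matrix_vector_mul_bounded_linear)
  then obtain K where K: "norm (A *v v) \<le> norm v * K" for v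
    using bounded_linear.bounded by blast
  from 0 obtain v where "v \<noteq> 0" and v: "A *v v = complex_of_real (\<bar>K\<bar> + 1) *s v"
    using poly_charpoly_eq_0_iff[of A "complex_of_real (\<bar>K\<bar> + 1)"] by auto
  have "complex_of_real (\<bar>K\<bar> + 1) *s v = (\<bar>K\<bar> + 1) *\<^sub>R v"
    unfolding vec_eq_iff vector_smult_component vector_scaleR_component
    by (simp only: scaleR_conv_of_real simp_thms)
  then have "(\<bar>K\<bar> + 1) * norm v \<le> K * norm v"
    using K[of v] v by (simp add: mult.commute)
  then show False
    using \<open>v \<noteq> 0\<close> by simp
qed

lemma in_eigenvalues_iff:
  "l \<in># eigenvalues A \<longleftrightarrow> (\<exists>v. v \<noteq> 0 \<and> map_matrix complex_of_real A *v v = l *s v)"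
  using charpoly_nonzero[of "map_matrix complex_of_real A"]
  by (simp add: eigenvalues_def poly_charpoly_eq_0_iff)

definition strongly_irreducible :: "(real^'n^'n) set \<Rightarrow> bool" where
  "strongly_irreducible G \<longleftrightarrow>
    \<not> (\<exists>\<W>. finite \<W> \<and> \<W> \<noteq> {} \<and>
         (\<forall>W\<in>\<W>. subspace W \<and> W \<noteq> {0} \<and> W \<noteq> UNIV) \<and>
         (\<forall>A\<in>G. (*v) A ` \<Union>\<W> \<subseteq> \<Union>\<W>))"

abbreviation real_mat :: "int^'n^'n \<Rightarrow> real^'n^'n" where
  "real_mat \<equiv> map_matrix real_of_int"

definition M_inv :: "(int^'n^'n) set" where
  "M_inv = {A. invertible (real_mat A)}"

definition integer_congruent :: "real^'n \<Rightarrow> real^'n \<Rightarrow> bool" where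
  "integer_congruent x y \<longleftrightarrow> (\<forall>i. x $ i - y $ i \<in> \<int>)"

lemma equivp_integer_congruent: "equivp (integer_congruent :: real^'n \<Rightarrow> real^'n \<Rightarrow> bool)"
  (is "equivp ?R")
proof (rule equivpI)
  show "reflp ?R"
    by (simp add: reflp_def integer_congruent_def)
  show "symp ?R"
  proof (rule sympI)
    fix x y :: "real^'n"
    assume "integer_congruent x y"
    then have "- (x $ i - y $ i) \<in> \<int>" for i
      unfolding integer_congruent_def by (intro Ints_minus) auto
    then show "integer_congruent y x"
      by (simp add: integer_congruent_def)
  qed
  show "transp ?R"
  proof (rule transpI)
    fix x y z :: "real^'n"
    assume *: "integer_congruent x y" "integer_congruent y z"
    have "(x $ i - y $ i) + (y $ i - z $ i) \<in> \<int>" for i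
      using * unfolding integer_congruent_def by (intro Ints_add) auto
    then show "integer_congruent x z"
      by (simp add: integer_congruent_def)
  qed
qed

quotient_type (overloaded) 'n torus = "real^('n::finite)" / integer_congruent
  morphisms torus_rep torus_proj
  by (fact equivp_integer_congruent)

instantiation torus :: (finite) topological_space
begin

definition open_torus :: "'a torus set \<Rightarrow> bool" where
  "open_torus U \<longleftrightarrow> open (torus_proj -` U)"

instance
  by standard (auto simp: open_torus_def vimage_Union)

end

lemma surj_torus_proj: "surj torus_proj"
  by (metis Quotient_abs_rep Quotient_torus surj_def)

lemma quotient_map_torus_proj: "quotient_map euclidean euclidean torus_proj"
  by (auto simp: quotient_map_def open_torus_def vimage_def surj_torus_proj)

lift_definition torus_act :: "int^'n^'n \<Rightarrow> 'n::finite torus \<Rightarrow> 'n torus"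
  is "\<lambda>A x. real_mat A *v x"
proof -
  fix A :: "int^'n^'n" and x y :: "real^'n"
  assume *: "integer_congruent x y"
  have "(\<Sum>j\<in>UNIV. real_of_int (A $ i $ j) * (x $ j - y $ j)) \<in> \<int>" for i
    using * unfolding integer_congruent_def by (intro Ints_sum Ints_mult) auto
  then show "integer_congruent (real_mat A *v x) (real_mat A *v y)"
    by (simp add: integer_congruent_def matrix_vector_mult_def right_diff_distrib sum_subtractf)
qed

definition ID_property :: "(int^'n^'n) set \<Rightarrow> bool" where
  "ID_property \<Gamma> \<longleftrightarrow>
    (\<forall>S :: 'n::finite torus set.
       infinite S \<and> (\<forall>A\<in>\<Gamma>. torus_act A ` S \<subseteq> S) \<longrightarrow> closure S = UNIV)"

end

theory Submission
  imports Defs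
begin

text \<open>
  Pull everything back to \<open>\<real>\<^sup>d\<close>: a closed set \<open>X\<close> that is periodic under the integer lattice,
  invariant under \<open>\<Gamma>\<close> and infinite modulo the lattice has to be all of \<open>\<real>\<^sup>d\<close>.  The engine is that
  matrices of \<open>\<Gamma>\<close> stretch \<open>X\<close> until it contains long straight segments, and that segments in a
  generic direction fill the torus.

  \<^bold>\<open>Segments suffice.\<close>  A long segment in direction \<open>w\<close> is \<open>\<epsilon>\<close>-dense modulo the lattice unless \<open>w\<close> lies
  in one of finitely many rational hyperplanes that depend on \<open>\<epsilon>\<close> only
  (\<open>segment_dense_mod_lattice\<close>).  Strong irreducibility says that the orbit \<open>\<Gamma>u\<close> of a nonzero vector
  is not covered by finitely many hyperplanes (\<open>orbit_not_in_finite_union\<close>), so a segment in any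
  direction \<open>u\<close> can be moved by some \<open>A \<in> \<Gamma>\<close> into a good direction.  Hence a set with arbitrarily
  long segments is everything (\<open>long_segments_imp_UNIV\<close>).

  \<^bold>\<open>Sets that accumulate at 0.\<close>  Let \<open>g\<close> be the square of a proximal and expanding element and \<open>\<lambda> > 1\<close> its
  dominant eigenvalue; then
  \<open>g\<^sup>n / \<lambda>\<^sup>n\<close> tends to the rank one map \<open>x \<mapsto> (f \<bullet> x) v\<close>.  Blowing up points of \<open>X\<close> near 0 by powers
  of \<open>g\<close> yields a closed set \<open>P\<close> of reals, not only 0, such that \<open>t v \<in> X\<close> for \<open>t \<in> P\<close> and \<open>P\<close> is stable under
  multiplication by \<open>\<lambda>\<close>, by \<open>1/\<lambda>\<close> and by every coefficient \<open>f \<bullet> (h v)\<close>, \<open>h \<in> \<Gamma>\<close>.  On a logarithmic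
  scale the positive multipliers that preserve \<open>P\<close> form a closed semigroup of reals that contains
  \<open>ln \<lambda>\<close> and \<open>- ln \<lambda>\<close>; such a semigroup is a group.  Applied to \<open>h g\<^sup>n k\<close>, the coefficients
  divided by \<open>\<lambda>\<^sup>n\<close> converge to \<open>(f \<bullet> h v) (f \<bullet> k v)\<close>, and irreducibility allows \<open>h\<close> and \<open>k\<close> to be chosen so
  that the limit is nonzero and differs from infinitely many of its terms.  So the group is not discrete, hence
  it is the whole line, and \<open>X\<close> contains a ray (\<open>accumulation_at_zero_imp_UNIV\<close>).

  \<^bold>\<open>The general case.\<close>  The derived set \<open>X'\<close> is nonempty, closed, periodic and invariant.  If it contains
  a rational point, then it contains one, \<open>c\<close>, whose orbit on the torus is minimal and which is
  fixed on the torus by a power of \<open>g\<close>.  The stabilizer of \<open>c\<close> satisfies the same hypotheses as \<open>\<Gamma>\<close>, and the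
  translate \<open>X - c\<close> is invariant under it and accumulates at 0
  (\<open>rational_limit_point_imp_UNIV\<close>).  If \<open>X'\<close> contains no rational point, take \<open>t\<close> coprime to
  the determinants of finitely many elements of \<open>\<Gamma>\<close>; the elements congruent to 1 modulo \<open>t\<close> again
  satisfy the hypotheses.  A nonempty closed periodic set \<open>Y \<subseteq> X'\<close> invariant under them is infinite on the
  torus, because finite invariant sets consist of rational points; hence \<open>Y - Y\<close> accumulates at 0
  and is everything.  So \<open>Y\<close> meets \<open>Y - k\<close> for each \<open>k\<close> in the lattice scaled by \<open>1/t\<close>, and as \<open>k\<close> is
  fixed modulo the lattice, the intersection is again invariant.  Running through finitely
  many \<open>k\<close> puts a full translate of the scaled lattice into \<open>X'\<close>, and \<open>t\<close> is arbitrarily large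
  (\<open>irrational_imp_UNIV\<close>).
\<close>

section \<open>Powers of a matrix\<close>

text \<open>On matrices \<open>A ^ n\<close> is the entrywise power.\<close>

primrec mpow :: "'a::semiring_1^'n^'n \<Rightarrow> nat \<Rightarrow> 'a^'n^'n" where
  "mpow A 0 = mat 1"
| "mpow A (Suc n) = A ** mpow A n"

lemma mpow_add: "mpow A (m + n) = mpow A m ** mpow A n"
  by (induction m) (simp_all add: matrix_mul_assoc)

lemma mpow_Suc_right: "mpow A (Suc n) = mpow A n ** A"
  using mpow_add[of A n 1] by simp

lemma mpow_mpow: "mpow (mpow A m) n = mpow A (m * n)"
  by (induction n) (simp_all add: mpow_add)

lemma mpow_closed:
  assumes "\<And>A B. A \<in> G \<Longrightarrow> B \<in> G \<Longrightarrow> A ** B \<in> G" "A \<in> G" "n > 0"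
  shows "mpow A n \<in> G"
  using assms(3)
proof (induction n)
  case (Suc n)
  then show ?case using assms(1,2) by (cases n) auto
qed simp

lemma mpow_commute: "mpow A n *v (A *v x) = A *v (mpow A n *v x)"
  using mpow_Suc_right[of A n] by (simp add: matrix_vector_mul_assoc)

section \<open>Families of subspaces permuted by a semigroup\<close>

text \<open>Strong irreducibility in terms of individual subspaces instead of their union.  In this form the
  hypothesis passes to transposes, to suitable finite subsets and to subsemigroups of finite index, and it makes sense for
  a set of matrices that is not closed under multiplication.\<close>

definition family_irreducible :: "(real^'n^'n) set \<Rightarrow> bool" where
  "family_irreducible G \<longleftrightarrow>
    \<not> (\<exists>\<W>. finite \<W> \<and> \<W> \<noteq> {} \<and>
         (\<forall>W\<in>\<W>. subspace W \<and> W \<noteq> {0} \<and> W \<noteq> UNIV) \<and>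
         (\<forall>A\<in>G. \<forall>W\<in>\<W>. (*v) A ` W \<in> \<W>))"

lemma family_irreducibleD:
  assumes "family_irreducible G" "finite \<W>" "\<W> \<noteq> {}"
    and "\<And>W. W \<in> \<W> \<Longrightarrow> subspace W \<and> W \<noteq> {0} \<and> W \<noteq> UNIV"
    and "\<And>A W. A \<in> G \<Longrightarrow> W \<in> \<W> \<Longrightarrow> (*v) A ` W \<in> \<W>"
  shows False
proof -
  from assms(1) have "\<not> (finite \<W> \<and> \<W> \<noteq> {} \<and>
         (\<forall>W\<in>\<W>. subspace W \<and> W \<noteq> {0} \<and> W \<noteq> UNIV) \<and>
         (\<forall>A\<in>G. \<forall>W\<in>\<W>. (*v) A ` W \<in> \<W>))"
    unfolding family_irreducible_def not_ex by (rule spec)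
  then show False using assms(2-) by simp
qed

lemma strongly_irreducible_imp_family_irreducible:
  fixes G :: "(real^'n^'n) set"
  shows "strongly_irreducible G \<Longrightarrow> family_irreducible G"
  unfolding family_irreducible_def
proof (rule notI, elim exE conjE)
  fix \<W> :: "(real^'n) set set"
  assume irr: "strongly_irreducible G" and W: "finite \<W>" "\<W> \<noteq> {}"
    "\<forall>W\<in>\<W>. subspace W \<and> W \<noteq> {0} \<and> W \<noteq> UNIV" and stable: "\<forall>A\<in>G. \<forall>W\<in>\<W>. (*v) A ` W \<in> \<W>"
  have "\<forall>A\<in>G. (*v) A ` \<Union>\<W> \<subseteq> \<Union>\<W>"
    using stable by blast
  with irr W show False
    unfolding strongly_irreducible_def by metis
qed

lemma family_irreducible_mono:
  fixes F G :: "(real^'n^'n) set"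
  assumes "family_irreducible F" "F \<subseteq> G"
  shows "family_irreducible G"
  unfolding family_irreducible_def
proof (rule notI, elim exE conjE)
  fix \<W> :: "(real^'n) set set"
  assume W: "finite \<W>" "\<W> \<noteq> {}" "\<forall>W\<in>\<W>. subspace W \<and> W \<noteq> {0} \<and> W \<noteq> UNIV"
    "\<forall>A\<in>G. \<forall>W\<in>\<W>. (*v) A ` W \<in> \<W>"
  show False
    by (rule family_irreducibleD[OF assms(1) W(1,2)]) (use W(3,4) assms(2) in auto)
qed

lemma inj_invertible: "invertible A \<Longrightarrow> inj ((*v) (A :: real^'n^'n))"
  by (simp add: inj_matrix_vector_mult)

lemma dim_invertible_image: "invertible A \<Longrightarrow> dim ((*v) (A :: real^'n^'n) ` S) = dim S"
  using inj_on_subset[OF inj_invertible subset_UNIV] by (intro dim_image_eq) auto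

text \<open>Invertibility makes the action on subspaces injective, so on a finite invariant family it is a permutation.\<close>

lemma image_family_eq:
  assumes "finite \<W>" "invertible (A :: real^'n^'n)" "\<And>W. W \<in> \<W> \<Longrightarrow> (*v) A ` W \<in> \<W>"
  shows "(`) ((*v) A) ` \<W> = \<W>"
proof (rule endo_inj_surj)
  show "inj_on ((`) ((*v) A)) \<W>"
    using inj_invertible[OF assms(2)] by (simp add: inj_image_eq_iff inj_on_def)
qed (use assms in auto)

text \<open>Among all finite covers of the orbit by proper subspaces take one whose largest dimension \<open>k\<close> is least and
  which then has the fewest members of dimension \<open>k\<close>.  For \<open>A \<in> G\<close> the preimages under \<open>A\<close> also cover the
  orbit, hence so do the pairwise intersections; minimality forces every top-dimensional member to survive
  the intersection, that is, \<open>A\<close> maps it to another one.  So the top-dimensional members form an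
  invariant family.\<close>

lemma orbit_not_in_finite_union:
  fixes G :: "(real^'n^'n) set"
  assumes ne: "G \<noteq> {}" and mult: "\<And>A B. A \<in> G \<Longrightarrow> B \<in> G \<Longrightarrow> A ** B \<in> G"
    and inv: "\<And>A. A \<in> G \<Longrightarrow> invertible A" and irr: "family_irreducible G"
    and v: "v \<noteq> 0" and fin: "finite \<U>" and sub: "\<And>U. U \<in> \<U> \<Longrightarrow> subspace U \<and> U \<noteq> UNIV"
  shows "\<exists>A\<in>G. A *v v \<notin> \<Union>\<U>"
proof (rule ccontr)
  assume neg: "\<not> (\<exists>A\<in>G. A *v v \<notin> \<Union>\<U>)"
  define covers where "covers k \<V> \<longleftrightarrow> finite \<V> \<and> (\<forall>U\<in>\<V>. subspace U \<and> U \<noteq> UNIV \<and> dim U \<le> k) \<and>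
      (\<forall>A\<in>G. A *v v \<in> \<Union>\<V>)" for k and \<V> :: "(real^'n) set set"
  define top_part where "top_part k \<V> = {U\<in>\<V>. dim U = k}" for k and \<V> :: "(real^'n) set set"
  have "covers DIM(real^'n) \<U>"
    using neg fin sub dim_subset_UNIV unfolding covers_def by blast
  then have ex: "\<exists>k \<V>. covers k \<V>" by blast
  define k where "k = (LEAST k. \<exists>\<V>. covers k \<V>)"
  have exk: "\<exists>\<V>. covers k \<V>"
    using LeastI_ex[OF ex] by (simp add: k_def)
  have min_k: "k \<le> k'" if "covers k' \<V>" for k' \<V>
    unfolding k_def using that by (intro Least_le) blast
  define m where "m = (LEAST m. \<exists>\<V>. covers k \<V> \<and> card (top_part k \<V>) = m)"
  have "\<exists>\<V>. covers k \<V> \<and> card (top_part k \<V>) = m"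
    unfolding m_def by (rule LeastI_ex) (use exk in blast)
  then obtain \<V> where cov: "covers k \<V>" and card_m: "card (top_part k \<V>) = m"
    by blast
  have min_m: "m \<le> card (top_part k \<V>')" if "covers k \<V>'" for \<V>'
    unfolding m_def using that by (intro Least_le) blast
  have fin_top: "finite (top_part k \<V>)"
    using cov by (simp add: covers_def top_part_def)
  obtain A0 where A0: "A0 \<in> G" using ne by blast
  have "A0 *v v \<noteq> 0"
    using inj_invertible[OF inv[OF A0]] v by (metis injD matrix_vector_mult_0_right)
  moreover obtain U0 where "U0 \<in> \<V>" "A0 *v v \<in> U0"
    using cov A0 unfolding covers_def by blast
  ultimately have "dim U0 > 0" "dim U0 \<le> k"
    using cov unfolding covers_def by (auto simp: dim_eq_0 neq0_conv[symmetric] simp del: neq0_conv)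
  then have k_pos: "k > 0" by simp
  have top_ne: "top_part k \<V> \<noteq> {}"
  proof
    assume "top_part k \<V> = {}"
    then have "covers (k - 1) \<V>"
      using cov unfolding covers_def top_part_def
      by (metis (mono_tags, lifting) One_nat_def Suc_pred empty_iff k_pos le_Suc_eq mem_Collect_eq)
    from min_k[OF this] k_pos show False by simp
  qed
  \<comment> \<open>Refining the cover by \<open>A\<close> keeps only those top-dimensional members that \<open>A\<close> maps to top-dimensional ones; by minimality of \<open>m\<close> these are all.\<close>
  have stable: "(*v) A ` U \<in> top_part k \<V>" if A: "A \<in> G" and U: "U \<in> top_part k \<V>" for A U
  proof -
    define \<V>' where "\<V>' = (\<lambda>(U, U'). U \<inter> (*v) A -` U') ` (\<V> \<times> \<V>)"
    have "covers k \<V>'"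
      unfolding covers_def
    proof (intro conjI ballI)
      show "finite \<V>'" using cov by (auto simp: \<V>'_def covers_def)
      fix V assume "V \<in> \<V>'"
      then obtain U U' where UU: "U \<in> \<V>" "U' \<in> \<V>" and V: "V = U \<inter> (*v) A -` U'"
        by (auto simp: \<V>'_def)
      have sU: "subspace U" "subspace U'" "U \<noteq> UNIV" "dim U \<le> k"
        using cov UU by (auto simp: covers_def)
      show "subspace V"
        unfolding V by (intro subspace_inter sU linear_subspace_vimage) auto
      show "V \<noteq> UNIV" using sU V by auto
      have "dim V \<le> dim U" unfolding V by (intro dim_subset) auto
      then show "dim V \<le> k" using sU by simp
    next
      fix B assume B: "B \<in> G"
      obtain U where "U \<in> \<V>" "B *v v \<in> U"
        using cov B by (auto simp: covers_def)
      moreover obtain U' where "U' \<in> \<V>" "(A ** B) *v v \<in> U'"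
        using cov mult[OF A B] unfolding covers_def by blast
      ultimately show "B *v v \<in> \<Union>\<V>'"
        unfolding \<V>'_def by (auto simp: matrix_vector_mul_assoc)
    qed
    define stay where "stay = {U \<in> top_part k \<V>. (*v) A ` U \<in> top_part k \<V>}"
    have "top_part k \<V>' \<subseteq> stay"
    proof
      fix V assume "V \<in> top_part k \<V>'"
      then obtain U U' where UU: "U \<in> \<V>" "U' \<in> \<V>" and V: "V = U \<inter> (*v) A -` U'" and dV: "dim V = k"
        by (auto simp: \<V>'_def top_part_def)
      have sU: "subspace U" "subspace U'" "dim U \<le> k" "dim U' \<le> k"
        using cov UU by (auto simp: covers_def)
      have sV: "subspace V"
        unfolding V by (intro subspace_inter sU linear_subspace_vimage) auto
      have VU: "V = U"
        using subspace_dim_equal[OF sV sU(1)] V dV sU by auto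
      have "(*v) A ` V = U'"
      proof (rule subspace_dim_equal)
        show "subspace ((*v) A ` V)" by (intro linear_subspace_image sV) auto
        show "dim U' \<le> dim ((*v) A ` V)"
          using dim_invertible_image[OF inv[OF A]] dV sU by simp
      qed (use sU V in auto)
      then show "V \<in> stay"
        using VU UU dV dim_invertible_image[OF inv[OF A], of V] by (auto simp: stay_def top_part_def)
    qed
    moreover have "finite stay" using fin_top by (simp add: stay_def)
    ultimately have "card (top_part k \<V>) \<le> card stay"
      using min_m[OF \<open>covers k \<V>'\<close>] card_m card_mono[of stay "top_part k \<V>'"] by linarith
    then have "stay = top_part k \<V>"
      using fin_top by (intro card_seteq) (auto simp: stay_def)
    then show ?thesis using U by (auto simp: stay_def)
  qed
  show False
  proof (rule family_irreducibleD[OF irr fin_top top_ne])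
    fix W assume "W \<in> top_part k \<V>"
    then show "subspace W \<and> W \<noteq> {0} \<and> W \<noteq> UNIV"
      using cov k_pos by (auto simp: top_part_def covers_def)
  qed (fact stable)
qed

text \<open>If \<open>A\<^sup>T\<close> permutes a family of subspaces then \<open>A\<close> permutes their orthogonal complements.\<close>

lemma family_irreducible_transpose:
  fixes G :: "(real^'n^'n) set"
  assumes inv: "\<And>A. A \<in> G \<Longrightarrow> invertible A" and irr: "family_irreducible G"
  shows "family_irreducible (transpose ` G)"
  unfolding family_irreducible_def
proof (rule notI, elim exE conjE)
  fix \<W> :: "(real^'n) set set"
  assume fin: "finite \<W>" and ne: "\<W> \<noteq> {}"
    and sub: "\<forall>W\<in>\<W>. subspace W \<and> W \<noteq> {0} \<and> W \<noteq> UNIV"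
    and stable: "\<forall>A\<in>transpose ` G. \<forall>W\<in>\<W>. (*v) A ` W \<in> \<W>"
  show False
  proof (rule family_irreducibleD[OF irr, of "orthogonal_comp ` \<W>"])
    show "subspace W \<and> W \<noteq> {0} \<and> W \<noteq> UNIV" if "W \<in> orthogonal_comp ` \<W>" for W
      using that sub subspace_orthogonal_comp orthogonal_comp_self
      by (metis (no_types, lifting) imageE orthogonal_comp_UNIV orthogonal_comp_null)
    fix A W assume A: "A \<in> G" and "W \<in> orthogonal_comp ` \<W>"
    then obtain V where V: "V \<in> \<W>" "W = V\<^sup>\<bottom>" by blast
    have invT: "invertible (transpose A)" by (rule transpose_invertible[OF inv[OF A]])
    have "(`) ((*v) (transpose A)) ` \<W> = \<W>"
      by (rule image_family_eq) (use fin invT stable A in auto)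
    then obtain V' where V': "V' \<in> \<W>" "V = (*v) (transpose A) ` V'"
      using V by blast
    have mem: "x \<in> W \<longleftrightarrow> A *v x \<in> V'\<^sup>\<bottom>" for x
      unfolding V V' orthogonal_comp_def orthogonal_def
      by (simp add: dot_lmul_matrix)
    have "surj ((*v) A)"
      using inj_invertible[OF inv[OF A]] by (simp add: linear_injective_imp_surjective)
    then have "(*v) A ` W = V'\<^sup>\<bottom>"
      using mem by (auto simp: image_iff) (metis surjE)
    then show "(*v) A ` W \<in> orthogonal_comp ` \<W>" using V' by blast
  qed (use fin ne in auto)
qed

text \<open>The matrices of \<open>K\<close> serve as coset representatives for \<open>H\<close> in \<open>G\<close>: the \<open>G\<close>-translates of an
  \<open>H\<close>-invariant family are preimages of its members under matrices of \<open>K\<close>, so they are again finite in number.\<close>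

lemma family_irreducible_finite_index:
  fixes G H K :: "(real^'n^'n) set"
  assumes mult: "\<And>A B. A \<in> G \<Longrightarrow> B \<in> G \<Longrightarrow> A ** B \<in> G" and ne: "G \<noteq> {}"
    and inv: "\<And>A. A \<in> G \<Longrightarrow> invertible A" and irr: "family_irreducible G"
    and K: "finite K" "K \<subseteq> G" and ret: "\<And>A. A \<in> G \<Longrightarrow> \<exists>B\<in>K. B ** A \<in> H"
  shows "family_irreducible H"
  unfolding family_irreducible_def
proof (rule notI, elim exE conjE)
  fix \<W> :: "(real^'n) set set"
  assume fin: "finite \<W>" and ne_W: "\<W> \<noteq> {}"
    and sub: "\<forall>W\<in>\<W>. subspace W \<and> W \<noteq> {0} \<and> W \<noteq> UNIV"
    and stable: "\<forall>A\<in>H. \<forall>W\<in>\<W>. (*v) A ` W \<in> \<W>"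
  define \<V> where "\<V> = (\<lambda>(A, W). (*v) A ` W) ` (G \<times> \<W>)"
  have "\<V> \<subseteq> (\<lambda>(B, W). (*v) B -` W) ` (K \<times> \<W>)"
  proof
    fix V assume "V \<in> \<V>"
    then obtain A W where AW: "A \<in> G" "W \<in> \<W>" "V = (*v) A ` W" by (auto simp: \<V>_def)
    obtain B where B: "B \<in> K" "B ** A \<in> H" using ret[OF AW(1)] by blast
    have "(*v) (B ** A) ` W = (*v) B ` V"
      by (auto simp: AW image_image matrix_vector_mul_assoc)
    then have "(*v) B ` V \<in> \<W>" using stable B AW by metis
    moreover have "V = (*v) B -` ((*v) B ` V)"
      using inj_invertible[of B] inv B K by (metis inj_vimage_image_eq subsetD)
    ultimately show "V \<in> (\<lambda>(B, W). (*v) B -` W) ` (K \<times> \<W>)"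
      using B by (intro image_eqI[where x = "(B, (*v) B ` V)"]) auto
  qed
  then have fin_V: "finite \<V>"
    using fin K by (meson finite_SigmaI finite_imageI finite_subset)
  show False
  proof (rule family_irreducibleD[OF irr fin_V])
    show "\<V> \<noteq> {}" using ne ne_W by (auto simp: \<V>_def)
    fix V assume "V \<in> \<V>"
    then obtain A W where AW: "A \<in> G" "W \<in> \<W>" "V = (*v) A ` W" by (auto simp: \<V>_def)
    have W: "subspace W" "W \<noteq> {0}" "W \<noteq> UNIV" using sub AW by auto
    have d: "dim V = dim W" using AW dim_invertible_image inv by metis
    have sV: "subspace V" unfolding AW by (intro linear_subspace_image W) auto
    have "dim W \<noteq> 0" using W(2) subspace_0[OF W(1)] by auto
    then have "V \<noteq> {0}" using d by auto
    moreover have "V \<noteq> UNIV"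
    proof
      assume "V = UNIV"
      then have "dim (UNIV :: (real^'n) set) \<le> dim W" using d by simp
      then show False using subspace_dim_equal[OF W(1) subspace_UNIV subset_UNIV] W(3) by blast
    qed
    ultimately show "subspace V \<and> V \<noteq> {0} \<and> V \<noteq> UNIV" using sV by blast
  next
    fix A V assume A: "A \<in> G" and "V \<in> \<V>"
    then obtain B W where AW: "B \<in> G" "W \<in> \<W>" "V = (*v) B ` W" by (auto simp: \<V>_def)
    have "(*v) A ` V = (*v) (A ** B) ` W"
      by (auto simp: AW image_image matrix_vector_mul_assoc)
    moreover have "(A ** B, W) \<in> G \<times> \<W>"
      using mult[OF A AW(1)] AW(2) by blast
    ultimately show "(*v) A ` V \<in> \<V>"
      unfolding \<V>_def by (metis (no_types, lifting) case_prod_conv image_eqI)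
  qed
qed

section \<open>Powers of a proximal matrix\<close>

text \<open>A simple root of the characteristic polynomial has a one-dimensional generalized eigenspace.  If \<open>v\<close> and \<open>w\<close> were
  independent, they could be completed to an invertible matrix \<open>P\<close>; two columns of \<open>(z - B) P\<close>
  would give factors \<open>z - l\<close> of the determinant, making \<open>l\<close> a double root.\<close>

lemma simple_root_kernel:
  fixes B :: "complex^'n^'n"
  assumes ord: "order l (charpoly B) = 1" and v: "v \<noteq> 0" "B *v v = l *s v"
    and w: "B *v w - l *s w = c *s v"
  shows "\<exists>a. w = a *s v"
proof (rule ccontr)
  assume neg: "\<not> (\<exists>a. w = a *s v)"
  obtain i0 where i0: "v $ i0 \<noteq> 0" using v(1) by (auto simp: vec_eq_iff)
  define w' where "w' = w - (w $ i0 / v $ i0) *s v"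
  have w'0: "w' $ i0 = 0" using i0 by (simp add: w'_def)
  have "w' \<noteq> 0" using neg by (auto simp: w'_def)
  then obtain i1 where i1: "w' $ i1 \<noteq> 0" by (auto simp: vec_eq_iff)
  have i01: "i1 \<noteq> i0" using i1 w'0 by auto
  have Bw': "B *v w' = l *s w' + c *s v"
  proof -
    have "B *v w' = B *v w - (w $ i0 / v $ i0) *s (l *s v)"
      by (simp add: w'_def matrix_vector_mult_diff_distrib vector_scalar_commute v(2))
    also have "B *v w = l *s w + c *s v" using w by (simp add: algebra_simps)
    finally show ?thesis
      by (simp add: w'_def vec_eq_iff algebra_simps)
  qed
  define P where "P = (\<chi> i j. if j = i0 then v $ i else if j = i1 then w' $ i else if i = j then 1 else 0)"
  have Px: "(P *v x) $ i = v $ i * x $ i0 + w' $ i * x $ i1 + (if i = i0 \<or> i = i1 then 0 else x $ i)" for x i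
  proof -
    have "(P *v x) $ i = (\<Sum>j\<in>UNIV. (if j = i0 then v $ i * x $ i0 else 0) + (if j = i1 then w' $ i * x $ i1 else 0)
         + (if j = i then (if i = i0 \<or> i = i1 then 0 else x $ i) else 0))"
      unfolding matrix_vector_mult_def P_def using i01 by (auto intro!: sum.cong)
    then show ?thesis by (simp add: sum.distrib)
  qed
  have "det P \<noteq> 0"
  proof
    assume "det P = 0"
    then obtain x where x: "x \<noteq> 0" "P *v x = 0" using det_eq_0_iff_kernel by blast
    have eq: "v $ i * x $ i0 + w' $ i * x $ i1 + (if i = i0 \<or> i = i1 then 0 else x $ i) = 0" for i
      using Px[of x i] x(2) by simp
    have x0: "x $ i0 = 0" using eq[of i0] i0 w'0 by simp
    have x1: "x $ i1 = 0" using eq[of i1] i1 x0 by simp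
    have "x $ i = 0" for i using eq[of i] x0 x1 by (auto split: if_splits)
    then show False using x(1) by (simp add: vec_eq_iff)
  qed
  \<comment> \<open>The column operations on \<open>(z - B) P\<close> are carried out as row operations on its transpose.\<close>
  define r where "r z j = column j ((mat z - B) ** P)" for z j
  define D where "D z = det (\<chi> j. if j = i1 then w' else if j = i0 then v else r z j)" for z
  have matz: "mat z *v x = z *s x" for z :: complex and x :: "complex^'n"
    by (simp add: vec_eq_iff matrix_vector_mult_def mat_def if_distrib if_distribR cong: if_cong)
  have colM: "column j (M ** P) = M *v column j P" for j and M :: "complex^'n^'n"
    by (simp add: vec_eq_iff column_def matrix_matrix_mult_def matrix_vector_mult_def)
  have c0: "column i0 P = v" by (simp add: column_def P_def vec_eq_iff)
  have c1: "column i1 P = w'" using i01 by (simp add: column_def P_def vec_eq_iff)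
  have r0: "r z i0 = (z - l) *s v" for z
    by (simp add: r_def colM c0 matrix_vector_mult_diff_rdistrib matz v(2) vec_eq_iff algebra_simps)
  have r1: "r z i1 = (z - l) *s w' + (- c) *s v" for z
    by (simp add: r_def colM c1 matrix_vector_mult_diff_rdistrib matz Bw' vec_eq_iff algebra_simps)
  have detP: "det (mat z - B) * det P = (z - l) * ((z - l) * D z)" for z
  proof -
    have "det (mat z - B) * det P = det (transpose ((mat z - B) ** P))"
      by (simp add: det_mul)
    also have "transpose ((mat z - B) ** P) = (\<chi> j. if j = i0 then (z - l) *s v else
         (if j = i1 then (z - l) *s w' + (- c) *s v else r z j))"
      using r0[of z] r1[of z] by (auto simp: r_def vec_eq_iff transpose_def column_def)
    also have "det \<dots> = (z - l) * det (\<chi> j. if j = i0 then v else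
         (if j = i1 then (z - l) *s w' + (- c) *s v else r z j))"
      by (rule det_row_mul)
    also have "det (\<chi> j. if j = i0 then v else
         (if j = i1 then (z - l) *s w' + (- c) *s v else r z j)) =
         det (\<chi> j. if j = i1 then (z - l) *s w' else if j = i0 then v else r z j)" (is "det ?X = det ?Y")
    proof -
      have "?X = (\<chi> k. if k = i1 then row i1 ?Y + (- c) *s row i0 ?Y else row k ?Y)"
        using i01 by (auto simp: vec_eq_iff row_def)
      then show ?thesis using det_row_operation[OF i01, of ?Y "- c"] by simp
    qed
    also have "\<dots> = (z - l) * D z"
      unfolding D_def by (rule det_row_mul)
    finally show ?thesis .
  qed
  have "charpoly B \<noteq> 0" by (rule charpoly_nonzero)
  from order_decomp[OF this, of l] ord obtain q where q: "charpoly B = [:- l, 1:] * q" "\<not> [:- l, 1:] dvd q"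
    by auto
  have "poly q l \<noteq> 0" using q(2) by (simp add: poly_eq_0_iff_dvd)
  have eq: "poly q z * det P = (z - l) * D z" if "z \<noteq> l" for z
  proof -
    have "det (mat z - B) = (z - l) * poly q z"
      unfolding poly_charpoly[symmetric] q(1) poly_mult by simp
    then have "(z - l) * (poly q z * det P) = (z - l) * ((z - l) * D z)"
      using detP[of z] by (simp only: mult.assoc)
    then show ?thesis using that by simp
  qed
  have r_entry: "r z j $ i = (\<Sum>k\<in>UNIV. ((if i = k then z else 0) - B $ i $ k) * P $ k $ j)" for z i j
    by (simp add: r_def column_def matrix_matrix_mult_def mat_def)
  have r_cont: "isCont (\<lambda>z. r z j $ i) l" for i j
  proof -
    have "isCont (\<lambda>z. if i = k then z else 0) l" for k
      by (cases "i = k") simp_all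
    then show ?thesis
      unfolding r_entry by (intro continuous_intros) auto
  qed
  have entry: "isCont (\<lambda>z. (\<chi> j. if j = i1 then w' else if j = i0 then v else r z j) $ i $ j) l" for i j
    by (cases "i = i1"; cases "i = i0") (simp_all add: r_cont)
  have "isCont D l"
    unfolding D_def det_def by (intro continuous_intros entry)
  then have "((\<lambda>z. (z - l) * D z) \<longlongrightarrow> (l - l) * D l) (at l)"
    by (intro tendsto_intros) (simp add: isCont_def)
  moreover have "((\<lambda>z. (z - l) * D z) \<longlongrightarrow> poly q l * det P) (at l)"
  proof (rule Lim_transform_eventually)
    show "((\<lambda>z. poly q z * det P) \<longlongrightarrow> poly q l * det P) (at l)"
      by (intro tendsto_intros)
    show "eventually (\<lambda>z. poly q z * det P = (z - l) * D z) (at l)"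
      using eq by (auto simp: eventually_at_filter)
  qed
  ultimately have "(l - l) * D l = poly q l * det P"
    by (rule LIM_unique)
  then show False using \<open>poly q l \<noteq> 0\<close> \<open>det P \<noteq> 0\<close> by simp
qed

definition poly_act :: "complex poly \<Rightarrow> complex^'n^'n \<Rightarrow> complex^'n \<Rightarrow> complex^'n" where
  "poly_act p B u = (\<Sum>i\<le>degree p. coeff p i *s (mpow B i *v u))"

lemma poly_act_altdef:
  assumes "degree p \<le> N"
  shows "poly_act p B u = (\<Sum>i\<le>N. coeff p i *s (mpow B i *v u))"
  unfolding poly_act_def
proof (rule sum.mono_neutral_left)
  show "\<forall>i\<in>{..N} - {..degree p}. coeff p i *s (mpow B i *v u) = 0"
    by (auto simp: coeff_eq_0)
qed (use assms in auto)

lemma poly_act_pCons_0: "poly_act (pCons 0 p) B u = poly_act p B (B *v u)"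
proof -
  have "degree (pCons 0 p) \<le> Suc (degree p)" by (simp add: degree_pCons_le)
  then have "poly_act (pCons 0 p) B u = (\<Sum>i\<le>Suc (degree p). coeff (pCons 0 p) i *s (mpow B i *v u))"
    by (rule poly_act_altdef)
  also have "\<dots> = (\<Sum>i\<le>degree p. coeff p i *s (mpow B i *v (B *v u)))"
    by (simp only: sum.atMost_Suc_shift coeff_pCons_0 coeff_pCons_Suc)
       (simp add: matrix_vector_mul_assoc[symmetric] mpow_commute)
  finally show ?thesis by (simp add: poly_act_def)
qed

lemma poly_act_diff_smult: "poly_act (p - smult m q) B u = poly_act p B u - m *s poly_act q B u"
proof -
  define N where "N = max (degree p) (degree q)"
  have "degree (p - smult m q) \<le> N"
    unfolding N_def by (meson degree_diff_le degree_smult_le le_max_iff_disj order_refl order_trans)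
  moreover have "degree p \<le> N" "degree q \<le> N" by (auto simp: N_def)
  ultimately show ?thesis
    by (simp add: poly_act_altdef vec_eq_iff sum_distrib_left sum_subtractf algebra_simps)
qed

lemma poly_act_diff_scale: "poly_act p B (x - m *s y) = poly_act p B x - m *s poly_act p B y"
  by (simp add: poly_act_def vec_eq_iff sum_distrib_left sum_subtractf
     matrix_vector_mult_diff_distrib vector_scalar_commute algebra_simps)

lemma matrix_vector_mult_sum_right:
  fixes B :: "'a::comm_ring_1^'n^'m"
  shows "B *v (\<Sum>i\<in>I. f i) = (\<Sum>i\<in>I. B *v f i)"
  by (induction I rule: infinite_finite_induct) (simp_all add: matrix_vector_right_distrib)

lemma poly_act_commute: "B *v poly_act p B u = poly_act p B (B *v u)"
  unfolding poly_act_def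
  by (simp add: matrix_vector_mult_sum_right vector_scalar_commute mpow_commute)

lemma poly_act_linear_factor:
  "poly_act ([:- m, 1:] * p) B u = poly_act p B (B *v u - m *s u)"
proof -
  have "[:- m, 1:] * p = pCons 0 p - smult m p" by simp
  then show ?thesis by (simp only: poly_act_diff_smult poly_act_pCons_0 poly_act_diff_scale)
qed

lemma poly_act_power_factor:
  "poly_act ([:- m, 1:] ^ k * p) B u = poly_act p B (((\<lambda>x. B *v x - m *s x) ^^ k) u)"
proof (induction k arbitrary: u)
  case (Suc k)
  have "poly_act ([:- m, 1:] ^ Suc k * p) B u = poly_act ([:- m, 1:] * ([:- m, 1:] ^ k * p)) B u"
    by (simp only: power_Suc mult.assoc)
  also have "\<dots> = poly_act p B (((\<lambda>x. B *v x - m *s x) ^^ Suc k) u)"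
    by (simp only: poly_act_linear_factor Suc funpow_Suc_right o_apply)
  finally show ?case .
qed simp

lemma of_real_smult_vec: "complex_of_real c *s x = c *\<^sub>R x"
  unfolding vec_eq_iff vector_smult_component vector_scaleR_component
  by (simp only: scaleR_conv_of_real simp_thms)

text \<open>More iterates \<open>u, B u, B\<^sup>2 u, \<dots>\<close> than the real dimension are linearly dependent.  The polynomial depends
  on \<open>u\<close>, which suffices because growth is estimated for one vector at a time.\<close>

lemma ex_annihilating_poly:
  fixes B :: "complex^'n^'n"
  shows "\<exists>p. p \<noteq> 0 \<and> poly_act p B u = 0"
proof -
  define a where "a i = mpow B i *v u" for i
  define N where "N = DIM(complex^'n)"
  show ?thesis
  proof (cases "inj_on a {..N}")
    case False
    then obtain i j where ij: "i \<noteq> j" "a i = a j" by (auto simp: inj_on_def)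
    define p where "p = monom 1 i - monom (1::complex) j"
    have c: "coeff p k = (if k = i then 1 else 0) - (if k = j then 1 else 0)" for k
      by (simp add: p_def)
    then have "coeff p i \<noteq> 0" using ij by simp
    then have "p \<noteq> 0" by auto
    have "degree p \<le> max i j"
      unfolding p_def by (meson degree_diff_le_max degree_monom_le le_trans max.mono)
    then have "poly_act p B u = (\<Sum>k\<le>max i j. coeff p k *s a k)"
      by (simp add: poly_act_altdef a_def)
    also have "\<dots> = (\<Sum>k\<le>max i j. (if k = i then a i else 0) - (if k = j then a j else 0))"
      by (rule sum.cong) (auto simp: c)
    also have "\<dots> = 0" using ij(2) by (simp add: sum_subtractf)
    finally show ?thesis using \<open>p \<noteq> 0\<close> by blast
  next
    case True
    then have "card (a ` {..N}) > DIM(complex^'n)" by (simp add: card_image N_def)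
    then have "dependent (a ` {..N})" by (intro dependent_biggerset) simp
    then obtain c where c: "\<exists>x\<in>a ` {..N}. c x \<noteq> 0" "(\<Sum>x\<in>a ` {..N}. c x *\<^sub>R x) = 0"
      by (auto simp: dependent_finite)
    define p where "p = (\<Sum>i\<le>N. monom (complex_of_real (c (a i))) i)"
    have cp: "coeff p k = (if k \<le> N then complex_of_real (c (a k)) else 0)" for k
      by (simp add: p_def coeff_sum)
    have "degree p \<le> N" using cp by (intro degree_le) auto
    then have "poly_act p B u = (\<Sum>k\<le>N. coeff p k *s a k)"
      by (simp add: poly_act_altdef a_def)
    also have "\<dots> = (\<Sum>k\<le>N. c (a k) *\<^sub>R a k)"
      by (rule sum.cong) (auto simp: cp of_real_smult_vec)
    also have "\<dots> = 0" using c(2) by (simp add: sum.reindex[OF True])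
    finally have "poly_act p B u = 0" .
    moreover have "p \<noteq> 0"
    proof -
      obtain i where "i \<le> N" "c (a i) \<noteq> 0" using c(1) by auto
      then have "coeff p i \<noteq> 0" using cp by simp
      then show ?thesis by auto
    qed
    ultimately show ?thesis by blast
  qed
qed

text \<open>Split off one linear factor of \<open>s\<close> at a time.  For a root \<open>m\<close> of modulus below \<open>r\<close> the iterates of \<open>z\<close> solve a first
  order recurrence with ratio \<open>m\<close> and inhomogeneity \<open>O(r\<^sup>n)\<close>; for a root that is not an eigenvalue,
  \<open>B - m\<close> is bounded below and commutes with \<open>B\<close>.\<close>

lemma growth_bound:
  fixes B :: "complex^'n^'n"
  assumes "s \<noteq> 0" "poly_act s B z = 0" "r > 0"
    and "\<And>m. poly s m = 0 \<Longrightarrow> cmod m < r \<or> (\<forall>x. B *v x = m *s x \<longrightarrow> x = 0)"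
  shows "\<exists>C. \<forall>n. norm (mpow B n *v z) \<le> C * r ^ n"
  using assms(1,2,4)
proof (induction "degree s" arbitrary: s z)
  case 0
  then obtain a where a: "s = [:a:]" "a \<noteq> 0" by (metis degree_eq_zeroE pCons_eq_0_iff)
  then have "z = 0" using 0(3) by (auto simp: poly_act_def vec_eq_iff)
  then show ?case by (intro exI[of _ 0]) simp
next
  case (Suc d)
  have "\<not> constant (poly s)" using Suc(2) by (simp add: constant_degree)
  then obtain m where m: "poly s m = 0" using fundamental_theorem_of_algebra by blast
  then obtain s' where s': "s = [:- m, 1:] * s'" by (metis dvdE poly_eq_0_iff_dvd)
  have s'0: "s' \<noteq> 0" using s' Suc(3) by auto
  define z' where "z' = B *v z - m *s z"
  have deg: "d = degree s'"
  proof -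
    have "degree s = degree [:- m, 1:] + degree s'"
      unfolding s' by (rule degree_mult_eq) (use s'0 in auto)
    then show ?thesis using Suc(2) by simp
  qed
  have "poly_act s' B z' = 0" using Suc(4) unfolding s' poly_act_linear_factor z'_def .
  moreover have "cmod k < r \<or> (\<forall>x. B *v x = k *s x \<longrightarrow> x = 0)" if "poly s' k = 0" for k
    using Suc(5)[of k] that by (simp add: s')
  ultimately obtain C where C: "norm (mpow B n *v z') \<le> C * r ^ n" for n
    using Suc(1)[OF deg s'0] by blast
  have step: "mpow B n *v z' = B *v (mpow B n *v z) - m *s (mpow B n *v z)" for n
    by (simp add: z'_def matrix_vector_mult_diff_distrib vector_scalar_commute mpow_commute)
  show ?case
  proof (cases "cmod m < r")
    case True
    define K where "K = max (norm z) (C / (r - cmod m))"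
    have "norm (mpow B n *v z) \<le> K * r ^ n" for n
    proof (induction n)
      case 0
      then show ?case by (simp add: K_def)
    next
      case (Suc n)
      have "mpow B (Suc n) *v z = mpow B n *v z' + m *s (mpow B n *v z)"
        by (simp add: step matrix_vector_mul_assoc)
      then have "norm (mpow B (Suc n) *v z) \<le> norm (mpow B n *v z') + norm (m *s (mpow B n *v z))"
        by (metis norm_triangle_ineq)
      also have "norm (m *s (mpow B n *v z)) = cmod m * norm (mpow B n *v z)"
        by (simp add: norm_vec_def L2_set_def norm_mult power_mult_distrib sum_distrib_left[symmetric] real_sqrt_mult)
      also have "\<dots> \<le> cmod m * (K * r ^ n)" using Suc by (intro mult_left_mono) auto
      finally have "norm (mpow B (Suc n) *v z) \<le> (C + cmod m * K) * r ^ n"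
        using C[of n] by (simp add: algebra_simps)
      also have "\<dots> \<le> (r * K) * r ^ n"
      proof (rule mult_right_mono)
        have "C / (r - cmod m) \<le> K" by (simp add: K_def)
        then show "C + cmod m * K \<le> r * K" using True by (simp add: field_simps)
      qed (use assms(3) in simp)
      finally show ?case by (simp add: algebra_simps)
    qed
    then show ?thesis by blast
  next
    case False
    then have inj: "\<forall>x. B *v x = m *s x \<longrightarrow> x = 0" using Suc(5)[OF m] by blast
    have lin: "linear (\<lambda>x. B *v x - m *s x)"
      by (rule linearI) (simp_all add: vec_eq_iff algebra_simps matrix_vector_mult_def sum.distrib sum_distrib_left scaleR_sum_right)
    have "inj (\<lambda>x. B *v x - m *s x)"
      using inj by (subst linear_injective_0[OF lin]) auto
    then obtain b where b: "b > 0" "\<And>x. b * norm x \<le> norm (B *v x - m *s x)"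
      using linear_inj_bounded_below_pos[OF lin] by blast
    have "norm (mpow B n *v z) \<le> (C / b) * r ^ n" for n
      using b(2)[of "mpow B n *v z"] C[of n] b(1) step[of n] by (simp add: field_simps)
    then show ?thesis by blast
  qed
qed

text \<open>The dominant eigenvalue is real because its conjugate is an eigenvalue of the same modulus, and it
  is simple because a second copy would not be dominated.\<close>

lemma proximal_dominant_eigenvalue:
  fixes A :: "real^'n^'n"
  assumes "proximal A" "expanding A"
  obtains l r where "\<bar>l\<bar> > 1" "0 < r" "r < \<bar>l\<bar>"
    "order (complex_of_real l) (charpoly (map_matrix complex_of_real A)) = 1"
    "\<And>m. m \<in># eigenvalues A \<Longrightarrow> m = complex_of_real l \<or> cmod m < r"
proof -
  define B where "B = map_matrix complex_of_real A"
  obtain lc where lc: "lc \<in># eigenvalues A" "\<And>m. m \<in># eigenvalues A - {#lc#} \<Longrightarrow> cmod m < cmod lc"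
    using assms(1) unfolding proximal_def by blast
  have other: "cmod m < cmod lc" if "m \<in># eigenvalues A" "m \<noteq> lc" for m
    using lc(2)[of m] that by (simp add: in_diff_count)
  have count_eq: "count (eigenvalues A) lc = order lc (charpoly B)"
    using charpoly_nonzero[of B] by (simp add: eigenvalues_def B_def)
  have "count (eigenvalues A) lc = 1"
  proof (rule ccontr)
    assume "count (eigenvalues A) lc \<noteq> 1"
    then have "count (eigenvalues A) lc > 1" using lc(1) by (simp add: Suc_lessI)
    then have "lc \<in># eigenvalues A - {#lc#}" by (simp add: in_diff_count)
    from lc(2)[OF this] show False by simp
  qed
  then have ord: "order lc (charpoly B) = 1" using count_eq by simp
  obtain l' where "l' \<in># eigenvalues A" "cmod l' > 1" using assms(2) unfolding expanding_def by blast
  then have big: "cmod lc > 1" using other[of l'] by (cases "l' = lc") auto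
  have "cnj lc \<in># eigenvalues A"
  proof -
    obtain v where v: "v \<noteq> 0" "B *v v = lc *s v"
      using lc(1) unfolding in_eigenvalues_iff B_def by blast
    define w where "w = (\<chi> i. cnj (v $ i))"
    have "B *v w = cnj lc *s w"
    proof -
      have "(B *v w) $ i = cnj ((B *v v) $ i)" for i
        by (simp add: matrix_vector_mult_def B_def w_def cnj_sum)
      then show ?thesis by (simp add: vec_eq_iff v(2)) (simp add: w_def)
    qed
    moreover have "w \<noteq> 0" using v(1) by (auto simp: w_def vec_eq_iff)
    ultimately show ?thesis unfolding in_eigenvalues_iff B_def by blast
  qed
  then have "cnj lc = lc" using other[of "cnj lc"] by auto
  then have lre: "lc = complex_of_real (Re lc)" by (simp add: complex_eq_iff)
  define S where "S = insert 0 (cmod ` (set_mset (eigenvalues A) - {lc}))"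
  have S: "finite S" "S \<noteq> {}" "\<And>x. x \<in> S \<Longrightarrow> x < cmod lc"
    using other big by (auto simp: S_def)
  define r where "r = (Max S + cmod lc) / 2"
  have M: "0 \<le> Max S" "Max S < cmod lc" using S by (auto simp: S_def)
  have labs: "\<bar>Re lc\<bar> = cmod lc" using lre by (metis norm_of_real)
  show thesis
  proof (rule that[of "Re lc" r])
    show "\<bar>Re lc\<bar> > 1" "0 < r" "r < \<bar>Re lc\<bar>" using M big labs by (auto simp: r_def)
    show "order (complex_of_real (Re lc)) (charpoly (map_matrix complex_of_real A)) = 1"
      using ord lre by (simp add: B_def)
    show "m = complex_of_real (Re lc) \<or> cmod m < r" if "m \<in># eigenvalues A" for m
    proof (cases "m = lc")
      case False
      then have "cmod m \<le> Max S" using that S by (intro Max_ge) (auto simp: S_def)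
      then show ?thesis using M by (auto simp: r_def)
    qed (use lre in simp)
  qed
qed

text \<open>Let \<open>B\<close> be the complexification of \<open>A\<close>.  An annihilating polynomial of \<open>u\<close> is \<open>(z - l)\<^sup>k s(z)\<close> with \<open>s(l) \<noteq> 0\<close>.  Because
  the generalized eigenspace of \<open>l\<close> is the eigenspace, already \<open>(B - l) s(B) u = 0\<close>, so \<open>(B - l) u\<close> is
  annihilated by \<open>s\<close> and grows at most like \<open>r\<^sup>n\<close> for some \<open>r\<close> below \<open>\<bar>l\<bar>\<close>.  Thus \<open>A\<^sup>n u / l\<^sup>n\<close> is a Cauchy sequence, and its
  limit is an eigenvector for \<open>l\<close>.\<close>

lemma proximal_power_limit:
  fixes A :: "real^'n^'n"
  assumes "proximal A" "expanding A"
  obtains l v f where "\<bar>l\<bar> > 1" "f \<bullet> v = 1"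
    "\<And>x. (\<lambda>n. (1 / l ^ n) *\<^sub>R (mpow A n *v x)) \<longlonglongrightarrow> (f \<bullet> x) *\<^sub>R v"
proof -
  define B where "B = map_matrix complex_of_real A"
  obtain l r where l: "\<bar>l\<bar> > 1" and r: "0 < r" "r < \<bar>l\<bar>"
    and ord: "order (complex_of_real l) (charpoly B) = 1"
    and other: "\<And>m. m \<in># eigenvalues A \<Longrightarrow> m = complex_of_real l \<or> cmod m < r"
    using proximal_dominant_eigenvalue[OF assms] unfolding B_def by metis
  define lc where "lc = complex_of_real l"
  define cv where "cv x = (\<chi> i. complex_of_real (x $ i))" for x :: "real^'n"
  have cv_mult: "B *v cv x = cv (A *v x)" for x
    by (simp add: B_def cv_def vec_eq_iff matrix_vector_mult_def)
  have cv_pow: "mpow B n *v cv x = cv (mpow A n *v x)" for n x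
  proof (induction n)
    case (Suc n)
    then show ?case by (simp add: matrix_vector_mul_assoc[symmetric] cv_mult)
  qed simp
  have cv_norm: "norm (cv x) = norm x" for x
    by (simp add: cv_def norm_vec_def L2_set_def)
  have cv_diff: "cv (x - l *\<^sub>R y) = cv x - lc *s cv y" for x y
    by (simp add: cv_def lc_def vec_eq_iff)
  have "order lc (charpoly B) \<noteq> 0" using ord by (simp add: lc_def)
  then have "poly (charpoly B) lc = 0" by (simp add: order_root)
  then obtain w where w: "w \<noteq> 0" "B *v w = lc *s w" by (auto simp: poly_charpoly_eq_0_iff)
  define v where "v = (if (\<chi> i. Re (w $ i)) = 0 then (\<chi> i. Im (w $ i)) else (\<chi> i. Re (w $ i)))"
  have v0: "v \<noteq> 0"
    using w(1) by (auto simp: v_def vec_eq_iff complex_eq_iff)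
  have Av: "A *v v = l *\<^sub>R v"
  proof -
    have "(\<Sum>j\<in>UNIV. A $ i $ j * Re (w $ j)) = l * Re (w $ i)"
      "(\<Sum>j\<in>UNIV. A $ i $ j * Im (w $ j)) = l * Im (w $ i)" for i
      using arg_cong[OF w(2), of "\<lambda>u. Re (u $ i)"] arg_cong[OF w(2), of "\<lambda>u. Im (u $ i)"]
      by (simp_all add: matrix_vector_mult_def B_def lc_def)
    then show ?thesis by (simp add: v_def vec_eq_iff matrix_vector_mult_def)
  qed
  have cv0: "cv v \<noteq> 0" using v0 by (simp add: cv_def vec_eq_iff)
  have Bv: "B *v cv v = lc *s cv v"
    unfolding cv_mult Av by (simp add: cv_def lc_def vec_eq_iff)
  define N where "N x = B *v x - lc *s x" for x
  have ker: "\<exists>a. x = a *s cv v" if "N x = c *s cv v" for x c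
    using simple_root_kernel[of lc B "cv v" x c] ord cv0 Bv that by (simp add: lc_def N_def)
  have N_scale: "N (a *s cv v) = 0" for a
    by (simp add: N_def vector_scalar_commute Bv vec_eq_iff)
  have ker2: "N z = 0" if "N (N z) = 0" for z
  proof -
    have "N (N z) = 0 *s cv v" using that by simp
    from ker[OF this] obtain a where "N z = a *s cv v" by blast
    from ker[OF this] obtain b where "z = b *s cv v" by blast
    then show ?thesis using N_scale by simp
  qed
  have kerk: "N z = 0" if "(N ^^ k) z = 0" for z k
    using that
  proof (induction k arbitrary: z)
    case 0
    then show ?case by (simp add: N_def)
  next
    case (Suc k)
    then have "N (N z) = 0" by (simp add: funpow_swap1)
    then show ?case by (rule ker2)
  qed
  have growth: "\<exists>C. \<forall>n. norm (mpow B n *v N u) \<le> C * r ^ n" for u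
  proof -
    obtain p where p: "p \<noteq> 0" "poly_act p B u = 0" using ex_annihilating_poly by blast
    obtain s where s: "p = [:- lc, 1:] ^ order lc p * s" "\<not> [:- lc, 1:] dvd s"
      using order_decomp[OF p(1)] by blast
    have Nfun: "N = (\<lambda>x. B *v x - lc *s x)" by (simp add: N_def fun_eq_iff)
    have comm: "N (poly_act s B x) = poly_act s B (N x)" for x
      by (simp add: N_def poly_act_commute poly_act_diff_scale)
    have commk: "(N ^^ k) (poly_act s B x) = poly_act s B ((N ^^ k) x)" for x k
      by (induction k) (simp_all add: comm)
    have "poly_act s B ((N ^^ order lc p) u) = 0"
      using p(2) poly_act_power_factor[of lc "order lc p" s B u] s(1) Nfun by simp
    then have "N (poly_act s B u) = 0" using kerk[of "order lc p" "poly_act s B u"] commk by simp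
    then have "poly_act s B (N u) = 0" using comm by simp
    moreover have "s \<noteq> 0" using s(2) by auto
    moreover have "cmod m < r \<or> (\<forall>x. B *v x = m *s x \<longrightarrow> x = 0)" if "poly s m = 0" for m
    proof -
      have "m \<noteq> lc" using that s(2) by (auto simp: poly_eq_0_iff_dvd)
      then show ?thesis using other[of m] unfolding in_eigenvalues_iff B_def[symmetric] lc_def by blast
    qed
    ultimately show ?thesis using growth_bound[of s B "N u" r] r by blast
  qed
  define b where "b x n = (1 / l ^ n) *\<^sub>R (mpow A n *v x)" for x n
  have l0: "l \<noteq> 0" using l by auto
  have conv: "\<exists>L. b x \<longlonglongrightarrow> L" for x
  proof -
    obtain C where C: "\<And>n. norm (mpow B n *v N (cv x)) \<le> C * r ^ n" using growth by blast
    have Ncv: "N (cv x) = cv (A *v x - l *\<^sub>R x)" by (simp add: N_def cv_mult cv_diff)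
    have C': "norm (mpow A n *v (A *v x - l *\<^sub>R x)) \<le> C * r ^ n" for n
      using C[of n] by (simp only: Ncv cv_pow cv_norm)
    have "summable (\<lambda>n. b x (Suc n) - b x n)"
    proof (rule summable_comparison_test')
      show "summable (\<lambda>n. (C / \<bar>l\<bar>) * (r / \<bar>l\<bar>) ^ n)"
        using r by (intro summable_mult summable_geometric) auto
      fix n
      have "b x (Suc n) - b x n = (1 / l ^ Suc n) *\<^sub>R (mpow A n *v (A *v x - l *\<^sub>R x))"
        using l0 by (simp add: b_def matrix_vector_mult_diff_distrib mpow_commute
            matrix_vector_mul_assoc[symmetric] matrix_vector_mult_scaleR scaleR_diff_right)
      then have "norm (b x (Suc n) - b x n) = norm (mpow A n *v (A *v x - l *\<^sub>R x)) / \<bar>l\<bar> ^ Suc n"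
        by (simp add: norm_mult power_abs abs_mult divide_simps)
      also have "\<dots> \<le> (C * r ^ n) / \<bar>l\<bar> ^ Suc n"
        by (intro divide_right_mono C') auto
      finally show "norm (b x (Suc n) - b x n) \<le> (C / \<bar>l\<bar>) * (r / \<bar>l\<bar>) ^ n"
        by (simp add: power_divide)
    qed
    then have "(\<lambda>n. \<Sum>i<n. b x (Suc i) - b x i) \<longlonglongrightarrow> (\<Sum>n. b x (Suc n) - b x n)"
      by (rule summable_LIMSEQ)
    then have "(\<lambda>n. b x n - b x 0) \<longlonglongrightarrow> (\<Sum>n. b x (Suc n) - b x n)"
      by (simp add: sum_lessThan_telescope)
    from tendsto_add[OF this tendsto_const[of "b x 0"]] show ?thesis by auto
  qed
  define T where "T x = lim (b x)" for x
  have T: "b x \<longlonglongrightarrow> T x" for x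
    unfolding T_def using conv[of x] by (simp add: convergent_def convergent_LIMSEQ_iff[symmetric])
  have linT: "linear T"
  proof (rule linearI)
    fix x y
    have "b (x + y) = (\<lambda>n. b x n + b y n)"
      by (simp add: b_def fun_eq_iff matrix_vector_right_distrib scaleR_add_right)
    then show "T (x + y) = T x + T y"
      using tendsto_add[OF T[of x] T[of y]] T[of "x + y"] LIMSEQ_unique by simp
  next
    fix c x
    have "b (c *\<^sub>R x) = (\<lambda>n. c *\<^sub>R b x n)"
      by (simp add: b_def fun_eq_iff matrix_vector_mult_scaleR)
    then show "T (c *\<^sub>R x) = c *\<^sub>R T x"
      using tendsto_scaleR[OF tendsto_const T[of x], of c] T[of "c *\<^sub>R x"] LIMSEQ_unique by simp
  qed
  have AT: "A *v T x = l *\<^sub>R T x" for x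
  proof (rule LIMSEQ_unique)
    show "(\<lambda>n. A *v b x n) \<longlonglongrightarrow> A *v T x"
      by (intro bounded_linear.tendsto[OF matrix_vector_mul_bounded_linear] T)
    have "(\<lambda>n. A *v b x n) = (\<lambda>n. l *\<^sub>R b x (Suc n))"
      using l0 by (simp add: b_def fun_eq_iff matrix_vector_mult_scaleR matrix_vector_mul_assoc)
    then show "(\<lambda>n. A *v b x n) \<longlonglongrightarrow> l *\<^sub>R T x"
      using tendsto_scaleR[OF tendsto_const LIMSEQ_Suc[OF T[of x]], of l] by simp
  qed
  have T_mult: "\<exists>a. T x = a *\<^sub>R v" for x
  proof -
    have "N (cv (T x)) = 0 *s cv v"
      by (simp add: N_def cv_mult AT) (simp add: cv_def lc_def vec_eq_iff)
    from ker[OF this] obtain a where a: "cv (T x) = a *s cv v" by blast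
    have "T x = Re a *\<^sub>R v"
    proof -
      have "T x $ i = Re a * v $ i" for i
        using arg_cong[OF a, of "\<lambda>u. Re (u $ i)"] by (simp add: cv_def)
      then show ?thesis by (simp add: vec_eq_iff)
    qed
    then show ?thesis by blast
  qed
  have powv: "mpow A n *v v = l ^ n *\<^sub>R v" for n
    by (induction n) (simp_all add: matrix_vector_mul_assoc[symmetric] matrix_vector_mult_scaleR Av)
  have Tv: "T v = v"
  proof (rule LIMSEQ_unique[OF T])
    have "b v = (\<lambda>n. v)" using l0 by (simp add: b_def powv fun_eq_iff)
    then show "b v \<longlonglongrightarrow> v" by simp
  qed
  define f where "f = (1 / (v \<bullet> v)) *\<^sub>R adjoint T v"
  have f_eq: "f \<bullet> x = (T x \<bullet> v) / (v \<bullet> v)" for x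
    using adjoint_works[OF linT, of x v] by (simp add: f_def inner_commute)
  have Tf: "T x = (f \<bullet> x) *\<^sub>R v" for x
    using T_mult[of x] v0 by (auto simp: f_eq)
  show thesis
  proof (rule that[OF l])
    show "f \<bullet> v = 1" using v0 by (simp add: f_eq Tv)
    show "(\<lambda>n. (1 / l ^ n) *\<^sub>R (mpow A n *v x)) \<longlonglongrightarrow> (f \<bullet> x) *\<^sub>R v" for x
      using T[of x] unfolding Tf b_def .
  qed
qed

section \<open>Long segments modulo the integer lattice\<close>

definition int_lattice :: "(real^'n) set" where
  "int_lattice = {k. \<forall>i. k $ i \<in> \<int>}"

text \<open>The mean of such a sum over a long interval is close to the constant term \<open>c\<close>.  Instead of integrating, compare
  with the bounded primitive: if the sum stayed below \<open>d\<close>, then \<open>(c - d) s\<close> plus a bounded function would be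
  decreasing in \<open>s\<close>.\<close>

lemma cos_sum_exceeds:
  fixes c d :: real
  assumes fin: "finite I" and w: "\<And>i. i \<in> I \<Longrightarrow> \<omega> i \<noteq> 0" and dc: "d < c"
  shows "\<exists>L\<ge>0. \<forall>\<alpha>. \<exists>s\<in>{0..L}. d < c + (\<Sum>i\<in>I. C i * cos (\<alpha> i + \<omega> i * s))"
proof -
  define B where "B = (\<Sum>i\<in>I. \<bar>C i / \<omega> i\<bar>)"
  define L where "L = (2 * B + 1) / (c - d)"
  have B0: "B \<ge> 0" unfolding B_def by (intro sum_nonneg) auto
  have L0: "L > 0" using B0 dc by (simp add: L_def)
  have "\<exists>s\<in>{0..L}. d < c + (\<Sum>i\<in>I. C i * cos (\<alpha> i + \<omega> i * s))" for \<alpha>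
  proof (rule ccontr)
    assume *: "\<not> (\<exists>s\<in>{0..L}. d < c + (\<Sum>i\<in>I. C i * cos (\<alpha> i + \<omega> i * s)))"
    have le: "c - d + (\<Sum>i\<in>I. C i * cos (\<alpha> i + \<omega> i * s)) \<le> 0" if "0 \<le> s" "s \<le> L" for s
    proof -
      have "c + (\<Sum>i\<in>I. C i * cos (\<alpha> i + \<omega> i * s)) \<le> d"
        using that * by (meson atLeastAtMost_iff not_less)
      then show ?thesis by linarith
    qed
    define S where "S s = (\<Sum>i\<in>I. C i / \<omega> i * sin (\<alpha> i + \<omega> i * s))" for s
    have S_bound: "\<bar>S s\<bar> \<le> B" for s
    proof -
      have "\<bar>S s\<bar> \<le> (\<Sum>i\<in>I. \<bar>C i / \<omega> i * sin (\<alpha> i + \<omega> i * s)\<bar>)"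
        unfolding S_def by (rule sum_abs)
      also have "\<dots> \<le> B"
        unfolding B_def abs_mult by (intro sum_mono mult_left_le) (auto simp: abs_sin_le_one)
      finally show ?thesis .
    qed
    have "(c - d) * L + S L \<le> (c - d) * 0 + S 0"
    proof (rule DERIV_nonpos_imp_nonincreasing[where f = "\<lambda>s. (c - d) * s + S s"])
      show "0 \<le> L" using L0 by simp
      fix s assume s: "0 \<le> s" "s \<le> L"
      have "((\<lambda>s. C i / \<omega> i * sin (\<alpha> i + \<omega> i * s)) has_real_derivative C i * cos (\<alpha> i + \<omega> i * s)) (at s)"
        if "i \<in> I" for i
        using w[OF that] by (auto intro!: derivative_eq_intros)
      then have "(S has_real_derivative (\<Sum>i\<in>I. C i * cos (\<alpha> i + \<omega> i * s))) (at s)"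
        unfolding S_def by (rule DERIV_sum)
      moreover have "((\<lambda>s. (c - d) * s) has_real_derivative (c - d)) (at s)"
        by (auto intro!: derivative_eq_intros)
      ultimately have "((\<lambda>s. (c - d) * s + S s) has_real_derivative
              (c - d) + (\<Sum>i\<in>I. C i * cos (\<alpha> i + \<omega> i * s))) (at s)"
        by (intro DERIV_add)
      then show "\<exists>y. ((\<lambda>s. (c - d) * s + S s) has_real_derivative y) (at s) \<and> y \<le> 0"
        using le[OF s] by auto
    qed
    moreover have "(c - d) * L = 2 * B + 1" using dc by (simp add: L_def)
    ultimately show False using S_bound[of L] S_bound[of 0] by linarith
  qed
  then show ?thesis using L0 less_imp_le by blast
qed

text \<open>\<open>(1 + cos t) / 2\<close> is the square of \<open>(cis (t/2) + cis (- t/2)) / 2\<close>, to which the binomial theorem applies.\<close>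

lemma cos_power_expansion:
  "complex_of_real (((1 + cos t) / 2) ^ N) =
     (\<Sum>j\<le>2*N. complex_of_real (real ((2*N) choose j) / 4 ^ N) * cis ((real j - real N) * t))"
proof -
  have "complex_of_real ((1 + cos t) / 2) = (cis (t/2) + cis (- (t/2))) ^ 2 / 4"
  proof -
    have "1 + cos t = 2 * (cos (t/2))\<^sup>2" using cos_double_cos[of "t/2"] by simp
    then show ?thesis
      by (simp add: complex_eq_iff power2_eq_square)
  qed
  then have "complex_of_real (((1 + cos t) / 2) ^ N) = (cis (t/2) + cis (- (t/2))) ^ (2 * N) / 4 ^ N"
    unfolding of_real_power by (simp only: power_divide power_mult)
  also have "(cis (t/2) + cis (- (t/2))) ^ (2 * N) =
      (\<Sum>j\<le>2*N. of_nat ((2*N) choose j) * cis (t/2) ^ j * cis (- (t/2)) ^ (2 * N - j))"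
    by (rule binomial_ring)
  also have "\<dots> = (\<Sum>j\<le>2*N. of_nat ((2*N) choose j) * cis ((real j - real N) * t))"
  proof (rule sum.cong)
    fix j assume "j \<in> {..2*N}"
    then have "real j * (t/2) + real (2 * N - j) * (- (t/2)) = (real j - real N) * t"
      by (simp add: of_nat_diff field_simps)
    then show "of_nat ((2*N) choose j) * cis (t/2) ^ j * cis (- (t/2)) ^ (2 * N - j) =
        of_nat ((2*N) choose j) * cis ((real j - real N) * t)"
      by (simp only: Complex.DeMoivre mult.assoc cis_mult)
  qed simp
  finally show ?thesis by (simp add: sum_divide_distrib)
qed

lemma cos_product_expansion:
  fixes x :: "real^'n"
  shows "(\<Prod>i\<in>UNIV. ((1 + cos (x $ i)) / 2) ^ N) =
     (\<Sum>h\<in>PiE UNIV (\<lambda>_. {..2*N}). (\<Prod>i\<in>UNIV. real ((2*N) choose h i) / 4 ^ N) *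
        cos (\<Sum>i\<in>UNIV. (real (h i) - real N) * x $ i))"
proof -
  have cis_sum: "(\<Prod>i\<in>I. cis (y i)) = cis (\<Sum>i\<in>I. y i)" for I :: "'n set" and y
    by (induction I rule: infinite_finite_induct) (simp_all add: cis_mult)
  have "complex_of_real (\<Prod>i\<in>UNIV. ((1 + cos (x $ i)) / 2) ^ N) =
      (\<Prod>i\<in>UNIV. \<Sum>j\<le>2*N. complex_of_real (real ((2*N) choose j) / 4 ^ N) * cis ((real j - real N) * x $ i))"
    by (simp only: of_real_prod cos_power_expansion)
  also have "\<dots> = (\<Sum>h\<in>PiE UNIV (\<lambda>_. {..2*N}). \<Prod>i\<in>UNIV. complex_of_real (real ((2*N) choose h i) / 4 ^ N)
        * cis ((real (h i) - real N) * x $ i))"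
    by (rule prod_sum_PiE) auto
  also have "\<dots> = (\<Sum>h\<in>PiE UNIV (\<lambda>_. {..2*N}). complex_of_real (\<Prod>i\<in>UNIV. real ((2*N) choose h i) / 4 ^ N)
        * cis (\<Sum>i\<in>UNIV. (real (h i) - real N) * x $ i))"
    by (simp only: prod.distrib cis_sum of_real_prod)
  finally show ?thesis
    by (auto dest!: arg_cong[where f = Re] simp del: of_real_prod of_real_divide)
qed

text \<open>A quantitative form of Kronecker's theorem.  The test function \<open>\<Prod>i. ((1 + cos (2 \<pi> (x\<^sub>i - z\<^sub>i))) / 2) ^ N\<close> is at
  most \<open>\<rho> ^ N\<close>, with \<open>\<rho> < 1\<close>, at points that are \<open>\<epsilon>\<close>-far from all lattice translates of \<open>z\<close>, whereas its constant Fourier coefficient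
  decays only like a power of \<open>N\<close>.  For suitable \<open>N\<close> a long segment cannot stay in the far region, provided
  its direction is orthogonal to none of the other, finitely many, frequencies.\<close>

lemma segment_dense_mod_lattice:
  fixes z :: "real^'n"
  assumes eps: "\<epsilon> > 0"
  shows "\<exists>M. finite M \<and> 0 \<notin> M \<and> (\<forall>u. (\<forall>m\<in>M. m \<bullet> u \<noteq> 0) \<longrightarrow>
     (\<exists>L\<ge>0. \<forall>y. \<exists>s\<in>{0..L}. \<exists>k. k \<in> int_lattice \<and> dist (y + s *\<^sub>R u + k) z < \<epsilon>))"
proof -
  define d where "d = CARD('n)"
  have d0: "d > 0" by (simp add: d_def)
  define e where "e = min (\<epsilon> / d) (1/2)"
  have e: "e > 0" "e \<le> 1/2" "d * e \<le> \<epsilon>" using eps d0 by (auto simp: e_def min_def field_simps)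
  have cos_nonneg: "0 \<le> 1 + cos y" for y :: real
    using cos_ge_minus_one[of y] by linarith
  define \<rho> where "\<rho> = (1 + cos (2 * pi * e)) / 2"
  have \<rho>: "0 \<le> \<rho>" "\<rho> < 1"
  proof -
    show "0 \<le> \<rho>" using cos_nonneg[of "2*pi*e"] by (simp add: \<rho>_def)
    have "cos (2 * pi * e) < cos 0"
      by (rule cos_monotone_0_pi) (use e in auto)
    then show "\<rho> < 1" by (simp add: \<rho>_def)
  qed
  \<comment> \<open>The \<open>d\<close>-th root turns the comparison with a \<open>d\<close>-fold product of binomial coefficients into a one-dimensional one.\<close>
  define \<sigma> where "\<sigma> = root d \<rho>"
  have \<sigma>: "0 \<le> \<sigma>" "\<sigma> < 1" "\<sigma> ^ d = \<rho>"
    using \<rho> d0 by (auto simp: \<sigma>_def)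
  have "(\<lambda>n. real n * \<sigma> ^ n) \<longlonglongrightarrow> 0"
    using powser_times_n_limit_0[of \<sigma>] \<sigma> by simp
  then have "eventually (\<lambda>n. real n * \<sigma> ^ n < 1/2) sequentially"
    by (rule order_tendstoD) simp
  then have "eventually (\<lambda>n. real n * \<sigma> ^ n < 1/2 \<and> n > 0) sequentially"
    using eventually_gt_at_top[of 0] by (rule eventually_conj)
  then obtain N where N: "real N * \<sigma> ^ N < 1/2" "N > 0"
    using eventually_happens by fastforce
  define c where "c = (real ((2*N) choose N) / 4 ^ N) ^ d"
  have c: "\<rho> ^ N < c"
  proof -
    have "4 ^ N / (2 * real N) \<le> real ((2*N) choose N)"
      using central_binomial_lower_bound[of N] N(2) by simp
    then have "1 / (2 * real N) \<le> real ((2*N) choose N) / 4 ^ N"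
      by (simp add: field_simps)
    moreover have "\<sigma> ^ N < 1 / (2 * real N)" using N by (simp add: field_simps)
    ultimately have "\<sigma> ^ N < real ((2*N) choose N) / 4 ^ N" by simp
    then have "(\<sigma> ^ N) ^ d < c"
      unfolding c_def using \<sigma> d0 by (intro power_strict_mono) auto
    then show ?thesis using \<sigma>(3) by (metis power_mult mult.commute)
  qed
  \<comment> \<open>Exponents of the nonconstant Fourier terms; the constant term belongs to the exponent \<open>N\<close> in each coordinate.\<close>
  define H where "H = PiE (UNIV :: 'n set) (\<lambda>_. {..2*N}) - {\<lambda>_. N}"
  define \<mu> where "\<mu> h = (\<chi> i. real (h i) - real N)" for h :: "'n \<Rightarrow> nat"
  have finH: "finite H" by (auto simp: H_def intro!: finite_PiE)
  have full: "PiE (UNIV :: 'n set) (\<lambda>_. {..2*N}) = insert (\<lambda>_. N) H"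
    by (auto simp: H_def)
  define C where "C h = (\<Prod>i\<in>UNIV. real ((2*N) choose h i) / 4 ^ N)" for h :: "'n \<Rightarrow> nat"
  have small: "(\<Prod>i\<in>UNIV. ((1 + cos (2 * pi * (x $ i - z $ i))) / 2) ^ N) \<le> \<rho> ^ N"
    if far: "\<And>k. k \<in> int_lattice \<Longrightarrow> \<epsilon> \<le> dist (x + k) z" for x
  proof -
    define k :: "real^'n" where "k = (\<chi> i. real_of_int (round (z $ i - x $ i)))"
    define t where "t i = x $ i + k $ i - z $ i" for i
    have t_half: "\<bar>t i\<bar> \<le> 1/2" for i
      using of_int_round_abs_le[of "z $ i - x $ i"] by (simp add: t_def k_def abs_if split: if_splits)
    have "\<exists>i. e \<le> \<bar>t i\<bar>"
    proof (rule ccontr)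
      assume "\<not> (\<exists>i. e \<le> \<bar>t i\<bar>)"
      then have "(\<Sum>i\<in>UNIV. \<bar>(x + k - z) $ i\<bar>) < (\<Sum>i\<in>(UNIV::'n set). e)"
        by (intro sum_strict_mono) (auto simp: t_def not_le)
      then have "norm (x + k - z) < d * e"
        using norm_le_l1_cart[of "x + k - z"] by (simp add: d_def)
      then have "dist (x + k) z < \<epsilon>" using e(3) by (simp add: dist_norm)
      then show False using far[of k] by (simp add: k_def int_lattice_def)
    qed
    then obtain i0 where i0: "e \<le> \<bar>t i0\<bar>" by blast
    have cos_eq: "cos (2 * pi * (x $ i - z $ i)) = cos (2 * pi * t i)" for i
    proof -
      have "cos (2 * pi * t i) = cos (2 * pi * (x $ i - z $ i) + 2 * pi * real_of_int (round (z $ i - x $ i)))"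
        by (simp add: t_def k_def algebra_simps)
      also have "\<dots> = cos (2 * pi * (x $ i - z $ i))"
        by (simp add: cos_add cos_int_2pin sin_int_2pin)
      finally show ?thesis by simp
    qed
    define q where "q i = ((1 + cos (2 * pi * t i)) / 2) ^ N" for i
    have q01: "0 \<le> q i" "q i \<le> 1" for i
    proof -
      have "0 \<le> (1 + cos (2 * pi * t i)) / 2" "(1 + cos (2 * pi * t i)) / 2 \<le> 1"
        using cos_nonneg[of "2*pi*t i"] cos_le_one[of "2*pi*t i"] by auto
      then show "0 \<le> q i" "q i \<le> 1" unfolding q_def by (auto intro: power_le_one)
    qed
    have "cos (2 * pi * \<bar>t i0\<bar>) \<le> cos (2 * pi * e)"
      by (rule cos_monotone_0_pi_le) (use i0 e t_half[of i0] in auto)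
    moreover have "cos (2 * pi * \<bar>t i0\<bar>) = cos (2 * pi * t i0)" by (auto simp: abs_if)
    ultimately have q0: "q i0 \<le> \<rho> ^ N"
      unfolding q_def \<rho>_def using cos_nonneg[of "2*pi*t i0"] by (intro power_mono) auto
    have "(\<Prod>i\<in>UNIV. ((1 + cos (2 * pi * (x $ i - z $ i))) / 2) ^ N) = (\<Prod>i\<in>UNIV. q i)"
      by (simp add: cos_eq q_def)
    also have "\<dots> = q i0 * (\<Prod>i\<in>UNIV - {i0}. q i)"
      by (simp add: prod.remove[of UNIV i0])
    also have "\<dots> \<le> q i0 * 1"
      by (intro mult_left_mono prod_le_1) (auto simp: q01)
    finally show ?thesis using q0 by simp
  qed
  show ?thesis
  proof (intro exI[of _ "\<mu> ` H"] conjI allI impI)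
    show "finite (\<mu> ` H)" using finH by simp
    show "0 \<notin> \<mu> ` H"
      by (auto simp: \<mu>_def H_def vec_eq_iff fun_eq_iff)
    fix u assume u: "\<forall>m\<in>\<mu> ` H. m \<bullet> u \<noteq> 0"
    obtain L where L: "L \<ge> 0"
      "\<And>\<alpha>. \<exists>s\<in>{0..L}. \<rho> ^ N < c + (\<Sum>h\<in>H. C h * cos (\<alpha> h + (2 * pi * (\<mu> h \<bullet> u)) * s))"
      using cos_sum_exceeds[of H "\<lambda>h. 2 * pi * (\<mu> h \<bullet> u)" "\<rho> ^ N" c C] finH u c by auto
    have "\<exists>s\<in>{0..L}. \<exists>k. k \<in> int_lattice \<and> dist (y + s *\<^sub>R u + k) z < \<epsilon>" for y
    proof -
      obtain s where s: "s \<in> {0..L}"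
        "\<rho> ^ N < c + (\<Sum>h\<in>H. C h * cos (2 * pi * (\<mu> h \<bullet> (y - z)) + (2 * pi * (\<mu> h \<bullet> u)) * s))"
        using L(2)[of "\<lambda>h. 2 * pi * (\<mu> h \<bullet> (y - z))"] by blast
      define x where "x = y + s *\<^sub>R u"
      define \<theta> where "\<theta> = (2 * pi) *\<^sub>R (x - z)"
      have "(\<Prod>i\<in>UNIV. ((1 + cos (2 * pi * (x $ i - z $ i))) / 2) ^ N) = (\<Prod>i\<in>UNIV. ((1 + cos (\<theta> $ i)) / 2) ^ N)"
        by (simp add: \<theta>_def)
      also have "\<dots> = (\<Sum>h\<in>insert (\<lambda>_. N) H. C h * cos (\<mu> h \<bullet> \<theta>))"
        unfolding cos_product_expansion full C_def by (simp add: \<mu>_def inner_vec_def)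
      also have "\<dots> = c + (\<Sum>h\<in>H. C h * cos (\<mu> h \<bullet> \<theta>))"
      proof -
        have "(\<lambda>_. N) \<notin> H" by (simp add: H_def)
        moreover have "C (\<lambda>_. N) = c" by (simp add: C_def c_def d_def power_divide)
        moreover have "\<mu> (\<lambda>_. N) = 0" by (simp add: \<mu>_def vec_eq_iff)
        ultimately show ?thesis using finH by simp
      qed
      also have "(\<Sum>h\<in>H. C h * cos (\<mu> h \<bullet> \<theta>)) =
          (\<Sum>h\<in>H. C h * cos (2 * pi * (\<mu> h \<bullet> (y - z)) + (2 * pi * (\<mu> h \<bullet> u)) * s))"
        by (simp add: \<theta>_def x_def algebra_simps inner_simps)
      finally have "\<not> (\<Prod>i\<in>UNIV. ((1 + cos (2 * pi * (x $ i - z $ i))) / 2) ^ N) \<le> \<rho> ^ N"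
        using s(2) by simp
      then obtain k :: "real^'n" where "k \<in> int_lattice" "dist (x + k) z < \<epsilon>"
        using small[of x] by (meson not_le)
      then show ?thesis using s(1) unfolding x_def by blast
    qed
    then show "\<exists>L\<ge>0. \<forall>y. \<exists>s\<in>{0..L}. \<exists>k. k \<in> int_lattice \<and> dist (y + s *\<^sub>R u + k) z < \<epsilon>"
      using L(1) by blast
  qed
qed

section \<open>Closed subsemigroups of the real line\<close>

text \<open>Modulo \<open>l\<close> the multiples of \<open>d\<close> return arbitrarily close to 0, by Dirichlet's approximation theorem; the
  multiple just before a return approximates \<open>- d\<close>.\<close>

lemma closed_additive_semigroup_uminus:
  fixes D :: "real set"
  assumes cl: "closed D" and add: "\<And>x y. x \<in> D \<Longrightarrow> y \<in> D \<Longrightarrow> x + y \<in> D"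
    and l: "l > 0" "l \<in> D" "- l \<in> D" and d: "d \<in> D"
  shows "- d \<in> D"
proof -
  have zero: "0 \<in> D" using add[OF l(2,3)] by simp
  have nat_mult: "real n * x \<in> D" if "x \<in> D" for n x
    by (induction n) (use zero add that in \<open>auto simp: algebra_simps\<close>)
  have int_mult: "real_of_int h * l \<in> D" for h
  proof (cases "h \<ge> 0")
    case True
    then show ?thesis using nat_mult[OF l(2), of "nat h"] by simp
  next
    case False
    then show ?thesis using nat_mult[OF l(3), of "nat (- h)"] by simp
  qed
  have "\<exists>y\<in>D. dist y (- d) < e" if "e > 0" for e
  proof -
    obtain N :: nat where N: "real N > l / e" "N > 0"
      using reals_Archimedean2[of "max 0 (l / e)"] by (metis max_less_iff_conj of_nat_0_less_iff)
    obtain h k where hk: "0 < k" "\<bar>of_int k * (d / l) - of_int h\<bar> < 1 / N"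
      using Dirichlet_approx[OF N(2)] by metis
    define y where "y = real (nat (k - 1)) * d + real_of_int (- h) * l"
    have "y \<in> D" unfolding y_def by (intro add nat_mult int_mult d)
    moreover have "dist y (- d) < e"
    proof -
      have "real (nat (k - 1)) = of_int k - 1" using hk(1) by simp
      then have "y - (- d) = l * (of_int k * (d / l) - of_int h)"
        using l(1) by (simp add: y_def algebra_simps)
      then have "dist y (- d) = l * \<bar>of_int k * (d / l) - of_int h\<bar>"
        using l(1) by (simp only: dist_real_def abs_mult abs_of_pos)
      also have "\<dots> < l * (1 / N)" using hk(2) l(1) by (intro mult_strict_left_mono)
      also have "\<dots> < e" using N that l(1) by (simp add: field_simps)
      finally show ?thesis .
    qed
    ultimately show ?thesis by blast
  qed
  then show ?thesis using cl closed_approachable by blast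
qed

text \<open>By \<open>closed_additive_semigroup_uminus\<close> \<open>D\<close> is a closed group; the differences of \<open>a\<close> and nearby elements are arbitrarily small nonzero elements of \<open>D\<close>.\<close>

lemma closed_additive_semigroup_UNIV:
  fixes D :: "real set"
  assumes cl: "closed D" and add: "\<And>x y. x \<in> D \<Longrightarrow> y \<in> D \<Longrightarrow> x + y \<in> D"
    and l: "l > 0" "l \<in> D" "- l \<in> D" and a: "a islimpt D"
  shows "D = UNIV"
proof -
  have neg: "- x \<in> D" if "x \<in> D" for x
    using closed_additive_semigroup_uminus[OF cl add l that] .
  have aD: "a \<in> D" using cl a closed_limpt by blast
  have zero: "0 \<in> D" using add[OF l(2,3)] by simp
  have nat_mult: "real n * x \<in> D" if "x \<in> D" for n x
    by (induction n) (use zero add that in \<open>auto simp: algebra_simps\<close>)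
  have int_mult: "real_of_int h * x \<in> D" if "x \<in> D" for h x
  proof (cases "h \<ge> 0")
    case True
    then show ?thesis using nat_mult[OF that, of "nat h"] by simp
  next
    case False
    then show ?thesis using nat_mult[OF neg[OF that], of "nat (- h)"] by simp
  qed
  have "x \<in> D" for x
  proof -
    have "\<exists>y\<in>D. dist y x < e" if e: "e > 0" for e
    proof -
      obtain b where b: "b \<in> D" "b \<noteq> a" "dist b a < e"
        using a e unfolding islimpt_approachable by blast
      define q where "q = b - a"
      have q: "q \<in> D" "q \<noteq> 0" "\<bar>q\<bar> < e"
        using add[OF b(1) neg[OF aD]] b by (auto simp: q_def dist_real_def)
      define y where "y = real_of_int \<lfloor>x / q\<rfloor> * q"
      have "x / q - real_of_int \<lfloor>x / q\<rfloor> = frac (x / q)" by (simp add: frac_def)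
      then have "x - y = frac (x / q) * q"
        using q(2) by (simp add: y_def field_simps)
      then have "\<bar>x - y\<bar> = frac (x / q) * \<bar>q\<bar>" by (simp add: abs_mult)
      also have "\<dots> \<le> 1 * \<bar>q\<bar>" by (intro mult_right_mono) (auto simp: less_imp_le frac_lt_1)
      finally have "dist y x < e" using q(3) by (simp add: dist_real_def abs_minus_commute)
      moreover have "y \<in> D" unfolding y_def by (rule int_mult[OF q(1)])
      ultimately show ?thesis by blast
    qed
    then show ?thesis using cl closed_approachable by blast
  qed
  then show ?thesis by blast
qed

section \<open>Sets that accumulate at the origin\<close>

definition lattice_periodic :: "(real^'n) set \<Rightarrow> bool" where
  "lattice_periodic X \<longleftrightarrow> (\<forall>x\<in>X. \<forall>k\<in>int_lattice. x + k \<in> X)"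

definition mat_invariant :: "(real^'n^'n) set \<Rightarrow> (real^'n) set \<Rightarrow> bool" where
  "mat_invariant G X \<longleftrightarrow> (\<forall>A\<in>G. \<forall>x\<in>X. A *v x \<in> X)"

text \<open>The element \<open>g\<close> is only known through the limit of its normalized powers, which is inherited by \<open>g ^ N\<close> with the same \<open>v\<close>
  and \<open>f\<close>.  This lets the results below be applied to subsemigroups that contain just a power of \<open>g\<close>.\<close>

locale proximal_semigroup =
  fixes G :: "(real^'n^'n) set" and g :: "real^'n^'n" and lam :: real and v f :: "real^'n"
  assumes dim_gt_1: "CARD('n) > 1"
    and mult_closed: "\<And>A B. A \<in> G \<Longrightarrow> B \<in> G \<Longrightarrow> A ** B \<in> G"
    and invertible: "\<And>A. A \<in> G \<Longrightarrow> invertible A"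
    and irreducible: "family_irreducible G"
    and g_in: "g \<in> G" and lam: "lam > 1" and f_v: "f \<bullet> v = 1"
    and power_limit: "\<And>x. (\<lambda>n. (1 / lam ^ n) *\<^sub>R (mpow g n *v x)) \<longlonglongrightarrow> (f \<bullet> x) *\<^sub>R v"
begin

lemma lam_pos: "lam > 0"
  using lam by simp

lemma v_nz: "v \<noteq> 0" and f_nz: "f \<noteq> 0"
  using f_v by auto

lemma orbit_escapes:
  assumes "w \<noteq> 0" "finite \<U>" "\<And>U. U \<in> \<U> \<Longrightarrow> subspace U \<and> U \<noteq> UNIV"
  shows "\<exists>A\<in>G. A *v w \<notin> \<Union>\<U>"
  using orbit_not_in_finite_union[of G w \<U>] g_in mult_closed invertible irreducible assms by blast

lemma hyperplane_proper: "w \<noteq> 0 \<Longrightarrow> subspace {x. w \<bullet> x = 0} \<and> {x::real^'n. w \<bullet> x = 0} \<noteq> UNIV"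
  using subspace_hyperplane[of w] by (auto simp: set_eq_iff)

lemma dual_orbit_escapes:
  assumes "finite \<U>" "\<And>U. U \<in> \<U> \<Longrightarrow> subspace U \<and> U \<noteq> UNIV"
  shows "\<exists>A\<in>G. transpose A *v f \<notin> \<Union>\<U>"
proof -
  have "\<exists>A\<in>transpose ` G. A *v f \<notin> \<Union>\<U>"
  proof (rule orbit_not_in_finite_union)
    show "transpose ` G \<noteq> {}" using g_in by blast
    show "A ** B \<in> transpose ` G" if "A \<in> transpose ` G" "B \<in> transpose ` G" for A B
      using that mult_closed by (auto simp: matrix_transpose_mul[symmetric])
    show "invertible A" if "A \<in> transpose ` G" for A
      using that invertible transpose_invertible by blast
    show "family_irreducible (transpose ` G)"
      by (rule family_irreducible_transpose[OF invertible irreducible])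
  qed (use assms f_nz in auto)
  then show ?thesis by blast
qed

text \<open>The transposed orbit of \<open>f\<close> avoids the two hyperplanes orthogonal to \<open>w1\<close> and \<open>w2\<close>.\<close>

lemma ex_both_nonzero:
  assumes "w1 \<noteq> 0" "w2 \<noteq> 0"
  shows "\<exists>A\<in>G. f \<bullet> (A *v w1) \<noteq> 0 \<and> f \<bullet> (A *v w2) \<noteq> 0"
proof -
  have inner_row: "w \<bullet> (f v* A) = f \<bullet> (A *v w)" for w A
    by (metis inner_commute dot_lmul_matrix)
  have "\<exists>A\<in>G. transpose A *v f \<notin> \<Union>{{x. w1 \<bullet> x = 0}, {x. w2 \<bullet> x = 0}}"
    by (rule dual_orbit_escapes) (use hyperplane_proper[OF assms(1)] hyperplane_proper[OF assms(2)] in auto)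
  then show ?thesis
    by (auto simp: inner_row)
qed

lemma g_v: "g *v v = lam *\<^sub>R v"
proof (rule LIMSEQ_unique)
  let ?b = "\<lambda>n. (1 / lam ^ n) *\<^sub>R (mpow g n *v v)"
  have b: "?b \<longlonglongrightarrow> v" using power_limit[of v] f_v by simp
  show "(\<lambda>n. g *v ?b n) \<longlonglongrightarrow> g *v v"
    by (intro bounded_linear.tendsto[OF matrix_vector_mul_bounded_linear] b)
  have "(\<lambda>n. g *v ?b n) = (\<lambda>n. lam *\<^sub>R ?b (Suc n))"
    using lam_pos by (simp add: fun_eq_iff matrix_vector_mult_scaleR matrix_vector_mul_assoc)
  then show "(\<lambda>n. g *v ?b n) \<longlonglongrightarrow> lam *\<^sub>R v"
    using tendsto_scaleR[OF tendsto_const LIMSEQ_Suc[OF b], of lam] by simp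
qed

lemma mpow_g_v: "mpow g n *v v = lam ^ n *\<^sub>R v"
  by (induction n) (simp_all add: matrix_vector_mul_assoc[symmetric] matrix_vector_mult_scaleR g_v)

lemma power_limit_varying:
  assumes u: "u \<longlonglongrightarrow> e" and k: "filterlim k at_top sequentially"
  shows "(\<lambda>n. (1 / lam ^ k n) *\<^sub>R (mpow g (k n) *v u n)) \<longlonglongrightarrow> (f \<bullet> e) *\<^sub>R v"
proof -
  have expand: "M *v x = (\<Sum>i\<in>UNIV. x $ i *\<^sub>R (M *v axis i 1))" for M :: "real^'n^'n" and x
    using basis_expansion[of x] 
    by (metis (no_types, lifting) matrix_vector_mult_scaleR matrix_vector_mult_sum_right scalar_mult_eq_scaleR sum.cong)
  have "(\<lambda>n. \<Sum>i\<in>UNIV. u n $ i *\<^sub>R ((1 / lam ^ k n) *\<^sub>R (mpow g (k n) *v axis i 1)))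
      \<longlonglongrightarrow> (\<Sum>i\<in>UNIV. e $ i *\<^sub>R ((f \<bullet> axis i 1) *\<^sub>R v))"
  proof (rule tendsto_sum, rule tendsto_scaleR)
    show "(\<lambda>n. u n $ i) \<longlonglongrightarrow> e $ i" for i
      using u by (rule tendsto_vec_nth)
    show "(\<lambda>n. (1 / lam ^ k n) *\<^sub>R (mpow g (k n) *v axis i 1)) \<longlonglongrightarrow> (f \<bullet> axis i 1) *\<^sub>R v" for i
      by (rule filterlim_compose[OF power_limit k])
  qed
  moreover have "(\<Sum>i\<in>UNIV. e $ i *\<^sub>R ((f \<bullet> axis i 1) *\<^sub>R v)) = (f \<bullet> e) *\<^sub>R v"
    by (simp add: inner_axis inner_vec_def[of f e] scaleR_sum_left mult.commute)
  ultimately show ?thesis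
    by (subst expand) (simp add: scaleR_sum_right mult.commute)
qed

lemma mat_invariant_power:
  assumes "mat_invariant G X" "x \<in> X"
  shows "mpow g n *v x \<in> X"
  by (induction n) (use assms g_in in \<open>auto simp: mat_invariant_def matrix_vector_mul_assoc[symmetric]\<close>)

text \<open>Near a hypothetical point \<open>z\<close> outside \<open>X\<close> the harmful directions fill finitely many rational hyperplanes; move the segments by a matrix
  that takes \<open>u\<close> off all of them.  The base point \<open>x\<close> may depend on \<open>L\<close>, since the length needed does not
  depend on the position of the segment.\<close>

lemma long_segments_imp_UNIV:
  assumes cl: "closed X" and per: "lattice_periodic X" and invar: "mat_invariant G X"
    and u: "u \<noteq> 0" and seg: "\<And>L. L \<ge> 0 \<Longrightarrow> \<exists>x. \<forall>s\<in>{0..L}. x + s *\<^sub>R u \<in> X"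
  shows "X = UNIV"
proof (rule ccontr)
  assume "X \<noteq> UNIV"
  then obtain z where z: "z \<notin> X" by blast
  then obtain e where e: "e > 0" "\<And>y. y \<in> X \<Longrightarrow> e \<le> dist y z"
    using cl closed_approachable[of X z] by (meson not_le)
  obtain M where M: "finite M" "0 \<notin> M" and dense: "\<And>u. (\<forall>m\<in>M. m \<bullet> u \<noteq> 0) \<Longrightarrow>
     (\<exists>L\<ge>0. \<forall>y. \<exists>s\<in>{0..L}. \<exists>k. k \<in> int_lattice \<and> dist (y + s *\<^sub>R u + k) z < e)"
    using segment_dense_mod_lattice[OF e(1), of z] by blast
  have "\<exists>A\<in>G. A *v u \<notin> \<Union>((\<lambda>m. {x. m \<bullet> x = 0}) ` M)"
  proof (rule orbit_escapes[OF u])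
    fix U assume "U \<in> (\<lambda>m. {x. m \<bullet> x = 0}) ` M"
    then obtain m where "m \<in> M" "U = {x. m \<bullet> x = 0}" by blast
    then show "subspace U \<and> U \<noteq> UNIV" using hyperplane_proper[of m] M(2) by metis
  qed (use M in auto)
  then obtain A where A: "A \<in> G" "\<forall>m\<in>M. m \<bullet> (A *v u) \<noteq> 0" by blast
  obtain L where L: "L \<ge> 0" "\<And>y. \<exists>s\<in>{0..L}. \<exists>k. k \<in> int_lattice \<and> dist (y + s *\<^sub>R (A *v u) + k) z < e"
    using dense[OF A(2)] by blast
  obtain x where x: "\<forall>s\<in>{0..L}. x + s *\<^sub>R u \<in> X" using seg[OF L(1)] by blast
  obtain s k where s: "s \<in> {0..L}" "k \<in> int_lattice" "dist (A *v x + s *\<^sub>R (A *v u) + k) z < e"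
    using L(2) by blast
  have "A *v (x + s *\<^sub>R u) \<in> X" using invar A(1) x s(1) by (auto simp: mat_invariant_def)
  then have "A *v x + s *\<^sub>R (A *v u) + k \<in> X"
    using per s(2) by (simp add: lattice_periodic_def matrix_vector_right_distrib matrix_vector_mult_scaleR)
  then show False using e(2) s(3) by fastforce
qed

text \<open>Asking for all integer powers of \<open>lam\<close>, written as quotients, makes the set invariant under division by \<open>lam\<close>, although \<open>X\<close> itself
  is only invariant under \<open>g\<close>.\<close>

definition admissible :: "(real^'n) set \<Rightarrow> real set" where
  "admissible X = {t. \<forall>a b. (lam ^ a / lam ^ b * t) *\<^sub>R v \<in> X}"

lemma closed_admissible:
  assumes "closed X"
  shows "closed (admissible X)"
proof -
  have "admissible X = (\<Inter>a. \<Inter>b. (\<lambda>t. (lam ^ a / lam ^ b * t) *\<^sub>R v) -` X)"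
    by (auto simp: admissible_def)
  also have "closed \<dots>"
    by (intro closed_INT ballI closed_vimage assms continuous_intros)
  finally show ?thesis .
qed

lemma admissible_scale:
  assumes "t \<in> admissible X"
  shows "lam ^ c / lam ^ d * t \<in> admissible X"
  unfolding admissible_def
proof (rule CollectI, intro allI)
  fix a b
  have "lam ^ a / lam ^ b * (lam ^ c / lam ^ d * t) = lam ^ (a + c) / lam ^ (b + d) * t"
    by (simp add: power_add)
  then show "(lam ^ a / lam ^ b * (lam ^ c / lam ^ d * t)) *\<^sub>R v \<in> X"
    using assms unfolding admissible_def by (metis (mono_tags, lifting) mem_Collect_eq)
qed

text \<open>Start from \<open>lam ^ (- n) t v\<close>, apply \<open>h\<close> and then \<open>g ^ n\<close>, and let \<open>n\<close> tend to infinity.\<close>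

lemma admissible_coefficient:
  assumes cl: "closed X" and invar: "mat_invariant G X" and h: "h \<in> G" and t: "t \<in> admissible X"
  shows "f \<bullet> (h *v v) * t \<in> admissible X"
  unfolding admissible_def
proof (rule CollectI, intro allI)
  fix a b
  define c where "c = lam ^ a / lam ^ b * t"
  have lim: "(\<lambda>n. c *\<^sub>R ((1 / lam ^ n) *\<^sub>R (mpow g n *v (h *v v)))) \<longlonglongrightarrow> c *\<^sub>R ((f \<bullet> (h *v v)) *\<^sub>R v)"
    by (intro tendsto_scaleR tendsto_const power_limit)
  have "c *\<^sub>R ((1 / lam ^ n) *\<^sub>R (mpow g n *v (h *v v))) \<in> X" for n
  proof -
    have "(lam ^ a / lam ^ (b + n) * t) *\<^sub>R v \<in> X" using t by (simp add: admissible_def)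
    then have "h *v ((lam ^ a / lam ^ (b + n) * t) *\<^sub>R v) \<in> X"
      using invar h by (simp add: mat_invariant_def)
    then have "mpow g n *v (h *v ((lam ^ a / lam ^ (b + n) * t) *\<^sub>R v)) \<in> X"
      by (rule mat_invariant_power[OF invar])
    then show ?thesis
      by (simp add: matrix_vector_mult_scaleR c_def power_add)
  qed
  from closed_sequentially[OF cl this lim]
  show "(lam ^ a / lam ^ b * (f \<bullet> (h *v v) * t)) *\<^sub>R v \<in> X"
    by (simp add: c_def mult_ac)
qed

lemma power_window:
  assumes "0 < r" "r < 1"
  shows "\<exists>k. 1 \<le> lam ^ k * r \<and> lam ^ k * r \<le> lam"
proof -
  have ex: "\<exists>k. 1 \<le> lam ^ k * r"
    using real_arch_pow[OF lam, of "1 / r"] assms by (auto simp: field_simps intro: less_imp_le)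
  define k where "k = (LEAST k. 1 \<le> lam ^ k * r)"
  have k: "1 \<le> lam ^ k * r" unfolding k_def by (rule LeastI_ex[OF ex])
  then have "k \<noteq> 0" using assms by (cases k) auto
  then obtain m where m: "k = Suc m" by (cases k) auto
  have "\<not> 1 \<le> lam ^ m * r" using not_less_Least[of m "\<lambda>k. 1 \<le> lam ^ k * r"] m by (simp add: k_def)
  then have "lam * (lam ^ m * r) \<le> lam * 1" using lam by (intro mult_left_mono) auto
  then show ?thesis using k m by (intro exI[of _ k]) (simp add: mult.assoc)
qed

text \<open>Blow up points \<open>x\<^sub>n \<in> X\<close> tending to 0: choose \<open>k\<^sub>n\<close> so that \<open>lam ^ k\<^sub>n * norm x\<^sub>n\<close> lies in \<open>[1, lam]\<close>, and pass to a
  subsequence along which these numbers and the directions of \<open>x\<^sub>n\<close> converge.  A fixed \<open>h \<in> G\<close> moves the limit direction off the kernel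
  of \<open>f\<close>, so that \<open>g ^ (k\<^sub>n + j)\<close> applied to \<open>h x\<^sub>n\<close> converges to a nonzero multiple of \<open>v\<close>, for every integer \<open>j\<close>.\<close>

lemma admissible_nonzero:
  assumes cl: "closed X" and invar: "mat_invariant G X" and acc: "0 islimpt X"
  shows "\<exists>t\<in>admissible X. t \<noteq> 0"
proof -
  have "\<exists>x\<in>X. x \<noteq> 0 \<and> norm x < 1 / (real n + 2)" for n
    using acc unfolding islimpt_approachable by (auto simp: dist_norm dest!: spec[of _ "1 / (real n + 2)"])
  then obtain x where x: "\<And>n. x n \<in> X" "\<And>n. x n \<noteq> 0" "\<And>n. norm (x n) < 1 / (real n + 2)" by metis
  have x1: "0 < norm (x n)" "norm (x n) < 1" for n
  proof -
    show "0 < norm (x n)" using x(2) by simp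
    have "1 / (real n + 2) \<le> 1" by simp
    then show "norm (x n) < 1" using x(3)[of n] by linarith
  qed
  have "\<exists>k. 1 \<le> lam ^ k * norm (x n) \<and> lam ^ k * norm (x n) \<le> lam" for n
    by (rule power_window[OF x1])
  then obtain k where k: "\<And>n. 1 \<le> lam ^ k n * norm (x n)" "\<And>n. lam ^ k n * norm (x n) \<le> lam"
    by metis
  have k_large: "lam ^ k n \<ge> real n + 2" for n
  proof -
    have "1 \<le> lam ^ k n * (1 / (real n + 2))"
      using k(1)[of n] x(3)[of n] lam_pos by (meson less_imp_le mult_left_mono order_trans zero_le_power)
    then show ?thesis by (simp add: field_simps)
  qed
  have k_top: "filterlim k at_top sequentially"
    unfolding filterlim_at_top
  proof
    fix Z :: nat
    obtain n0 where n0: "real n0 > lam ^ Z" using reals_Archimedean2 by blast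
    have "Z \<le> k n" if "n \<ge> n0" for n
    proof (rule ccontr)
      assume "\<not> Z \<le> k n"
      then have "lam ^ k n \<le> lam ^ Z" using lam by (intro power_increasing) auto
      then show False using n0 k_large[of n] that by linarith
    qed
    then show "eventually (\<lambda>n. Z \<le> k n) sequentially" by (auto simp: eventually_sequentially)
  qed
  define S :: "((real^'n) \<times> real) set" where "S = sphere 0 1 \<times> {1..lam}"
  have "compact S" unfolding S_def by (intro compact_Times) auto
  moreover define p where "p n = (x n /\<^sub>R norm (x n), lam ^ k n * norm (x n))" for n
  have "\<forall>n. p n \<in> S" using k x(2) by (auto simp: p_def S_def)
  ultimately obtain q \<sigma> where q: "q \<in> S" "strict_mono \<sigma>" "(p \<circ> \<sigma>) \<longlonglongrightarrow> q"
    using compact_imp_seq_compact seq_compactE by metis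
  obtain e s where es: "q = (e, s)" by (cases q)
  have e: "e \<noteq> 0" and s: "s \<ge> 1" using q(1) by (auto simp: es S_def)
  have lim_e: "(\<lambda>n. x (\<sigma> n) /\<^sub>R norm (x (\<sigma> n))) \<longlonglongrightarrow> e"
    using tendsto_fst[OF q(3)] by (simp add: es p_def o_def)
  have lim_s: "(\<lambda>n. lam ^ k (\<sigma> n) * norm (x (\<sigma> n))) \<longlonglongrightarrow> s"
    using tendsto_snd[OF q(3)] by (simp add: es p_def o_def)
  obtain h where h: "h \<in> G" "f \<bullet> (h *v e) \<noteq> 0" using ex_both_nonzero[OF e e] by blast
  define t where "t = s * (f \<bullet> (h *v e))"
  have k\<sigma>: "filterlim (\<lambda>n. k (\<sigma> n)) at_top sequentially"
    using filterlim_compose[OF k_top filterlim_subseq[OF q(2)]] .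
  have "(lam ^ a / lam ^ b * t) *\<^sub>R v \<in> X" for a b
  proof -
    define m where "m n = k (\<sigma> n) + a - b" for n
    have m_top: "filterlim m at_top sequentially"
      unfolding filterlim_at_top
    proof
      fix Z :: nat
      have "eventually (\<lambda>n. Z + b \<le> k (\<sigma> n)) sequentially"
        using k\<sigma> unfolding filterlim_at_top by blast
      then show "eventually (\<lambda>n. Z \<le> m n) sequentially"
        by (rule eventually_mono) (simp add: m_def)
    qed
    define u where "u n = h *v (x (\<sigma> n) /\<^sub>R norm (x (\<sigma> n)))" for n
    have "u \<longlonglongrightarrow> h *v e"
      unfolding u_def by (intro bounded_linear.tendsto[OF matrix_vector_mul_bounded_linear] lim_e)
    note pl = power_limit_varying[OF this m_top]
    have lim: "(\<lambda>n. (lam ^ a / lam ^ b * (lam ^ k (\<sigma> n) * norm (x (\<sigma> n)))) *\<^sub>R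
         ((1 / lam ^ m n) *\<^sub>R (mpow g (m n) *v u n))) \<longlonglongrightarrow> (lam ^ a / lam ^ b * s) *\<^sub>R ((f \<bullet> (h *v e)) *\<^sub>R v)"
      by (rule tendsto_scaleR[OF _ pl]) (intro tendsto_mult tendsto_const lim_s)
    have ev: "eventually (\<lambda>n. (lam ^ a / lam ^ b * (lam ^ k (\<sigma> n) * norm (x (\<sigma> n)))) *\<^sub>R
         ((1 / lam ^ m n) *\<^sub>R (mpow g (m n) *v u n)) \<in> X) sequentially"
    proof -
      have "eventually (\<lambda>n. b \<le> k (\<sigma> n)) sequentially"
        using k\<sigma> unfolding filterlim_at_top by blast
      then show ?thesis
      proof (rule eventually_mono)
        fix n assume "b \<le> k (\<sigma> n)"
        then have "lam ^ m n * lam ^ b = lam ^ k (\<sigma> n) * lam ^ a"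
          by (simp add: m_def power_add[symmetric])
        then have "lam ^ a / lam ^ b * lam ^ k (\<sigma> n) = lam ^ m n"
          using lam_pos by (simp add: field_simps)
        then have "lam ^ a / lam ^ b * (lam ^ k (\<sigma> n) * norm (x (\<sigma> n))) * (1 / lam ^ m n) = norm (x (\<sigma> n))"
          using lam_pos by (simp only: mult.assoc[symmetric]) simp
        then have "(lam ^ a / lam ^ b * (lam ^ k (\<sigma> n) * norm (x (\<sigma> n)))) *\<^sub>R
         ((1 / lam ^ m n) *\<^sub>R (mpow g (m n) *v u n)) = norm (x (\<sigma> n)) *\<^sub>R (mpow g (m n) *v u n)"
          by (simp only: scaleR_scaleR)
        also have "\<dots> = mpow g (m n) *v (h *v x (\<sigma> n))"
          using x(2) by (simp add: u_def matrix_vector_mult_scaleR)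
        also have "\<dots> \<in> X"
          using mat_invariant_power[OF invar] invar h(1) x(1) by (auto simp: mat_invariant_def)
        finally show "(lam ^ a / lam ^ b * (lam ^ k (\<sigma> n) * norm (x (\<sigma> n)))) *\<^sub>R
         ((1 / lam ^ m n) *\<^sub>R (mpow g (m n) *v u n)) \<in> X" .
      qed
    qed
    have "(lam ^ a / lam ^ b * s) *\<^sub>R ((f \<bullet> (h *v e)) *\<^sub>R v) \<in> X"
      by (rule Lim_in_closed_set[OF cl ev _ lim]) simp
    then show ?thesis by (simp add: t_def mult.assoc)
  qed
  then have "t \<in> admissible X" by (simp add: admissible_def)
  moreover have "t \<noteq> 0" using s h by (simp add: t_def)
  ultimately show ?thesis by blast
qed

lemma ex_transversal:
  "\<exists>k\<in>G. f \<bullet> (k *v v) \<noteq> 0 \<and> k *v v - (f \<bullet> (k *v v)) *\<^sub>R v \<noteq> 0"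
proof -
  have "\<exists>k\<in>G. k *v v \<notin> \<Union>{span {v}, {x. f \<bullet> x = 0}}"
  proof (rule orbit_escapes[OF v_nz])
    have "dim (span {v}) \<le> 1" by simp
    then have "dim (span {v}) < DIM(real^'n)" using dim_gt_1 by simp
    then have "span {v} \<noteq> UNIV" by (metis dim_UNIV dim_eq_full less_irrefl span_UNIV)
    then show "subspace U \<and> U \<noteq> UNIV" if "U \<in> {span {v}, {x. f \<bullet> x = 0}}" for U
      using that hyperplane_proper[OF f_nz] by auto
  qed auto
  then obtain k where k: "k \<in> G" "k *v v \<notin> span {v}" "f \<bullet> (k *v v) \<noteq> 0" by auto
  have "(f \<bullet> (k *v v)) *\<^sub>R v \<in> span {v}" by (intro span_mul span_base) simp
  then have "k *v v - (f \<bullet> (k *v v)) *\<^sub>R v \<noteq> 0" using k(2) by auto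
  then show ?thesis using k by blast
qed

text \<open>The span of the orbit of \<open>w\<close> under the invertible \<open>g\<close> is mapped onto itself, so it is spanned by any tail of the orbit.\<close>

lemma orbit_tail_vanishing:
  assumes van: "\<And>n. n \<ge> N \<Longrightarrow> p \<bullet> (mpow g n *v w) = 0"
  shows "p \<bullet> w = 0"
proof -
  define U where "U = span (range (\<lambda>n. mpow g n *v w))"
  have inv: "invertible (mpow g n)" for n
  proof (induction n)
    case 0
    show ?case by (auto simp: invertible_def intro: exI[of _ "mat 1"])
  next
    case (Suc n)
    then show ?case using invertible[OF g_in] by (simp add: invertible_mult)
  qed
  have img: "(*v) (mpow g N) ` U = span (range (\<lambda>n. mpow g (N + n) *v w))"
    unfolding U_def by (subst span_linear_image[symmetric]) (auto simp: image_image mpow_add matrix_vector_mul_assoc)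
  also have "\<dots> \<subseteq> U"
    unfolding U_def by (intro span_mono) auto
  finally have sub: "(*v) (mpow g N) ` U \<subseteq> U" .
  have "(*v) (mpow g N) ` U = U"
    by (rule subspace_dim_equal[OF _ _ sub])
       (auto simp: U_def dim_invertible_image[OF inv] intro: linear_subspace_image)
  then have "w \<in> span (range (\<lambda>n. mpow g (N + n) *v w))"
    unfolding img[symmetric] unfolding U_def by (auto intro!: span_base range_eqI[of _ _ 0])
  moreover have "span (range (\<lambda>n. mpow g (N + n) *v w)) \<subseteq> {x. p \<bullet> x = 0}"
    by (rule span_minimal) (auto simp: van subspace_hyperplane)
  ultimately show ?thesis by blast
qed

text \<open>Let \<open>D\<close> be the set of logarithms of positive multipliers that preserve the admissible parameters.  It is a closed semigroup
  containing \<open>\<plusminus> ln lam\<close>, and the numbers \<open>ln (a n)\<^sup>2\<close> below lie in it.  They converge to \<open>ln A\<^sup>2\<close> but differ from it infinitely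
  often, so \<open>D\<close> is the whole line and \<open>X\<close> contains a ray in direction \<open>v\<close>.\<close>

lemma accumulation_at_zero_imp_UNIV:
  assumes cl: "closed X" and per: "lattice_periodic X" and invar: "mat_invariant G X" and acc: "0 islimpt X"
  shows "X = UNIV"
proof -
  obtain t0 where t0: "t0 \<in> admissible X" "t0 \<noteq> 0"
    using admissible_nonzero[OF cl invar acc] by blast
  define D where "D = {x. \<forall>t\<in>admissible X. exp x * t \<in> admissible X}"
  have "D = (\<Inter>t\<in>admissible X. (\<lambda>x. exp x * t) -` admissible X)" by (auto simp: D_def)
  also have "closed \<dots>"
    by (intro closed_INT ballI closed_vimage closed_admissible cl continuous_intros)
  finally have clD: "closed D" .
  have addD: "x + y \<in> D" if "x \<in> D" "y \<in> D" for x y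
    using that by (simp add: D_def exp_add mult.assoc)
  have lamD: "ln lam \<in> D" "- ln lam \<in> D"
    using admissible_scale[of _ X 1 0] admissible_scale[of _ X 0 1] lam_pos
    by (auto simp: D_def exp_minus field_simps)
  have ln_lam: "ln lam > 0" using lam by simp
  obtain k where k: "k \<in> G" "f \<bullet> (k *v v) \<noteq> 0" and w0: "k *v v - (f \<bullet> (k *v v)) *\<^sub>R v \<noteq> 0"
    using ex_transversal by blast
  define w where "w = k *v v - (f \<bullet> (k *v v)) *\<^sub>R v"
  have fw: "f \<bullet> w = 0" by (simp add: w_def inner_diff_right f_v)
  have kv: "k *v v = (f \<bullet> (k *v v)) *\<^sub>R v + w" by (simp add: w_def)
  obtain h where h: "h \<in> G" "f \<bullet> (h *v v) \<noteq> 0" "f \<bullet> (h *v w) \<noteq> 0"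
    using ex_both_nonzero[OF v_nz] w0 unfolding w_def by blast
  define a where "a n = f \<bullet> (h *v (mpow g n *v (k *v v))) / lam ^ n" for n
  define A where "A = (f \<bullet> (h *v v)) * (f \<bullet> (k *v v))"
  define r where "r n = f \<bullet> (h *v (mpow g n *v w)) / lam ^ n" for n
  have A0: "A \<noteq> 0" using h k by (simp add: A_def)
  have aAr: "a n = A + r n" for n
  proof -
    have "mpow g n *v (k *v v) = (f \<bullet> (k *v v) * lam ^ n) *\<^sub>R v + mpow g n *v w"
      by (subst kv) (simp add: matrix_vector_right_distrib matrix_vector_mult_scaleR mpow_g_v)
    then show ?thesis
      using lam_pos by (simp add: a_def A_def r_def matrix_vector_right_distrib matrix_vector_mult_scaleR
          inner_add_right add_divide_distrib)
  qed
  have r0: "r \<longlonglongrightarrow> 0"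
  proof -
    have "(\<lambda>n. f \<bullet> (h *v ((1 / lam ^ n) *\<^sub>R (mpow g n *v w)))) \<longlonglongrightarrow> f \<bullet> (h *v ((f \<bullet> w) *\<^sub>R v))"
      by (intro tendsto_inner tendsto_const bounded_linear.tendsto[OF matrix_vector_mul_bounded_linear] power_limit)
    then show ?thesis by (simp add: fw r_def[abs_def] matrix_vector_mult_scaleR)
  qed
  have freq: "\<exists>n\<ge>N. r n \<noteq> 0" for N
  proof (rule ccontr)
    assume "\<not> (\<exists>n\<ge>N. r n \<noteq> 0)"
    then have "(transpose h *v f) \<bullet> (mpow g n *v w) = 0" if "n \<ge> N" for n
      using that lam_pos by (auto simp: r_def dot_lmul_matrix)
    from orbit_tail_vanishing[OF this] show False using h(3) by (simp add: dot_lmul_matrix)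
  qed
  have a_lim: "a \<longlonglongrightarrow> A" using tendsto_add[OF tendsto_const[of A] r0] by (simp add: aAr[abs_def])
  have aD: "ln ((a n)\<^sup>2) \<in> D" if "a n \<noteq> 0" for n
  proof -
    have "(a n)\<^sup>2 * t \<in> admissible X" if t: "t \<in> admissible X" for t
    proof -
      have hgk: "h ** (mpow g n ** k) \<in> G"
        using h(1) k(1) mult_closed mpow_closed[of G g n] g_in by (cases "n = 0") auto
      have step: "a n * t \<in> admissible X" if "t \<in> admissible X" for t
      proof -
        have "lam ^ 0 / lam ^ n * (f \<bullet> ((h ** (mpow g n ** k)) *v v) * t) \<in> admissible X"
          by (intro admissible_scale admissible_coefficient cl invar hgk that)
        then show ?thesis by (simp add: a_def matrix_vector_mul_assoc[symmetric])
      qed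
      have "a n * (a n * t) \<in> admissible X" by (intro step t)
      then show ?thesis by (simp add: power2_eq_square mult.assoc)
    qed
    then show ?thesis using that by (simp add: D_def)
  qed
  have lim: "(\<lambda>n. ln ((a n)\<^sup>2)) \<longlonglongrightarrow> ln (A\<^sup>2)"
    using A0 by (intro tendsto_ln tendsto_power a_lim) simp
  have "ln (A\<^sup>2) islimpt D"
    unfolding islimpt_approachable
  proof (intro allI impI)
    fix e :: real assume e: "e > 0"
    have "eventually (\<lambda>n. dist (ln ((a n)\<^sup>2)) (ln (A\<^sup>2)) < e) sequentially"
      using tendstoD[OF lim e] .
    moreover have "eventually (\<lambda>n. dist (a n) A < \<bar>A\<bar>) sequentially"
      using tendstoD[OF a_lim] A0 by simp
    ultimately have "eventually (\<lambda>n. dist (ln ((a n)\<^sup>2)) (ln (A\<^sup>2)) < e \<and> dist (a n) A < \<bar>A\<bar>) sequentially"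
      by (rule eventually_conj)
    then obtain N where N: "\<And>n. n \<ge> N \<Longrightarrow> dist (ln ((a n)\<^sup>2)) (ln (A\<^sup>2)) < e \<and> dist (a n) A < \<bar>A\<bar>"
      unfolding eventually_sequentially by blast
    obtain n where n: "n \<ge> N" "r n \<noteq> 0" using freq by blast
    have close: "dist (ln ((a n)\<^sup>2)) (ln (A\<^sup>2)) < e" "\<bar>a n - A\<bar> < \<bar>A\<bar>"
      using N[OF n(1)] by (auto simp: dist_real_def)
    have "a n \<noteq> 0" "a n \<noteq> - A" "a n \<noteq> A" using close(2) n(2) aAr[of n] by auto
    then have "(a n)\<^sup>2 \<noteq> A\<^sup>2" by (auto simp: power2_eq_iff)
    then have "ln ((a n)\<^sup>2) \<noteq> ln (A\<^sup>2)" using A0 \<open>a n \<noteq> 0\<close> by simp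
    then show "\<exists>x'\<in>D. x' \<noteq> ln (A\<^sup>2) \<and> dist x' (ln (A\<^sup>2)) < e"
      using aD[OF \<open>a n \<noteq> 0\<close>] close(1) by blast
  qed
  from closed_additive_semigroup_UNIV[OF clD addD ln_lam lamD this]
  have D: "D = UNIV" .
  have ray: "(s * t0) *\<^sub>R v \<in> X" if "s > 0" for s
  proof -
    have "ln s \<in> D" using D by simp
    then have "s * t0 \<in> admissible X" using t0(1) that by (auto simp: D_def)
    then have "(lam ^ 0 / lam ^ 0 * (s * t0)) *\<^sub>R v \<in> X" unfolding admissible_def by blast
    then show ?thesis by simp
  qed
  show ?thesis
  proof (rule long_segments_imp_UNIV[OF cl per invar])
    show "t0 *\<^sub>R v \<noteq> 0" using t0 v_nz by simp
    show "\<exists>x. \<forall>s\<in>{0..L}. x + s *\<^sub>R (t0 *\<^sub>R v) \<in> X" for L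
    proof (intro exI ballI)
      fix s assume "s \<in> {0..L}"
      then have "((1 + s) * t0) *\<^sub>R v \<in> X" by (intro ray) auto
      then show "t0 *\<^sub>R v + s *\<^sub>R (t0 *\<^sub>R v) \<in> X" by (simp add: algebra_simps)
    qed
  qed
qed

end

section \<open>Integer matrices and lattice-periodic sets\<close>

lemma int_lattice_uminus: "k \<in> int_lattice \<Longrightarrow> - k \<in> int_lattice"
  by (simp add: int_lattice_def)

lemma real_mat_int_lattice: "k \<in> int_lattice \<Longrightarrow> real_mat M *v k \<in> int_lattice"
  by (auto simp: int_lattice_def matrix_vector_mult_def intro!: Ints_sum Ints_mult)

lemma torus_proj_eq_iff: "torus_proj x = torus_proj y \<longleftrightarrow> x - y \<in> int_lattice"
  by (simp add: torus.abs_eq_iff integer_congruent_def int_lattice_def)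

lemma lattice_periodic_iff:
  assumes "lattice_periodic X" "x - y \<in> int_lattice"
  shows "x \<in> X \<longleftrightarrow> y \<in> X"
proof -
  have "y = x + - (x - y)" "x = y + (x - y)" by simp_all
  then show ?thesis
    using assms int_lattice_uminus[OF assms(2)] unfolding lattice_periodic_def by metis
qed

lemma real_mat_mult: "real_mat (A ** B) = real_mat A ** real_mat B"
  by (simp add: vec_eq_iff matrix_matrix_mult_def)

lemma real_mat_mat_1: "real_mat (mat 1) = mat 1"
  by (simp add: vec_eq_iff mat_def)

lemma real_mat_mpow: "real_mat (mpow A n) = mpow (real_mat A) n"
  by (induction n) (simp_all add: real_mat_mult real_mat_mat_1)

lemma det_real_mat: "det (real_mat A) = real_of_int (det A)"
  by (simp add: det_def)

lemma det_Ints: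
  fixes A :: "real^'n^'n"
  assumes "\<And>i j. A $ i $ j \<in> \<int>"
  shows "det A \<in> \<int>"
  unfolding det_def using assms by (intro Ints_sum Ints_mult Ints_prod) auto

lemma finite_vec_entries:
  assumes "finite S"
  shows "finite {x :: 'a^'n. \<forall>i. x $ i \<in> S}"
proof (rule finite_subset)
  show "{x :: 'a^'n. \<forall>i. x $ i \<in> S} \<subseteq> vec_lambda ` (PiE UNIV (\<lambda>_. S))"
  proof
    fix x :: "'a^'n" assume "x \<in> {x. \<forall>i. x $ i \<in> S}"
    then show "x \<in> vec_lambda ` (PiE UNIV (\<lambda>_. S))"
      by (intro image_eqI[of _ _ "vec_nth x"]) (auto simp: vec_nth_inverse)
  qed
  show "finite (vec_lambda ` (PiE (UNIV :: 'n set) (\<lambda>_. S)))"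
    by (intro finite_imageI finite_PiE) (use assms in auto)
qed

lemma bounded_representative:
  assumes "lattice_periodic X" "x \<in> X"
  shows "\<exists>y\<in>X \<inter> cbox 0 1. torus_proj y = torus_proj x"
proof -
  define y where "y = (\<chi> i. frac (x $ i))"
  have diff: "x - y \<in> int_lattice" by (simp add: y_def int_lattice_def frac_def)
  have "y \<in> cbox 0 1" by (auto simp: mem_box_cart y_def less_imp_le frac_lt_1)
  moreover have "y \<in> X" using lattice_periodic_iff[OF assms(1) diff] assms(2) by simp
  moreover have "torus_proj y = torus_proj x" using diff torus_proj_eq_iff[of x y] by simp
  ultimately show ?thesis by blast
qed

lemma infinite_imp_limit_point:
  assumes "lattice_periodic X" "infinite (torus_proj ` X)"
  shows "\<exists>p. p islimpt X"
proof -
  have "torus_proj ` X \<subseteq> torus_proj ` (X \<inter> cbox 0 1)"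
  proof
    fix q assume "q \<in> torus_proj ` X"
    then obtain x where "x \<in> X" "q = torus_proj x" by blast
    then show "q \<in> torus_proj ` (X \<inter> cbox 0 1)"
      using bounded_representative[OF assms(1)] by (metis image_eqI)
  qed
  then have "infinite (X \<inter> cbox 0 1)" using assms(2) finite_subset finite_imageI by metis
  then obtain p where "p islimpt (X \<inter> cbox 0 1)"
    using compact_eq_Bolzano_Weierstrass[of "cbox 0 (1 :: real^'a)"] by (meson compact_cbox inf_le2)
  then show ?thesis using islimpt_subset by blast
qed

lemma islimpt_inj_image:
  fixes h :: "'a::metric_space \<Rightarrow> 'b::metric_space"
  assumes "x islimpt X" "isCont h x" "inj h"
  shows "h x islimpt h ` X"
  by (rule islimpt_isCont_image[OF assms(1,2)])
     (use assms(3) in \<open>auto simp: eventually_at_filter inj_eq\<close>)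

lemma islimpt_translation:
  fixes x :: "'a::real_normed_vector"
  assumes "x islimpt X"
  shows "x + k islimpt (\<lambda>y. y + k) ` X"
  by (rule islimpt_inj_image[OF assms]) (auto simp: inj_def intro!: continuous_intros)

lemma derived_lattice_periodic:
  assumes "lattice_periodic X"
  shows "lattice_periodic {x. x islimpt X}"
  unfolding lattice_periodic_def
proof (intro ballI)
  fix x k :: "real^'a" assume x: "x \<in> {x. x islimpt X}" and k: "k \<in> int_lattice"
  have "(\<lambda>y. y + k) ` X \<subseteq> X" using assms k by (auto simp: lattice_periodic_def)
  then show "x + k \<in> {x. x islimpt X}"
    using islimpt_translation[of x X k] x islimpt_subset by blast
qed

lemma derived_mat_invariant:
  assumes "\<And>A. A \<in> G \<Longrightarrow> invertible A" "mat_invariant G X"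
  shows "mat_invariant G {x. x islimpt X}"
  unfolding mat_invariant_def
proof (intro ballI)
  fix A x assume A: "A \<in> G" and x: "x \<in> {x. x islimpt X}"
  have "A *v x islimpt (*v) A ` X"
    by (rule islimpt_inj_image)
       (use x inj_invertible assms(1) A in \<open>auto intro!: linear_continuous_at matrix_vector_mul_bounded_linear\<close>)
  moreover have "(*v) A ` X \<subseteq> X" using assms(2) A by (auto simp: mat_invariant_def)
  ultimately show "A *v x \<in> {x. x islimpt X}" using islimpt_subset by blast
qed

lemma finite_range_collision:
  assumes "finite S" "\<And>n. h n \<in> S"
  obtains i j :: nat where "i < j" "h i = h j"
proof -
  have "\<not> inj h"
    using assms finite_subset[of "range h" S] range_inj_infinite[of h] by blast
  then obtain i j where "i \<noteq> j" "h i = h j" by (auto simp: inj_def)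
  then show thesis using that[of i j] that[of j i] by (cases "i < j") auto
qed

lemma finite_spanning_subset:
  assumes "span (h ` S) = (UNIV :: (real^'n) set)"
  obtains F where "finite F" "F \<subseteq> S" "span (h ` F) = UNIV"
proof -
  obtain B where B: "B \<subseteq> h ` S" "independent B" "h ` S \<subseteq> span B"
    using maximal_independent_subset by blast
  have "finite B" using B(2) by (rule independent_imp_finite)
  then obtain F where F: "F \<subseteq> S" "finite F" "B = h ` F"
    using finite_subset_image[OF _ B(1)] by blast
  have "span (h ` S) \<subseteq> span B" using B(3) by (simp add: span_minimal)
  then show thesis using that F assms by auto
qed

section \<open>Subsemigroups that remain irreducible\<close>

context proximal_semigroup
begin

lemma f_g: "f \<bullet> (g *v x) = lam * (f \<bullet> x)"
proof -
  have "(\<lambda>n. lam *\<^sub>R ((1 / lam ^ Suc n) *\<^sub>R (mpow g (Suc n) *v x))) \<longlonglongrightarrow> lam *\<^sub>R ((f \<bullet> x) *\<^sub>R v)"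
    by (rule tendsto_scaleR[OF tendsto_const LIMSEQ_Suc[OF power_limit]])
  moreover have "lam *\<^sub>R ((1 / lam ^ Suc n) *\<^sub>R (mpow g (Suc n) *v x)) = (1 / lam ^ n) *\<^sub>R (mpow g n *v (g *v x))" for n
    using lam_pos by (simp add: matrix_vector_mul_assoc[symmetric] mpow_commute)
  ultimately have "(\<lambda>n. (1 / lam ^ n) *\<^sub>R (mpow g n *v (g *v x))) \<longlonglongrightarrow> lam *\<^sub>R ((f \<bullet> x) *\<^sub>R v)"
    by simp
  from LIMSEQ_unique[OF power_limit[of "g *v x"] this] show ?thesis using v_nz by simp
qed

lemma f_mpow_g: "f \<bullet> (mpow g n *v x) = lam ^ n * (f \<bullet> x)"
  by (induction n) (simp_all add: matrix_vector_mul_assoc[symmetric] f_g)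

text \<open>Along the powers of \<open>g\<close> the coefficient \<open>f \<bullet> x\<close> is multiplied by \<open>lam > 1\<close>.\<close>

lemma infinite_orbit:
  assumes "w \<noteq> 0"
  shows "infinite ((\<lambda>A. A *v w) ` G)"
proof
  assume fin: "finite ((\<lambda>A. A *v w) ` G)"
  obtain h where h: "h \<in> G" "f \<bullet> (h *v w) \<noteq> 0" using ex_both_nonzero[OF assms assms] by blast
  have "mpow g (Suc n) *v (h *v w) \<in> (\<lambda>A. A *v w) ` G" for n
    using mult_closed[OF mpow_closed[OF mult_closed g_in, of "Suc n"] h(1)]
    by (auto simp: matrix_vector_mul_assoc)
  then obtain i j where ij: "i < j" "mpow g (Suc i) *v (h *v w) = mpow g (Suc j) *v (h *v w)"
    using finite_range_collision[OF fin, of "\<lambda>n. mpow g (Suc n) *v (h *v w)"] by blast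
  then have "lam ^ Suc i * (f \<bullet> (h *v w)) = lam ^ Suc j * (f \<bullet> (h *v w))"
    by (metis f_mpow_g)
  then have "lam ^ Suc i = lam ^ Suc j" using h(2) by simp
  moreover have "lam ^ Suc i < lam ^ Suc j" using ij(1) lam by (intro power_strict_increasing) auto
  ultimately show False by (metis less_irrefl)
qed

lemma subsemigroup:
  assumes "H \<subseteq> G" "\<And>A B. A \<in> H \<Longrightarrow> B \<in> H \<Longrightarrow> A ** B \<in> H" "family_irreducible H"
    and N: "N > 0" "mpow g N \<in> H"
  shows "proximal_semigroup H (mpow g N) (lam ^ N) v f"
proof
  show "lam ^ N > 1" using lam N(1) by simp
  fix x
  have "strict_mono (\<lambda>n. N * n)" using N(1) by (simp add: strict_mono_def)
  from LIMSEQ_subseq_LIMSEQ[OF power_limit[of x] this]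
  show "(\<lambda>n. (1 / (lam ^ N) ^ n) *\<^sub>R (mpow (mpow g N) n *v x)) \<longlonglongrightarrow> (f \<bullet> x) *\<^sub>R v"
    by (simp add: o_def mpow_mpow power_mult)
qed (use assms dim_gt_1 invertible f_v in auto)

text \<open>Some power \<open>g ^ p\<close> maps \<open>W\<close> to itself; if \<open>W\<close> has a vector outside the kernel of \<open>f\<close>, the normalized iterates of
  that vector converge within \<open>W\<close> to a multiple of \<open>v\<close>.\<close>

lemma invariant_family_dichotomy:
  assumes fin: "finite \<W>" and sub: "\<And>W. W \<in> \<W> \<Longrightarrow> subspace W"
    and stable: "\<And>W. W \<in> \<W> \<Longrightarrow> (*v) g ` W \<in> \<W>" and W: "W \<in> \<W>"
  shows "v \<in> W \<or> W \<subseteq> {x. f \<bullet> x = 0}"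
proof (rule disjCI)
  assume "\<not> W \<subseteq> {x. f \<bullet> x = 0}"
  then obtain w where w: "w \<in> W" "f \<bullet> w \<noteq> 0" by blast
  have "(*v) (mpow g n) ` W \<in> \<W>" for n
  proof (induction n)
    case (Suc n)
    then show ?case using stable by (simp add: image_image matrix_vector_mul_assoc[symmetric]) (metis image_image)
  qed (use W in simp)
  then obtain i j where ij: "i < j" "(*v) (mpow g i) ` W = (*v) (mpow g j) ` W"
    using finite_range_collision[OF fin, of "\<lambda>n. (*v) (mpow g n) ` W"] by blast
  define p where "p = j - i"
  have p: "p > 0" using ij(1) by (simp add: p_def)
  have inv: "invertible (mpow g i)"
  proof (cases "i = 0")
    case True
    then show ?thesis by (auto simp: invertible_def intro: exI[of _ "mat 1"])
  qed (use invertible mpow_closed[OF mult_closed g_in] in auto)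
  have "(*v) (mpow g j) ` W = (*v) (mpow g i) ` ((*v) (mpow g p) ` W)"
    using ij(1) mpow_add[of g i p] by (simp add: p_def image_image matrix_vector_mul_assoc)
  then have "(*v) (mpow g p) ` W = W"
    using ij(2) inj_image_eq_iff[OF inj_invertible[OF inv]] by metis
  then have step: "mpow g p *v x \<in> W" if "x \<in> W" for x using that by blast
  have pow: "mpow g (p * n) *v w \<in> W" for n
    by (induction n) (use w step in \<open>auto simp: mpow_add matrix_vector_mul_assoc[symmetric]\<close>)
  have "strict_mono (\<lambda>n. p * n)" using p by (simp add: strict_mono_def)
  from LIMSEQ_subseq_LIMSEQ[OF power_limit[of w] this]
  have lim: "(\<lambda>n. (1 / lam ^ (p * n)) *\<^sub>R (mpow g (p * n) *v w)) \<longlonglongrightarrow> (f \<bullet> w) *\<^sub>R v"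
    by (simp add: o_def)
  have "closed W" by (rule closed_subspace[OF sub[OF W]])
  then have "(f \<bullet> w) *\<^sub>R v \<in> W"
    by (rule closed_sequentially[OF _ _ lim]) (intro subspace_scale[OF sub[OF W]] pow)
  then have "(1 / (f \<bullet> w)) *\<^sub>R ((f \<bullet> w) *\<^sub>R v) \<in> W" by (rule subspace_scale[OF sub[OF W]])
  then show "v \<in> W" using w(2) by simp
qed

text \<open>Take finitely many \<open>A \<in> G\<close> with \<open>f \<bullet> (A v) \<noteq> 0\<close> such that the vectors \<open>A v\<close> span and the vectors \<open>A\<^sup>T f\<close> span.  A member of a permuted family either
  contains \<open>v\<close> or lies in the kernel of \<open>f\<close>, and the condition \<open>f \<bullet> (A v) \<noteq> 0\<close> prevents \<open>A\<close> from taking the first kind to the second.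
  If members of the first kind exist, each of them contains all \<open>A v\<close>; if not, every \<open>A\<^sup>T f\<close> is orthogonal to all members.
  The finite set makes it possible to choose moduli coprime to all determinants involved.\<close>

lemma finite_irreducible_subset:
  "\<exists>F. finite F \<and> F \<subseteq> G \<and> g \<in> F \<and> family_irreducible F"
proof -
  define S where "S = {A \<in> G. f \<bullet> (A *v v) \<noteq> 0}"
  have span1: "span ((\<lambda>A. A *v v) ` S) = UNIV"
  proof (rule ccontr)
    assume ne: "span ((\<lambda>A. A *v v) ` S) \<noteq> UNIV"
    have "\<exists>A\<in>G. A *v v \<notin> \<Union>{span ((\<lambda>A. A *v v) ` S), {x. f \<bullet> x = 0}}"
      by (rule orbit_escapes[OF v_nz]) (use ne hyperplane_proper[OF f_nz] in auto)
    then show False by (auto simp: S_def intro: span_base)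
  qed
  have span2: "span ((\<lambda>A. transpose A *v f) ` S) = UNIV"
  proof (rule ccontr)
    assume ne: "span ((\<lambda>A. transpose A *v f) ` S) \<noteq> UNIV"
    have "\<exists>A\<in>G. transpose A *v f \<notin> \<Union>{span ((\<lambda>A. transpose A *v f) ` S), {x. v \<bullet> x = 0}}"
      by (rule dual_orbit_escapes) (use ne hyperplane_proper[OF v_nz] in auto)
    then obtain A where A: "A \<in> G" "transpose A *v f \<notin> span ((\<lambda>A. transpose A *v f) ` S)" "v \<bullet> (transpose A *v f) \<noteq> 0"
      by blast
    have "v \<bullet> (transpose A *v f) = f \<bullet> (A *v v)"
      by (metis inner_commute dot_lmul_matrix transpose_matrix_vector)
    then have "A \<in> S" using A by (simp add: S_def)
    then show False using A(2) by (blast intro: span_base)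
  qed
  obtain F1 where F1: "finite F1" "F1 \<subseteq> S" "span ((\<lambda>A. A *v v) ` F1) = UNIV"
    using finite_spanning_subset[OF span1] by blast
  obtain F2 where F2: "finite F2" "F2 \<subseteq> S" "span ((\<lambda>A. transpose A *v f) ` F2) = UNIV"
    using finite_spanning_subset[OF span2] by blast
  define F where "F = insert g (F1 \<union> F2)"
  have F: "finite F" "F \<subseteq> G" "g \<in> F" using F1 F2 g_in by (auto simp: F_def S_def)
  have fF: "f \<bullet> (A *v v) \<noteq> 0" if "A \<in> F" for A
    using that F1(2) F2(2) lam by (auto simp: F_def S_def g_v f_v)
  have "family_irreducible F"
    unfolding family_irreducible_def
  proof (rule notI, elim exE conjE)
    fix \<W> :: "(real^'n) set set"
    assume fin: "finite \<W>" and ne: "\<W> \<noteq> {}"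
      and sub: "\<forall>W\<in>\<W>. subspace W \<and> W \<noteq> {0} \<and> W \<noteq> UNIV"
      and stable: "\<forall>A\<in>F. \<forall>W\<in>\<W>. (*v) A ` W \<in> \<W>"
    have dich: "v \<in> W \<or> W \<subseteq> {x. f \<bullet> x = 0}" if "W \<in> \<W>" for W
      by (rule invariant_family_dichotomy[OF fin _ _ that]) (use sub stable F(3) in auto)
    define \<V> where "\<V> = {W \<in> \<W>. v \<in> W}"
    show False
    proof (cases "\<V> = {}")
      case False
      then obtain V where V: "V \<in> \<V>" by blast
      have "A *v v \<in> V" if A: "A \<in> F" for A
      proof -
        \<comment> \<open>Hence every member is the image of a member containing \<open>v\<close>.\<close>
        have "(`) ((*v) A) ` \<V> = \<V>"
        proof (rule image_family_eq)
          show "finite \<V>" using fin by (simp add: \<V>_def)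
          show "invertible A" using A F(2) invertible by blast
          fix W assume W: "W \<in> \<V>"
          then have "(*v) A ` W \<in> \<W>" using stable A by (simp add: \<V>_def)
          moreover have "A *v v \<in> (*v) A ` W" using W by (simp add: \<V>_def)
          ultimately show "(*v) A ` W \<in> \<V>"
            using dich[of "(*v) A ` W"] fF[OF A] unfolding \<V>_def by blast
        qed
        then obtain W where "W \<in> \<V>" "V = (*v) A ` W" using V by blast
        then show ?thesis by (simp add: \<V>_def)
      qed
      then have "(\<lambda>A. A *v v) ` F1 \<subseteq> V" by (auto simp: F_def)
      moreover have V': "subspace V" "V \<noteq> UNIV" using V sub by (auto simp: \<V>_def)
      ultimately have "span ((\<lambda>A. A *v v) ` F1) \<subseteq> V" by (intro span_minimal)
      then show False using F1(3) V'(2) by blast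
    next
      case True
      obtain W where W: "W \<in> \<W>" using ne by blast
      then obtain w where w: "w \<in> W" "w \<noteq> 0" using sub subspace_0 by blast
      have "(\<lambda>A. transpose A *v f) ` F2 \<subseteq> {x. w \<bullet> x = 0}"
      proof
        fix y assume "y \<in> (\<lambda>A. transpose A *v f) ` F2"
        then obtain A where A: "A \<in> F2" "y = transpose A *v f" by blast
        then have "(*v) A ` W \<in> \<W>" using stable W by (simp add: F_def)
        then have "f \<bullet> (A *v w) = 0" using dich[of "(*v) A ` W"] True w(1) unfolding \<V>_def by blast
        then show "y \<in> {x. w \<bullet> x = 0}"
          unfolding A(2) mem_Collect_eq by (metis inner_commute dot_lmul_matrix transpose_matrix_vector)
      qed
      then have "span ((\<lambda>A. transpose A *v f) ` F2) \<subseteq> {x. w \<bullet> x = 0}"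
        by (intro span_minimal subspace_hyperplane)
      then have "w \<in> {x. w \<bullet> x = 0}" using F2(3) by blast
      then show False using w(2) by simp
    qed
  qed
  then show ?thesis using F by blast
qed

end

section \<open>Finite orbits on the torus and difference sets\<close>

definition rational_vectors :: "(real^'n) set" where
  "rational_vectors = {x. \<exists>q::nat. q > 0 \<and> real q *\<^sub>R x \<in> int_lattice}"

text \<open>Cramer's rule: multiplying \<open>y\<close> by the determinant of \<open>M\<close> gives integers.\<close>

lemma int_matrix_rational_solution:
  fixes M :: "real^'n^'n"
  assumes M: "\<And>i j. M $ i $ j \<in> \<int>" and det: "det M \<noteq> 0" and y: "M *v y \<in> int_lattice"
  shows "y \<in> rational_vectors"
proof -
  have "det M \<in> \<int>" by (rule det_Ints) (rule M)
  then obtain d where d: "det M = real_of_int d" by (auto elim: Ints_cases)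
  have ints: "det M * y $ k \<in> \<int>" for k
  proof -
    have "det (\<chi> i j. if j = k then (M *v y) $ i else M $ i $ j) \<in> \<int>"
      using y M by (intro det_Ints) (auto simp: int_lattice_def)
    then show ?thesis by (simp add: cramer_lemma mult.commute)
  qed
  define q where "q = nat \<bar>d\<bar>"
  have q: "real q = \<bar>det M\<bar>" by (simp add: q_def d)
  have "real q * y $ k \<in> \<int>" for k
    using ints[of k] unfolding q by (cases "det M \<ge> 0") auto
  moreover have "q > 0" using det d by (simp add: q_def)
  ultimately show ?thesis by (auto simp: rational_vectors_def int_lattice_def)
qed

locale integral_proximal_semigroup = proximal_semigroup G g lam v f
  for G :: "(real^'n^'n) set" and g :: "real^'n^'n" and lam :: real and v f :: "real^'n" +
  assumes integral: "A \<in> G \<Longrightarrow> \<exists>M. A = real_mat M"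
begin

lemma entry_Ints: "A \<in> G \<Longrightarrow> A $ i $ j \<in> \<int>"
  using integral[of A] by auto

lemma mpow_in: "n > 0 \<Longrightarrow> mpow g n \<in> G"
  using mpow_closed[OF _ g_in, of n] mult_closed by blast

lemma int_lattice_mult: "A \<in> G \<Longrightarrow> k \<in> int_lattice \<Longrightarrow> A *v k \<in> int_lattice"
  using integral[of A] real_mat_int_lattice by blast

lemma torus_proj_mult:
  assumes "A \<in> G" "torus_proj x = torus_proj y"
  shows "torus_proj (A *v x) = torus_proj (A *v y)"
  using assms int_lattice_mult[OF assms(1), of "x - y"]
  by (simp add: torus_proj_eq_iff matrix_vector_mult_diff_distrib)

lemma subsemigroup_integral:
  assumes "H \<subseteq> G" "\<And>A B. A \<in> H \<Longrightarrow> B \<in> H \<Longrightarrow> A ** B \<in> H" "family_irreducible H"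
    and "N > 0" "mpow g N \<in> H"
  shows "integral_proximal_semigroup H (mpow g N) (lam ^ N) v f"
proof -
  interpret H: proximal_semigroup H "mpow g N" "lam ^ N" v f
    by (rule subsemigroup[OF assms])
  show ?thesis by unfold_locales (use assms(1) integral in blast)
qed

text \<open>Whenever \<open>A y\<close> and \<open>B y\<close> agree on the torus, the rows of \<open>A - B\<close> are integer vectors with integer inner product with \<open>y\<close>.  These
  rows span: a vector \<open>w\<close> orthogonal to all of them would satisfy \<open>A w = B w\<close> for all such pairs and so have a finite
  orbit in \<open>\<real>\<^sup>d\<close>.  Hence \<open>y\<close> solves a nonsingular integral linear system.\<close>

lemma finite_orbit_imp_rational:
  assumes fin: "finite ((\<lambda>A. torus_proj (A *v y)) ` G)"
  shows "y \<in> rational_vectors"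
proof -
  define R :: "(real^'n) set" where "R = {row i (A - B) | i A B. A \<in> G \<and> B \<in> G \<and> torus_proj (A *v y) = torus_proj (B *v y)}"
  have row_inner: "row i M \<bullet> x = (M *v x) $ i" for i x and M :: "real^'n^'a"
    by (simp add: row_def inner_vec_def matrix_vector_mult_def)
  have R_int: "r $ j \<in> \<int>" if "r \<in> R" for r :: "real^'n" and j
    using that entry_Ints by (auto simp: R_def row_def)
  have R_y: "r \<bullet> y \<in> \<int>" if r_in: "r \<in> R" for r
  proof -
    obtain i A B where r: "r = row i (A - B)" "torus_proj (A *v y) = torus_proj (B *v y)" "A \<in> G"
      using r_in unfolding R_def by blast
    have "(A *v y - B *v y) $ i \<in> \<int>" using r(2) by (simp add: torus_proj_eq_iff int_lattice_def)
    then show ?thesis by (simp add: r(1) row_inner matrix_vector_mult_diff_rdistrib)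
  qed
  have span_R: "span R = UNIV"
  proof (rule ccontr)
    assume "span R \<noteq> UNIV"
    then obtain w where w: "w \<noteq> 0" "span R \<subseteq> {x. w \<bullet> x = 0}"
      using span_not_univ_subset_hyperplane by blast
    have same: "A *v w = B *v w"
      if "A \<in> G" "B \<in> G" "torus_proj (A *v y) = torus_proj (B *v y)" for A B
    proof -
      have "row i (A - B) \<in> R" for i using that by (auto simp: R_def)
      then have "row i (A - B) \<in> {x. w \<bullet> x = 0}" for i using w(2) span_base[of _ R] by blast
      then have "row i (A - B) \<bullet> w = 0" for i by (simp add: inner_commute)
      then show ?thesis by (simp add: row_inner matrix_vector_mult_diff_rdistrib vec_eq_iff)
    qed
    define F where "F p = (SOME z. \<exists>A\<in>G. torus_proj (A *v y) = p \<and> z = A *v w)" for p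
    have "A *v w = F (torus_proj (A *v y))" if A: "A \<in> G" for A
    proof -
      have "\<exists>B\<in>G. torus_proj (B *v y) = torus_proj (A *v y) \<and> F (torus_proj (A *v y)) = B *v w"
        unfolding F_def by (rule someI_ex) (use A in blast)
      then show ?thesis using same A by metis
    qed
    then have "(\<lambda>A. A *v w) ` G = F ` ((\<lambda>A. torus_proj (A *v y)) ` G)"
      unfolding image_image by (intro image_cong) auto
    then show False using infinite_orbit[OF w(1)] fin by simp
  qed
  obtain B where B: "B \<subseteq> R" "independent B" "R \<subseteq> span B"
    using maximal_independent_subset by blast
  have finB: "finite B" using B(2) by (rule independent_imp_finite)
  have spanB: "span B = UNIV" using span_minimal[OF B(3) subspace_span] span_R by blast
  have "card B = CARD('n)"
  proof -
    have "card B = dim (span B)" using B(2) by (simp add: dim_eq_card_independent)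
    then show ?thesis using spanB by (simp add: dim_UNIV)
  qed
  then obtain h where h: "bij_betw h (UNIV :: 'n set) B"
    using finite_same_card_bij[OF finite_class.finite_UNIV finB] by auto
  define M where "M = (\<chi> i. h i)"
  have hB: "h i \<in> B" for i using h by (auto simp: bij_betw_def)
  have Mx: "(M *v x) $ i = h i \<bullet> x" for x i
    by (simp add: M_def inner_vec_def matrix_vector_mult_def)
  have "det M \<noteq> 0"
  proof
    assume "det M = 0"
    then obtain x where x: "x \<noteq> 0" "M *v x = 0" using det_eq_0_iff_kernel by blast
    have "B \<subseteq> {z. x \<bullet> z = 0}"
    proof
      fix b assume "b \<in> B"
      then obtain i where "b = h i" using h by (auto simp: bij_betw_def)
      then show "b \<in> {z. x \<bullet> z = 0}" using Mx[of x i] x(2) by (simp add: inner_commute)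
    qed
    then have "span B \<subseteq> {z. x \<bullet> z = 0}" by (intro span_minimal subspace_hyperplane)
    then have "x \<in> {z. x \<bullet> z = 0}" using spanB by blast
    then show False using x(1) by simp
  qed
  moreover have "M $ i $ j \<in> \<int>" for i j using R_int B(1) hB by (auto simp: M_def)
  moreover have "M *v y \<in> int_lattice" using R_y B(1) hB by (auto simp: int_lattice_def Mx)
  ultimately show ?thesis by (intro int_matrix_rational_solution)
qed

text \<open>Since \<open>Y\<close> has no rational point it is infinite modulo the lattice, hence has a limit point, and the difference set \<open>Y - Y\<close>
  accumulates at 0.  It is closed because one of the two points can be taken in the unit cube.\<close>

lemma differences_UNIV:
  assumes cl: "closed Y" and per: "lattice_periodic Y" and invar: "mat_invariant G Y"
    and ne: "Y \<noteq> {}" and irrat: "Y \<inter> rational_vectors = {}"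
  shows "\<exists>a\<in>Y. a + t \<in> Y"
proof -
  define Z where "Z = (\<Union>x\<in>Y \<inter> cbox 0 1. \<Union>y\<in>Y. {x - y})"
  have Z_eq: "Z = {x - y | x y. x \<in> Y \<and> y \<in> Y}"
  proof
    show "{x - y | x y. x \<in> Y \<and> y \<in> Y} \<subseteq> Z"
    proof
      fix z assume "z \<in> {x - y | x y. x \<in> Y \<and> y \<in> Y}"
      then obtain x y where xy: "x \<in> Y" "y \<in> Y" "z = x - y" by blast
      obtain x' where x': "x' \<in> Y \<inter> cbox 0 1" "torus_proj x' = torus_proj x"
        using bounded_representative[OF per xy(1)] by blast
      then have "x' - x \<in> int_lattice" by (simp add: torus_proj_eq_iff)
      then have "y + (x' - x) \<in> Y" using per xy(2) by (auto simp: lattice_periodic_def)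
      moreover have "z = x' - (y + (x' - x))" using xy by simp
      ultimately show "z \<in> Z" using x'(1) unfolding Z_def by blast
    qed
  qed (auto simp: Z_def)
  obtain y0 where y0: "y0 \<in> Y" using ne by blast
  have "infinite (torus_proj ` Y)"
  proof
    assume fin: "finite (torus_proj ` Y)"
    have "(\<lambda>A. torus_proj (A *v y0)) ` G \<subseteq> torus_proj ` Y"
      using invar y0 by (auto simp: mat_invariant_def)
    then have "y0 \<in> rational_vectors" using finite_orbit_imp_rational fin finite_subset by blast
    then show False using irrat y0 by blast
  qed
  then obtain p where p: "p islimpt Y" using infinite_imp_limit_point[OF per] by blast
  then have pY: "p \<in> Y" using cl closed_limpt by blast
  have "Z = UNIV"
  proof (rule accumulation_at_zero_imp_UNIV)
    show "closed Z"
      unfolding Z_def using compact_closed_differences[OF compact_Int_closed[OF compact_cbox cl, of 0 1] cl]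
      by (simp add: Int_commute)
    show "lattice_periodic Z"
      unfolding lattice_periodic_def
    proof (intro ballI)
      fix z k :: "real^'n" assume z: "z \<in> Z" and k: "k \<in> int_lattice"
      then obtain x y where xy: "x \<in> Y" "y \<in> Y" "z = x - y" unfolding Z_eq by blast
      then have "x + k \<in> Y" "z + k = (x + k) - y" using per k by (auto simp: lattice_periodic_def)
      then show "z + k \<in> Z" unfolding Z_eq using xy by blast
    qed
    show "mat_invariant G Z"
      unfolding mat_invariant_def
    proof (intro ballI)
      fix A z assume A: "A \<in> G" and "z \<in> Z"
      then obtain x y where xy: "x \<in> Y" "y \<in> Y" "z = x - y" unfolding Z_eq by blast
      then have "A *v x \<in> Y" "A *v y \<in> Y" "A *v z = A *v x - A *v y"
        using invar A by (auto simp: mat_invariant_def matrix_vector_mult_diff_distrib)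
      then show "A *v z \<in> Z" unfolding Z_eq by blast
    qed
    have "p + (- p) islimpt (\<lambda>y. y + (- p)) ` Y" by (rule islimpt_translation[OF p])
    moreover have "(\<lambda>y. y + (- p)) ` Y \<subseteq> Z" unfolding Z_eq using pY by auto
    ultimately have "p + (- p) islimpt Z" by (rule islimpt_subset)
    then show "0 islimpt Z" by simp
  qed
  then have "t \<in> Z" by simp
  then obtain x y where "x \<in> Y" "y \<in> Y" "t = x - y" unfolding Z_eq by blast
  then show ?thesis by (intro bexI[of _ y]) auto
qed

section \<open>Rational limit points\<close>

text \<open>The return condition \<open>ret\<close> says that the orbit of \<open>c\<close> on the torus is minimal.  It provides, for each of the finitely many orbit points, a
  matrix leading back to \<open>c\<close>, so the stabilizer has finite index.\<close>

lemma stabilizer_semigroup: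
  assumes c: "finite ((\<lambda>A. torus_proj (A *v c)) ` G)"
    and ret: "\<And>A. A \<in> G \<Longrightarrow> \<exists>B\<in>G. torus_proj (B *v (A *v c)) = torus_proj c"
    and p: "p > 0" "torus_proj (mpow g p *v c) = torus_proj c"
  shows "integral_proximal_semigroup {A \<in> G. torus_proj (A *v c) = torus_proj c} (mpow g p) (lam ^ p) v f"
    (is "integral_proximal_semigroup ?H _ _ _ _")
proof (rule subsemigroup_integral)
  show "A ** B \<in> ?H" if "A \<in> ?H" "B \<in> ?H" for A B
    using that mult_closed torus_proj_mult[of A "B *v c" c] by (simp add: matrix_vector_mul_assoc)
  define returns where
    "returns s B \<longleftrightarrow> B \<in> G \<and> (\<forall>x. torus_proj x = s \<longrightarrow> torus_proj (B *v x) = torus_proj c)" for s B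
  define b where "b s = (SOME B. returns s B)" for s
  have b: "b (torus_proj (A *v c)) \<in> G \<and> torus_proj (b (torus_proj (A *v c)) *v (A *v c)) = torus_proj c"
    if A: "A \<in> G" for A
  proof -
    obtain B where B: "B \<in> G" "torus_proj (B *v (A *v c)) = torus_proj c" using ret[OF A] by blast
    then have "returns (torus_proj (A *v c)) B"
      using torus_proj_mult[OF B(1)] unfolding returns_def by metis
    then have "returns (torus_proj (A *v c)) (b (torus_proj (A *v c)))"
      unfolding b_def by (rule someI)
    then show ?thesis unfolding returns_def by blast
  qed
  show "family_irreducible ?H"
  proof (rule family_irreducible_finite_index[OF mult_closed _ invertible irreducible])
    show "finite (b ` ((\<lambda>A. torus_proj (A *v c)) ` G))" using c by simp
    show "b ` ((\<lambda>A. torus_proj (A *v c)) ` G) \<subseteq> G" using b by blast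
    show "\<exists>B\<in>b ` ((\<lambda>A. torus_proj (A *v c)) ` G). B ** A \<in> ?H" if "A \<in> G" for A
      using b[OF that] mult_closed that by (intro bexI[of _ "b (torus_proj (A *v c))"]) (auto simp: matrix_vector_mul_assoc)
  qed (use g_in in auto)
  show "mpow g p \<in> ?H" using p mpow_in by blast
qed (use p in auto)

lemma finite_torsion: "finite (torus_proj ` {x :: real^'n. real q *\<^sub>R x \<in> int_lattice})" if "q > 0"
proof (rule finite_subset)
  let ?S = "(\<lambda>k. real_of_int k / real q) ` {0..<int q}"
  show "torus_proj ` {x :: real^'n. real q *\<^sub>R x \<in> int_lattice} \<subseteq> torus_proj ` {x :: real^'n. \<forall>i. x $ i \<in> ?S}"
  proof
    fix s assume "s \<in> torus_proj ` {x :: real^'n. real q *\<^sub>R x \<in> int_lattice}"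
    then obtain x where x: "real q *\<^sub>R x \<in> int_lattice" "s = torus_proj x" by blast
    have "\<exists>k. real q * x $ i = real_of_int k" for i
      using x(1) by (auto simp: int_lattice_def elim: Ints_cases)
    then obtain k where k: "\<And>i. real q * x $ i = real_of_int (k i)" by metis
    define y :: "real^'n" where "y = (\<chi> i. real_of_int (k i mod int q) / real q)"
    have "x $ i - y $ i = real_of_int (k i div int q)" for i
    proof -
      have "real_of_int (k i) = real_of_int (k i div int q) * real q + real_of_int (k i mod int q)"
        by (metis div_mult_mod_eq of_int_add of_int_mult of_int_of_nat_eq)
      then show ?thesis using k[of i] that by (simp add: y_def field_simps)
    qed
    then have "x - y \<in> int_lattice" by (simp add: int_lattice_def)
    then have "s = torus_proj y" using x(2) by (simp add: torus_proj_eq_iff)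
    moreover have "\<forall>i. y $ i \<in> ?S" using that by (auto simp: y_def)
    ultimately show "s \<in> torus_proj ` {x :: real^'n. \<forall>i. x $ i \<in> ?S}" by blast
  qed
  show "finite (torus_proj ` {x :: real^'n. \<forall>i. x $ i \<in> ?S})"
    by (intro finite_imageI finite_vec_entries) simp
qed

text \<open>Points with a bounded denominator have finite orbits.  Choose a limit point \<open>b\<close> of denominator \<open>q\<close> whose orbit has least
  cardinality; then the orbit of every image \<open>A b\<close> is the same set.  Among the images under powers of \<open>g\<close> some \<open>c\<close> is fixed on the torus by a
  further power of \<open>g\<close>, and translating by \<open>- c\<close> reduces the claim to accumulation at 0 for the stabilizer of \<open>c\<close>.\<close>

lemma rational_limit_point_imp_UNIV:
  assumes cl: "closed X" and per: "lattice_periodic X" and invar: "mat_invariant G X"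
    and a: "a islimpt X" "a \<in> rational_vectors"
  shows "X = UNIV"
proof -
  obtain q :: nat where q: "q > 0" "real q *\<^sub>R a \<in> int_lattice" using a(2) by (auto simp: rational_vectors_def)
  define B where "B = {b. b islimpt X \<and> real q *\<^sub>R b \<in> int_lattice}"
  have B_inv: "A *v b \<in> B" if "A \<in> G" "b \<in> B" for A b
    using derived_mat_invariant[OF invertible invar] that int_lattice_mult[of A "real q *\<^sub>R b"]
    by (auto simp: B_def mat_invariant_def matrix_vector_mult_scaleR)
  define orb where "orb x = (\<lambda>A. torus_proj (A *v x)) ` G" for x
  have orb_fin: "finite (orb b)" if "b \<in> B" for b
  proof (rule finite_subset)
    show "orb b \<subseteq> torus_proj ` {x. real q *\<^sub>R x \<in> int_lattice}"
      using B_inv[OF _ that] by (auto simp: orb_def B_def)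
  qed (rule finite_torsion[OF q(1)])
  have "a \<in> B" using a q by (simp add: B_def)
  then obtain b where b: "b \<in> B" "\<And>x. x \<in> B \<Longrightarrow> card (orb b) \<le> card (orb x)"
    using ex_has_least_nat[of "\<lambda>x. x \<in> B" a "\<lambda>x. card (orb x)"] by blast
  have orb_eq: "orb (A *v b) = orb b" if A: "A \<in> G" for A
  proof (rule card_seteq[OF orb_fin[OF b(1)]])
    show "orb (A *v b) \<subseteq> orb b" using mult_closed A by (auto simp: orb_def matrix_vector_mul_assoc)
    show "card (orb b) \<le> card (orb (A *v b))" using b B_inv[OF A b(1)] by blast
  qed
  have pow_in: "mpow g (Suc n) \<in> G" for n by (simp only: mpow_in zero_less_Suc)
  obtain i j where ij: "i < j" "torus_proj (mpow g (Suc i) *v b) = torus_proj (mpow g (Suc j) *v b)"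
    using finite_range_collision[OF orb_fin[OF b(1)], of "\<lambda>n. torus_proj (mpow g (Suc n) *v b)"] pow_in
    by (auto simp: orb_def)
  define c where "c = mpow g (Suc i) *v b"
  define p where "p = j - i"
  have p: "p > 0" using ij by (simp add: p_def)
  have c: "c \<in> B" "orb c = orb b" unfolding c_def by (rule B_inv[OF pow_in b(1)], rule orb_eq[OF pow_in])
  have "Suc j = p + Suc i" using ij(1) by (simp add: p_def)
  then have per_c: "torus_proj (mpow g p *v c) = torus_proj c"
    using ij(2) by (simp only: c_def matrix_vector_mul_assoc mpow_add)
  have c_in: "torus_proj c \<in> orb c"
    using per_c mpow_in[OF p] unfolding orb_def by (metis image_eqI)
  have ret: "\<exists>C\<in>G. torus_proj (C *v (A *v c)) = torus_proj c" if A: "A \<in> G" for A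
  proof -
    have "orb (A *v c) = orb c"
      using orb_eq[OF mult_closed[OF A pow_in]] c(2) by (simp add: c_def matrix_vector_mul_assoc)
    then have "torus_proj c \<in> orb (A *v c)" using c_in by simp
    then show ?thesis unfolding orb_def by (metis (no_types, lifting) imageE)
  qed
  define H where "H = {A \<in> G. torus_proj (A *v c) = torus_proj c}"
  interpret H: integral_proximal_semigroup H "mpow g p" "lam ^ p" v f
    unfolding H_def by (rule stabilizer_semigroup[OF _ ret p per_c]) (use orb_fin[OF c(1)] in \<open>auto simp: orb_def\<close>)
  define Z where "Z = {x. x + c \<in> X}"
  have "Z = UNIV"
  proof (rule H.accumulation_at_zero_imp_UNIV)
    have "Z = (\<lambda>x. x + c) -` X" by (auto simp: Z_def)
    then show "closed Z" using cl by (simp add: closed_vimage continuous_intros)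
    show "lattice_periodic Z"
      using per by (auto simp: Z_def lattice_periodic_def add.commute add.left_commute)
    show "mat_invariant H Z"
      unfolding mat_invariant_def
    proof (intro ballI)
      fix A x assume A: "A \<in> H" and x: "x \<in> Z"
      have "A *v (x + c) \<in> X" using A x invar by (simp add: H_def Z_def mat_invariant_def)
      moreover have "A *v (x + c) - (A *v x + c) \<in> int_lattice"
        using A by (simp add: H_def torus_proj_eq_iff matrix_vector_right_distrib)
      ultimately show "A *v x \<in> Z"
        using lattice_periodic_iff[OF per] by (auto simp: Z_def)
    qed
    have "c + (- c) islimpt (\<lambda>y. y + (- c)) ` X" using c(1) by (intro islimpt_translation) (simp add: B_def)
    moreover have "(\<lambda>y. y + (- c)) ` X \<subseteq> Z" by (auto simp: Z_def)
    ultimately have "c + (- c) islimpt Z" by (rule islimpt_subset)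
    then show "0 islimpt Z" by simp
  qed
  then have "x - c \<in> Z" for x by simp
  then show ?thesis by (auto simp: Z_def)
qed

end

section \<open>Integer matrices modulo an integer\<close>

definition mat_mod :: "int \<Rightarrow> int^'n^'m \<Rightarrow> int^'n^'m" where
  "mat_mod t A = (\<chi> i j. A $ i $ j mod t)"

lemma mat_mod_eq_iff: "mat_mod t A = mat_mod t B \<longleftrightarrow> (\<forall>i j. t dvd A $ i $ j - B $ i $ j)"
  by (simp add: mat_mod_def vec_eq_iff mod_eq_dvd_iff)

lemma mat_mod_mult_cong:
  assumes "mat_mod t A = mat_mod t A'" "mat_mod t B = mat_mod t B'"
  shows "mat_mod t (A ** B) = mat_mod t (A' ** B')"
proof -
  have "(\<Sum>k\<in>UNIV. A $ i $ k * B $ k $ j) mod t = (\<Sum>k\<in>UNIV. A' $ i $ k * B' $ k $ j) mod t" for i j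
  proof -
    have "A $ i $ k * B $ k $ j mod t = A' $ i $ k * B' $ k $ j mod t" for k
      using assms by (intro mod_mult_cong) (simp_all add: mat_mod_def vec_eq_iff)
    then have "(\<Sum>k\<in>UNIV. A $ i $ k * B $ k $ j mod t) mod t = (\<Sum>k\<in>UNIV. A' $ i $ k * B' $ k $ j mod t) mod t"
      by simp
    then show ?thesis by (simp only: mod_sum_eq)
  qed
  then show ?thesis by (simp add: mat_mod_def vec_eq_iff matrix_matrix_mult_def)
qed

lemma finite_range_mat_mod:
  assumes "t > 0"
  shows "finite (range (mat_mod t :: int^'n^'m \<Rightarrow> int^'n^'m))"
proof (rule finite_subset)
  show "range (mat_mod t) \<subseteq> {A :: int^'n^'m. \<forall>i. A $ i \<in> {x. \<forall>j. x $ j \<in> {0..<t}}}"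
    using assms by (auto simp: mat_mod_def)
  show "finite {A :: int^'n^'m. \<forall>i. A $ i \<in> {x. \<forall>j. x $ j \<in> {0..<t}}}"
    by (intro finite_vec_entries) simp
qed

lemma det_dvd_column:
  fixes C :: "int^'n^'n"
  assumes "\<And>i. t dvd C $ i $ k"
  shows "t dvd det C"
  unfolding det_def
proof (intro dvd_sum dvd_mult)
  fix p assume "p \<in> {p. p permutes (UNIV :: 'n set)}"
  then have "surj p" by (auto dest: permutes_surj)
  then obtain i where "p i = k" by (metis surjD)
  then have "t dvd C $ i $ p i" using assms by simp
  also have "C $ i $ p i dvd (\<Prod>i\<in>UNIV. C $ i $ p i)" by (intro dvd_prodI) auto
  finally show "t dvd (\<Prod>i\<in>UNIV. C $ i $ p i)" .
qed

lemma cramer_lemma_int: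
  fixes A :: "int^'n^'n"
  shows "det (\<chi> i j. if j = k then (A *v x) $ i else A $ i $ j) = x $ k * det A"
proof -
  let ?x = "\<chi> i. real_of_int (x $ i)"
  have "real_mat (\<chi> i j. if j = k then (A *v x) $ i else A $ i $ j) =
     (\<chi> i j. if j = k then (real_mat A *v ?x) $ i else real_mat A $ i $ j)"
    by (simp add: vec_eq_iff matrix_vector_mult_def)
  then have "real_of_int (det (\<chi> i j. if j = k then (A *v x) $ i else A $ i $ j)) = ?x $ k * det (real_mat A)"
    unfolding det_real_mat[symmetric] by (simp only: cramer_lemma)
  also have "\<dots> = real_of_int (x $ k * det A)" by (simp add: det_real_mat)
  finally show ?thesis by (simp only: of_int_eq_iff)
qed

text \<open>Cramer's rule for the columns of \<open>B - C\<close>: the determinant of \<open>A\<close> times each entry is divisible by \<open>t\<close>.\<close>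

lemma mat_mod_cancel:
  fixes A :: "int^'n^'n"
  assumes cop: "coprime (det A) t" and eq: "mat_mod t (A ** B) = mat_mod t (A ** C)"
  shows "mat_mod t B = mat_mod t C"
  unfolding mat_mod_eq_iff
proof (intro allI)
  fix m k
  define x where "x = (\<chi> i. B $ i $ k - C $ i $ k)"
  have "t dvd (A *v x) $ i" for i
  proof -
    have "(A *v x) $ i = (A ** B) $ i $ k - (A ** C) $ i $ k"
      by (simp add: x_def matrix_vector_mult_def matrix_matrix_mult_def right_diff_distrib sum_subtractf)
    then show ?thesis using eq by (simp add: mat_mod_eq_iff)
  qed
  then have "t dvd det (\<chi> i j. if j = m then (A *v x) $ i else A $ i $ j)"
    by (intro det_dvd_column[where k = m]) simp
  then have "t dvd x $ m * det A" by (simp add: cramer_lemma_int)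
  then have "t dvd x $ m" using cop by (simp add: coprime_dvd_mult_left_iff coprime_commute)
  then show "t dvd B $ m $ k - C $ m $ k" by (simp add: x_def)
qed

lemma power_mat_mod_1:
  fixes A :: "int^'n^'n"
  assumes "coprime (det A) t" "t > 0"
  shows "\<exists>N>0. mat_mod t (mpow A N) = mat_mod t (mat 1)"
proof -
  obtain i j where ij: "i < j" "mat_mod t (mpow A i) = mat_mod t (mpow A j)"
    using finite_range_collision[OF finite_range_mat_mod[OF assms(2)], of "\<lambda>n. mat_mod t (mpow A n)"] by blast
  have "coprime (det (mpow A n)) t" for n
    by (induction n) (use assms(1) in \<open>auto simp: det_mul\<close>)
  moreover have "mat_mod t (mpow A i ** mpow A (j - i)) = mat_mod t (mpow A i ** mat 1)"
    using ij by (simp add: mpow_add[symmetric])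
  ultimately have "mat_mod t (mpow A (j - i)) = mat_mod t (mat 1)" by (rule mat_mod_cancel)
  then show ?thesis using ij(1) by (intro exI[of _ "j - i"]) simp
qed

lemma mat_mod_inverse:
  fixes A :: "int^'n^'n"
  assumes "coprime (det A) t" "t > 0"
  shows "\<exists>N>0. mat_mod t (mpow A N ** A) = mat_mod t (mat 1)"
proof -
  obtain N where N: "N > 0" "mat_mod t (mpow A N) = mat_mod t (mat 1)" using power_mat_mod_1[OF assms] by blast
  have "mat_mod t (mpow A N ** mpow A N) = mat_mod t (mat 1 ** mat 1)"
    by (rule mat_mod_mult_cong[OF N(2) N(2)])
  moreover have "mpow A N ** mpow A N = mpow A (2 * N - 1) ** A"
  proof -
    have "Suc (2 * N - 1) = N + N" using N(1) by simp
    then show ?thesis by (metis mpow_Suc_right mpow_add)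
  qed
  ultimately show ?thesis using N(1) by (intro exI[of _ "2 * N - 1"]) simp
qed

section \<open>Sets without rational points\<close>

context integral_proximal_semigroup
begin

definition congruence_part :: "int \<Rightarrow> (real^'n^'n) set" where
  "congruence_part t = {real_mat M | M. real_mat M \<in> G \<and> coprime (det M) t \<and> mat_mod t M = mat_mod t (mat 1)}"

text \<open>Infinitely many elements of \<open>G\<close> may have a factor in common with \<open>t\<close>; it is enough that the members of a finite irreducible subset do not,
  so \<open>D\<close> is the absolute value of the product of their determinants.\<close>

lemma coprime_part_irreducible:
  "\<exists>D>0. \<forall>t. coprime D t \<longrightarrow>
     g \<in> {real_mat M | M. real_mat M \<in> G \<and> coprime (det M) t} \<and>
     family_irreducible {real_mat M | M. real_mat M \<in> G \<and> coprime (det M) t}"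
proof -
  obtain F where F: "finite F" "F \<subseteq> G" "g \<in> F" "family_irreducible F"
    using finite_irreducible_subset by blast
  have "F \<subseteq> range real_mat" using F(2) integral by blast
  then obtain E where E: "finite E" "F = real_mat ` E"
    using finite_subset_image[OF F(1)] by blast
  define D where "D = (\<Prod>M\<in>E. \<bar>det M\<bar>)"
  have "det M \<noteq> 0" if "M \<in> E" for M
  proof -
    have "invertible (real_mat M)" using that E(2) F(2) invertible by blast
    then show ?thesis by (simp add: invertible_det_nz det_real_mat)
  qed
  then have "D > 0" unfolding D_def by (intro prod_pos) auto
  moreover have "g \<in> {real_mat M | M. real_mat M \<in> G \<and> coprime (det M) t} \<and>
     family_irreducible {real_mat M | M. real_mat M \<in> G \<and> coprime (det M) t}" if t: "coprime D t" for t
  proof -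
    have "F \<subseteq> {real_mat M | M. real_mat M \<in> G \<and> coprime (det M) t}"
    proof
      fix A assume A: "A \<in> F"
      then obtain M where M: "M \<in> E" "A = real_mat M" using E by blast
      have "\<bar>det M\<bar> dvd D" unfolding D_def using E(1) M(1) by (intro dvd_prodI) auto
      then have "coprime (det M) t" using t by (metis abs_dvd_iff coprime_divisors dvd_refl)
      then show "A \<in> {real_mat M | M. real_mat M \<in> G \<and> coprime (det M) t}"
        using M A F(2) by blast
    qed
    then show ?thesis using F(3) family_irreducible_mono[OF F(4)] by blast
  qed
  ultimately show ?thesis by blast
qed

text \<open>Modulo \<open>t\<close> the elements with determinant coprime to \<open>t\<close> have inverses among their own powers.  One such inverse for each residue
  class shows that the congruence part has finite index.\<close>

lemma congruence_part_proximal: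
  "\<exists>D>0. \<forall>t>0. coprime D t \<longrightarrow>
     (\<exists>N. integral_proximal_semigroup (congruence_part t) (mpow g N) (lam ^ N) v f)"
proof -
  obtain D where D: "D > 0" "\<And>t. coprime D t \<Longrightarrow>
     g \<in> {real_mat M | M. real_mat M \<in> G \<and> coprime (det M) t} \<and>
     family_irreducible {real_mat M | M. real_mat M \<in> G \<and> coprime (det M) t}"
    using coprime_part_irreducible by blast
  have "\<exists>N. integral_proximal_semigroup (congruence_part t) (mpow g N) (lam ^ N) v f"
    if t: "t > 0" "coprime D t" for t
  proof -
    define E where "E = {M. real_mat M \<in> G \<and> coprime (det M) t}"
    have E_mult: "A ** B \<in> E" if "A \<in> E" "B \<in> E" for A B
      using that mult_closed by (simp add: E_def real_mat_mult det_mul)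
    have E_eq: "{real_mat M | M. real_mat M \<in> G \<and> coprime (det M) t} = real_mat ` E"
      by (auto simp: E_def)
    have E_pow: "mpow A n \<in> E" if "A \<in> E" "n > 0" for A n
      using mpow_closed[of E A n] E_mult that by blast
    obtain \<gamma> where \<gamma>: "\<gamma> \<in> E" "g = real_mat \<gamma>" using D(2)[OF t(2)] unfolding E_eq by blast
    have irr: "family_irreducible (real_mat ` E)" using D(2)[OF t(2)] unfolding E_eq by blast
    have cop: "coprime (det A) t" if "A \<in> E" for A using that by (simp add: E_def)
    define undoes where "undoes r B \<longleftrightarrow> B \<in> E \<and> (\<forall>A. mat_mod t A = r \<longrightarrow> mat_mod t (B ** A) = mat_mod t (mat 1))" for r B
    define b where "b r = (SOME B. undoes r B)" for r
    have b: "undoes (mat_mod t A) (b (mat_mod t A))" if A: "A \<in> E" for A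
    proof -
      obtain N where N: "N > 0" "mat_mod t (mpow A N ** A) = mat_mod t (mat 1)"
        using mat_mod_inverse[OF cop[OF A] t(1)] by blast
      then have "undoes (mat_mod t A) (mpow A N)"
        unfolding undoes_def using E_pow[OF A N(1)] mat_mod_mult_cong by metis
      then show ?thesis unfolding b_def by (rule someI)
    qed
    have cp: "congruence_part t = real_mat ` {A \<in> E. mat_mod t A = mat_mod t (mat 1)}"
      by (auto simp: congruence_part_def E_def)
    have irr_cp: "family_irreducible (congruence_part t)"
    proof (rule family_irreducible_finite_index[OF _ _ _ irr])
      show "A ** B \<in> real_mat ` E" if "A \<in> real_mat ` E" "B \<in> real_mat ` E" for A B
        using that E_mult by (auto simp: real_mat_mult[symmetric])
      show "real_mat ` E \<noteq> {}" using \<gamma> by blast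
      show "invertible A" if "A \<in> real_mat ` E" for A
        using that invertible by (auto simp: E_def)
      show "finite (real_mat ` b ` mat_mod t ` E)"
        using finite_range_mat_mod[OF t(1)] by (meson finite_imageI finite_subset image_mono subset_UNIV)
      show "real_mat ` b ` mat_mod t ` E \<subseteq> real_mat ` E"
        using b unfolding undoes_def by blast
      fix A assume "A \<in> real_mat ` E"
      then obtain M where M: "M \<in> E" "A = real_mat M" by blast
      have "b (mat_mod t M) ** M \<in> E" "mat_mod t (b (mat_mod t M) ** M) = mat_mod t (mat 1)"
        using b[OF M(1)] E_mult M(1) unfolding undoes_def by blast+
      then have "real_mat (b (mat_mod t M)) ** A \<in> congruence_part t"
        unfolding cp M(2) real_mat_mult[symmetric] by blast
      then show "\<exists>B\<in>real_mat ` b ` mat_mod t ` E. B ** A \<in> congruence_part t"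
        using M(1) by blast
    qed
    obtain N where N: "N > 0" "mat_mod t (mpow \<gamma> N) = mat_mod t (mat 1)"
      using power_mat_mod_1[OF cop[OF \<gamma>(1)] t(1)] by blast
    have "integral_proximal_semigroup (congruence_part t) (mpow g N) (lam ^ N) v f"
    proof (rule subsemigroup_integral[OF _ _ irr_cp N(1)])
      show "congruence_part t \<subseteq> G" by (auto simp: congruence_part_def)
      show "mpow g N \<in> congruence_part t"
        unfolding cp \<gamma>(2) real_mat_mpow[symmetric] using E_pow[OF \<gamma>(1) N(1)] N(2) by blast
      fix A B assume "A \<in> congruence_part t" "B \<in> congruence_part t"
      then obtain M M' where M: "A = real_mat M" "B = real_mat M'" "M \<in> E" "M' \<in> E"
        "mat_mod t M = mat_mod t (mat 1)" "mat_mod t M' = mat_mod t (mat 1)"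
        unfolding cp by blast
      have "mat_mod t (M ** M') = mat_mod t (mat 1 ** mat 1)" by (rule mat_mod_mult_cong[OF M(5,6)])
      then have "M ** M' \<in> {A \<in> E. mat_mod t A = mat_mod t (mat 1)}" using E_mult[OF M(3,4)] by simp
      then show "A ** B \<in> congruence_part t" unfolding cp M(1,2) real_mat_mult[symmetric] by blast
    qed
    then show ?thesis by blast
  qed
  then show ?thesis using D(1) by blast
qed

text \<open>Intersect with one translate after the other.  As every \<open>k \<in> T\<close> is fixed modulo the lattice, the intersections remain
  invariant, and by \<open>differences_UNIV\<close> none of them becomes empty.\<close>

lemma fixed_translates:
  assumes fixed: "\<And>A k. A \<in> G \<Longrightarrow> k \<in> T \<Longrightarrow> A *v k - k \<in> int_lattice" and fin: "finite T"
    and cl: "closed Y" and per: "lattice_periodic Y" and invar: "mat_invariant G Y"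
    and ne: "Y \<noteq> {}" and irrat: "Y \<inter> rational_vectors = {}"
  shows "\<exists>y\<in>Y. \<forall>k\<in>T. y + k \<in> Y"
proof -
  have "\<exists>Z\<subseteq>Y. closed Z \<and> lattice_periodic Z \<and> mat_invariant G Z \<and> Z \<noteq> {} \<and> (\<forall>y\<in>Z. \<forall>k\<in>T. y + k \<in> Y)"
    using fin fixed
  proof (induction T rule: finite_induct)
    case empty
    then show ?case using cl per invar ne by blast
  next
    case (insert k T)
    then obtain Z where Z: "Z \<subseteq> Y" "closed Z" "lattice_periodic Z" "mat_invariant G Z" "Z \<noteq> {}"
      "\<forall>y\<in>Z. \<forall>k\<in>T. y + k \<in> Y" by (metis insertI2)
    define Z' where "Z' = Z \<inter> (\<lambda>y. y + k) -` Z"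
    have "Z \<inter> rational_vectors = {}" using Z(1) irrat by blast
    then obtain a where "a \<in> Z" "a + k \<in> Z" using differences_UNIV[OF Z(2-5)] by blast
    then have "Z' \<noteq> {}" by (auto simp: Z'_def)
    moreover have "closed Z'"
      unfolding Z'_def by (intro closed_Int Z(2) closed_vimage continuous_intros)
    moreover have "lattice_periodic Z'"
      unfolding lattice_periodic_def
    proof (intro ballI)
      fix y l :: "real^'n" assume y: "y \<in> Z'" and l: "l \<in> int_lattice"
      have "y + l \<in> Z" "(y + k) + l \<in> Z" using y l Z(3) by (auto simp: Z'_def lattice_periodic_def)
      then show "y + l \<in> Z'" by (simp add: Z'_def algebra_simps)
    qed
    moreover have "mat_invariant G Z'"
      unfolding mat_invariant_def
    proof (intro ballI)
      fix A y assume A: "A \<in> G" and y: "y \<in> Z'"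
      have "A *v y \<in> Z" "A *v (y + k) \<in> Z" using A y Z(4) by (auto simp: Z'_def mat_invariant_def)
      moreover have "A *v (y + k) - (A *v y + k) \<in> int_lattice"
        using insert.prems[OF A, of k] by (simp add: matrix_vector_right_distrib)
      ultimately show "A *v y \<in> Z'"
        using lattice_periodic_iff[OF Z(3)] by (auto simp: Z'_def)
    qed
    moreover have "Z' \<subseteq> Y" "\<forall>y\<in>Z'. \<forall>k\<in>insert k T. y + k \<in> Y" using Z(1,6) by (auto simp: Z'_def)
    ultimately show ?case by blast
  qed
  then show ?thesis by blast
qed

lemma irrational_imp_UNIV:
  assumes cl: "closed Y" and per: "lattice_periodic Y" and invar: "mat_invariant G Y"
    and ne: "Y \<noteq> {}" and irrat: "Y \<inter> rational_vectors = {}"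
  shows "Y = UNIV"
proof -
  obtain D where D: "D > 0" "\<And>t. t > 0 \<Longrightarrow> coprime D t \<Longrightarrow>
     (\<exists>N. integral_proximal_semigroup (congruence_part t) (mpow g N) (lam ^ N) v f)"
    using congruence_part_proximal by blast
  have approx: "\<exists>y\<in>Y. dist y z < e" if e: "e > 0" for z e
  proof -
    obtain m :: nat where m: "real m > real CARD('n) / e" using reals_Archimedean2 by blast
    \<comment> \<open>Coprime to \<open>D\<close> by construction, and arbitrarily large.\<close>
    define t where "t = 1 + int m * D"
    have "coprime D t" 
    proof (rule coprimeI)
      fix c assume "c dvd D" "c dvd t"
      then have "c dvd t - int m * D" by (intro dvd_diff dvd_mult)
      then show "is_unit c" by (simp add: t_def)
    qed
    have "int m * 1 \<le> int m * D" using D(1) by (intro mult_left_mono) auto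
    then have "t > 0" "int m < t" by (simp_all add: t_def)
    then have t: "t > 0" "real_of_int t > real CARD('n) / e" using m by linarith+
    obtain N where "integral_proximal_semigroup (congruence_part t) (mpow g N) (lam ^ N) v f"
      using D(2)[OF t(1) \<open>coprime D t\<close>] by blast
    then interpret H: integral_proximal_semigroup "congruence_part t" "mpow g N" "lam ^ N" v f .
    define T where "T = {k :: real^'n. \<forall>i. k $ i \<in> (\<lambda>a. real_of_int a / real_of_int t) ` {0..<t}}"
    have finT: "finite T" unfolding T_def by (rule finite_vec_entries) simp
    have fixed: "A *v k - k \<in> int_lattice" if A: "A \<in> congruence_part t" and k: "k \<in> T" for A k
    proof -
      obtain M where M: "A = real_mat M" "mat_mod t M = mat_mod t (mat 1)"
        using A by (auto simp: congruence_part_def)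
      have "(A *v k - k) $ i \<in> \<int>" for i
      proof -
        have "(A *v k - k) $ i = ((real_mat (M - mat 1)) *v k) $ i"
        proof -
          have "real_mat (M - mat 1) = A - mat 1" by (simp add: M(1) vec_eq_iff mat_def)
          then show ?thesis by (simp add: matrix_vector_mult_diff_rdistrib)
        qed
        also have "\<dots> = (\<Sum>j\<in>UNIV. real_of_int ((M - mat 1) $ i $ j) * k $ j)"
          by (simp add: matrix_vector_mult_def)
        also have "\<dots> \<in> \<int>"
        proof (rule Ints_sum)
          fix j
          have "t dvd (M - mat 1) $ i $ j" using M(2) by (simp add: mat_mod_eq_iff)
          then obtain c where c: "(M - mat 1) $ i $ j = t * c" by blast
          obtain a where a: "k $ j = real_of_int a / real_of_int t" using k by (auto simp: T_def)
          show "real_of_int ((M - mat 1) $ i $ j) * k $ j \<in> \<int>"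
            unfolding c a using t(1) by simp
        qed
        finally show ?thesis .
      qed
      then show ?thesis by (simp add: int_lattice_def)
    qed
    have "mat_invariant (congruence_part t) Y"
      using invar by (auto simp: mat_invariant_def congruence_part_def)
    from H.fixed_translates[OF fixed finT cl per this ne irrat]
    obtain y where y: "y \<in> Y" "\<And>k. k \<in> T \<Longrightarrow> y + k \<in> Y" by blast
    define b where "b i = \<lfloor>real_of_int t * (z $ i - y $ i)\<rfloor>" for i
    define k :: "real^'n" where "k = (\<chi> i. real_of_int (b i mod t) / real_of_int t)"
    define l :: "real^'n" where "l = (\<chi> i. real_of_int (b i div t))"
    have "k \<in> T" using t(1) by (auto simp: T_def k_def)
    then have in_Y: "y + k + l \<in> Y"
      using y(2) per by (auto simp: lattice_periodic_def l_def int_lattice_def)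
    have comp: "\<bar>(z - (y + k + l)) $ i\<bar> < 1 / real_of_int t" for i
    proof -
      have "real_of_int (b i) = real_of_int (b i div t) * real_of_int t + real_of_int (b i mod t)"
        by (metis div_mult_mod_eq of_int_add of_int_mult)
      then have "(k + l) $ i = real_of_int (b i) / real_of_int t"
        using t(1) by (simp add: k_def l_def field_simps)
      then have "(z - (y + k + l)) $ i * real_of_int t = real_of_int t * (z $ i - y $ i) - real_of_int (b i)"
        using t(1) by (simp add: field_simps)
      moreover have "0 \<le> real_of_int t * (z $ i - y $ i) - real_of_int (b i)"
        "real_of_int t * (z $ i - y $ i) - real_of_int (b i) < 1"
        unfolding b_def by linarith+
      ultimately have "\<bar>(z - (y + k + l)) $ i * real_of_int t\<bar> < 1" by simp
      then have "\<bar>(z - (y + k + l)) $ i\<bar> * real_of_int t < 1"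
        using t(1) by (metis abs_mult abs_of_pos of_int_0_less_iff)
      then show ?thesis using t(1) by (simp only: pos_less_divide_eq of_int_0_less_iff)
    qed
    have "norm (z - (y + k + l)) \<le> (\<Sum>i\<in>UNIV. \<bar>(z - (y + k + l)) $ i\<bar>)" by (rule norm_le_l1_cart)
    also have "\<dots> \<le> (\<Sum>i\<in>(UNIV :: 'n set). 1 / real_of_int t)"
      using comp by (intro sum_mono) (simp add: less_imp_le)
    also have "\<dots> = real CARD('n) / real_of_int t" by simp
    also have "\<dots> < e" using t e by (simp add: field_simps)
    finally have "dist (y + k + l) z < e" by (simp add: dist_norm norm_minus_commute)
    then show ?thesis using in_Y by blast
  qed
  have "z \<in> Y" for z
    using closed_approachable[OF cl, of z] approx[of _ z] by simp
  then show ?thesis by (auto simp: set_eq_iff)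
qed

theorem infinite_invariant_imp_UNIV:
  assumes cl: "closed X" and per: "lattice_periodic X" and invar: "mat_invariant G X"
    and inf: "infinite (torus_proj ` X)"
  shows "X = UNIV"
proof -
  define X' where "X' = {x. x islimpt X}"
  have X': "closed X'" "lattice_periodic X'" "mat_invariant G X'" "X' \<noteq> {}"
    using closed_limpts derived_lattice_periodic[OF per] derived_mat_invariant[OF invertible invar]
      infinite_imp_limit_point[OF per inf] by (auto simp: X'_def)
  show ?thesis
  proof (cases "X' \<inter> rational_vectors = {}")
    case True
    then have "X' = UNIV" by (rule irrational_imp_UNIV[OF X'])
    moreover have "X' \<subseteq> X" using cl by (auto simp: X'_def closed_limpt)
    ultimately show ?thesis by blast
  next
    case False
    then show ?thesis
      using rational_limit_point_imp_UNIV[OF cl per invar] by (auto simp: X'_def)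
  qed
qed

end

section \<open>Infinite invariant sets on the torus\<close>

text \<open>A \<open>\<Gamma>\<close>-invariant subset of the torus corresponds to its preimage in \<open>\<real>\<^sup>d\<close>, whose closure has all the required properties.\<close>

lemma ID_property_lift:
  fixes \<Gamma> :: "(int^'n^'n) set"
  assumes "\<And>X. closed X \<Longrightarrow> lattice_periodic X \<Longrightarrow> mat_invariant (real_mat ` \<Gamma>) X \<Longrightarrow>
      infinite (torus_proj ` X) \<Longrightarrow> X = UNIV"
  shows "ID_property \<Gamma>"
  unfolding ID_property_def
proof (intro allI impI, elim conjE)
  fix S :: "'n torus set"
  assume inf: "infinite S" and inv: "\<forall>A\<in>\<Gamma>. torus_act A ` S \<subseteq> S"
  define X where "X = closure (torus_proj -` S)"
  have proj_S: "torus_proj ` (torus_proj -` S) = S"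
    using surj_torus_proj by (rule surj_image_vimage_eq)
  have act: "torus_act A (torus_proj x) = torus_proj (real_mat A *v x)" for A x
    by (simp add: torus_act.abs_eq)
  have "X = UNIV"
  proof (rule assms)
    show "closed X" by (simp add: X_def)
    show "lattice_periodic X"
      unfolding lattice_periodic_def
    proof (intro ballI)
      fix x k :: "real^'n" assume x: "x \<in> X" and k: "k \<in> int_lattice"
      have "(\<lambda>y. y + k) ` (torus_proj -` S) \<subseteq> torus_proj -` S"
      proof
        fix z assume "z \<in> (\<lambda>y. y + k) ` (torus_proj -` S)"
        then obtain y where y: "torus_proj y \<in> S" "z = y + k" by blast
        have "torus_proj z = torus_proj y" using k by (simp add: torus_proj_eq_iff y(2))
        then show "z \<in> torus_proj -` S" using y(1) by simp
      qed
      then have "(\<lambda>y. y + k) ` X \<subseteq> X"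
        unfolding X_def by (intro image_closure_subset) (auto intro!: continuous_intros closure_subset[THEN subsetD])
      then show "x + k \<in> X" using x by blast
    qed
    show "mat_invariant (real_mat ` \<Gamma>) X"
      unfolding mat_invariant_def
    proof (intro ballI)
      fix A x assume "A \<in> real_mat ` \<Gamma>" and x: "x \<in> X"
      then obtain M where M: "M \<in> \<Gamma>" "A = real_mat M" by blast
      have "(*v) A ` (torus_proj -` S) \<subseteq> torus_proj -` S"
      proof
        fix z assume "z \<in> (*v) A ` (torus_proj -` S)"
        then obtain y where y: "torus_proj y \<in> S" "z = A *v y" by blast
        have "torus_proj z = torus_act M (torus_proj y)" by (simp add: act y(2) M(2))
        then show "z \<in> torus_proj -` S" using inv M(1) y(1) by auto
      qed
      then have "(*v) A ` X \<subseteq> X"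
        unfolding X_def
        by (intro image_closure_subset) (auto intro!: closure_subset[THEN subsetD] linear_continuous_on matrix_vector_mul_bounded_linear)
      then show "A *v x \<in> X" using x by blast
    qed
    have "S \<subseteq> torus_proj ` X" using proj_S closure_subset[of "torus_proj -` S"] unfolding X_def by blast
    then show "infinite (torus_proj ` X)" using inf finite_subset by blast
  qed
  show "closure S = UNIV"
  proof (rule ccontr)
    assume "closure S \<noteq> UNIV"
    define U where "U = torus_proj -` (- closure S)"
    have "open (- closure S)" by (rule open_Compl[OF closed_closure])
    then have "open U" by (simp add: U_def open_torus_def)
    moreover have "U \<noteq> {}"
    proof -
      obtain p where "p \<notin> closure S" using \<open>closure S \<noteq> UNIV\<close> by blast
      moreover obtain x where "p = torus_proj x" using surj_torus_proj by (metis surjD)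
      ultimately show ?thesis by (auto simp: U_def)
    qed
    moreover have "U \<inter> torus_proj -` S = {}" using closure_subset[of S] by (auto simp: U_def)
    ultimately show False using \<open>X = UNIV\<close> unfolding X_def by (metis Int_UNIV_right open_Int_closure_eq_empty)
  qed
qed

theorem theorem1p1:
  fixes \<Gamma> :: "(int^'d^'d) set"
  assumes "CARD('d) > 1"
    and "\<Gamma> \<subseteq> M_inv"
    and "\<And>A B. A \<in> \<Gamma> \<Longrightarrow> B \<in> \<Gamma> \<Longrightarrow> A ** B \<in> \<Gamma>"
    and "\<exists>A\<in>\<Gamma>. proximal (real_mat A) \<and> expanding (real_mat A)"
    and "strongly_irreducible (real_mat ` \<Gamma>)"
  shows "ID_property \<Gamma>"
proof -
  obtain A where A: "A \<in> \<Gamma>" "proximal (real_mat A)" "expanding (real_mat A)" using assms(4) by blast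
  obtain l v f where l: "\<bar>l\<bar> > 1" and fv: "f \<bullet> v = 1"
    and lim: "\<And>x. (\<lambda>n. (1 / l ^ n) *\<^sub>R (mpow (real_mat A) n *v x)) \<longlonglongrightarrow> (f \<bullet> x) *\<^sub>R v"
    by (rule proximal_power_limit[OF A(2,3)]) (rule that)
  interpret integral_proximal_semigroup "real_mat ` \<Gamma>" "mpow (real_mat A) 2" "l\<^sup>2" v f
  proof
    show "CARD('d) > 1" by (rule assms(1))
    show "B ** C \<in> real_mat ` \<Gamma>" if "B \<in> real_mat ` \<Gamma>" "C \<in> real_mat ` \<Gamma>" for B C
      using that assms(3) by (auto simp: real_mat_mult[symmetric])
    show "invertible B" if "B \<in> real_mat ` \<Gamma>" for B
      using that assms(2) by (auto simp: M_inv_def)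
    show "family_irreducible (real_mat ` \<Gamma>)"
      by (rule strongly_irreducible_imp_family_irreducible[OF assms(5)])
    have "mpow A 2 \<in> \<Gamma>" using assms(3) A(1) by (intro mpow_closed) auto
    then show "mpow (real_mat A) 2 \<in> real_mat ` \<Gamma>" by (simp only: real_mat_mpow[symmetric]) blast
    have "1 < \<bar>l\<bar>\<^sup>2" using l by (rule one_less_power) simp
    then show "1 < l\<^sup>2" by simp
    show "f \<bullet> v = 1" by (rule fv)
    show "\<exists>M. B = real_mat M" if "B \<in> real_mat ` \<Gamma>" for B using that by blast
    fix x
    have "strict_mono (\<lambda>n::nat. 2 * n)" by (simp add: strict_mono_def)
    from LIMSEQ_subseq_LIMSEQ[OF lim[of x] this]
    show "(\<lambda>n. (1 / (l\<^sup>2) ^ n) *\<^sub>R (mpow (mpow (real_mat A) 2) n *v x)) \<longlonglongrightarrow> (f \<bullet> x) *\<^sub>R v"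
      by (simp only: o_def mpow_mpow power_mult)
  qed
  show ?thesis by (rule ID_property_lift) (rule infinite_invariant_imp_UNIV)
qed

end
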